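(* Let $F=\mathbb{C}$ or $F=\mathbb{R}$, let $n\ge 1$, and let $L$ be an indecomposable solvable (left) Leibniz algebra over $F$ whose nilradical is (isomorphic to) the Heisenberg algebra $H(n)$, with $L\neq \operatorname{nilrad}(L)$. Then $\dim L = 2n+1+f$ for some integer $f$ with $1\le f\le n+1$, and $L$ has a basis $\{S_1,\ldots,S_f,P_1,\ldots,P_n,B_1,\ldots,B_n,H\}$, where $\{H,P_1,\dots,P_n,B_1,\dots,B_n\}$ is a basis of the nilradical, in which the multiplication is as follows. (i) $[P_i,B_j]=-[B_j,P_i]=\delta_{ij}H$ for all $i,j$, and all other products among the elements $H,P_1,\dots,P_n,B_1,\dots,B_n$ are zero. (ii) $[S_\alpha,S_\beta]=r_{\alpha\beta}H$ with $r_{\alpha\beta}\in F$, for all $\alpha,\beta=1,\ldots,f$. (iii) For all $\alpha=1,\dots,f$, left multiplication $L_{S_\alpha}(x)=[S_\alpha,x]$ and right multiplication $R_{S_\alpha}(x)=[x,S_\alpha]$ act on the nilradical by $$L_{S_\alpha}\begin{pmatrix} H \\ P \\ B \end{pmatrix}=\begin{pmatrix} 2a_\alpha & 0 & 0 \\ 0 & a_\alpha I_n+A_\alpha & C_\alpha \\ 0 & D_\alpha & a_\alpha I_n-A_\alpha^T \end{pmatrix}\begin{pmatrix} H \\ P \\ B \end{pmatrix},$$ $$R_{S_\alpha}\begin{pmatrix} H \\ P \\ B \end{pmatrix}=\begin{pmatrix} -2a_\alpha & 0 & 0 \\ \rho_1^\alpha & -a_\alpha I_n-A_\alpha & -C_\alpha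 \\ \rho_2^\alpha & -D_\alpha & -a_\alpha I_n+A_\alpha^T \end{pmatrix}\begin{pmatrix} H \\ P \\ B \end{pmatrix},$$ where $P=(P_1,\dots,P_n)^T$, $B=(B_1,\dots,B_n)^T$, $a_\alpha\in F$, $A_\alpha,C_\alpha,D_\alpha\in F^{n\times n}$ and $\rho_1^\alpha,\rho_2^\alpha\in F^{n\times 1}$. (iv) The matrices $X_\alpha=\begin{pmatrix} A_\alpha & C_\alpha \\ D_\alpha & -A_\alpha^T \end{pmatrix}$ lie in $\mathfrak{sp}(2n,F)$ and commute pairwise. (v) $a_1\in\{0,1\}$ and $a_2=\cdots=a_f=0$. (vi) If $a_1=1$, then $\{X_2,\ldots,X_f\}$ is linearly nilindependent, $r_{\alpha\beta}=0$ for all $\alpha,\beta$, and $\rho_1^\alpha=\rho_2^\alpha=0$ for all $\alpha$; hence $L$ is a Lie algebra. (vii) If $a_1=0$, then $\{X_1,\ldots,X_f\}$ is linearly nilindependent, and for each $\alpha$ the column vector $\rho^\alpha\in F^{2n}$ obtained by stacking $\rho_1^\alpha$ on top of $\rho_2^\alpha$ lies in the nullspace of $X_\alpha$ (the $r_{\alpha\beta}\in F$ being otherwise unspecified).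
   Context: A (left) Leibniz algebra over $F$ is a (finite-dimensional) vector space $L$ over $F$ with a bilinear product $[\cdot,\cdot]$ satisfying $[x,[y,z]]=[[x,y],z]+[y,[x,z]]$ for all $x,y,z\in L$. It is a Lie algebra if in addition $[x,y]=-[y,x]$ for all $x,y$. $L$ is solvable if its derived series $L^{(1)}=[L,L]$, $L^{(k+1)}=[L^{(k)},L^{(k)}]$ reaches $0$; it is nilpotent if its lower central series $L^2=[L,L]$, $L^{k+1}=[L,L^k]$ reaches $0$. The nilradical $\operatorname{nilrad}(L)$ is the unique maximal nilpotent (two-sided) ideal of $L$. $L$ is indecomposable if it is not the direct sum of two nonzero ideals. The Heisenberg algebra $H(n)$ is the $(2n+1)$-dimensional Lie algebra with basis $\{H,P_1,\ldots,P_n,B_1,\ldots,B_n\}$ and products $[P_i,B_j]=-[B_j,P_i]=\delta_{ij}H$, all other products of basis elements being zero. Matrix convention: an equation $T\,(H,P,B)^T=M\,(H,P,B)^T$ for a linear map $T$ means that $T$ is applied entrywise to the column of basis vectors, so that each row of $M$ gives the coordinates of the image of the corresponding basis vector. $\mathfrak{sp}(2n,F)$ is the set of $X\in F^{2n\times 2n}$ with $XK+KX^T=0$, where $K=\begin{pmatrix} 0 & I_n \\ -I_n & 0 \end{pmatrix}$. A finite family of square matrices $\{X_\alpha\}$ is linearly nilindependent if, whenever $\sum_\alpha c_\alpha X_\alpha$ (with $c_\alpha\in F$) is nilpotent, all $c_\alpha=0$ (the empty family is linearly nilindependent). *)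

theory Defs
  imports Complex_Main "Jordan_Normal_Form.Matrix" "Jordan_Normal_Form.Matrix_Kernel"
begin

text \<open>Up to isomorphism the types of this class are exactly the fields of real and of complex
  numbers; it allows one statement to cover both ground fields.\<close>

class real_or_complex = real_field +
  assumes real_or_complex:
    "(\<forall>x. \<exists>s::real. x = s *\<^sub>R 1) \<or>
     (\<exists>i. i * i = -1 \<and> (\<forall>x. \<exists>s t :: real. x = s *\<^sub>R 1 + t *\<^sub>R i))"

instance real :: real_or_complex
  by standard simp

instance complex :: real_or_complex
proof
  have "x = Re x *\<^sub>R 1 + Im x *\<^sub>R \<i>" for x
    by (simp add: complex_eq_iff)
  then show "(\<forall>x::complex. \<exists>s::real. x = s *\<^sub>R 1) \<or>
     (\<exists>i::complex. i * i = -1 \<and> (\<forall>x. \<exists>s t :: real. x = s *\<^sub>R 1 + t *\<^sub>R i))"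
    by (metis i_squared)
qed


section \<open>Leibniz algebras\<close>

text \<open>The algebra is the whole type \<^typ>\<open>'v\<close>; ideals and subalgebras are subsets of it.\<close>

locale leibniz_algebra = vector_space scale
  for scale :: "'k::field \<Rightarrow> 'v::ab_group_add \<Rightarrow> 'v" +
  fixes br :: "'v \<Rightarrow> 'v \<Rightarrow> 'v"
  assumes finite_dim: "\<exists>E. finite E \<and> span E = UNIV"
    and linear_left: "Vector_Spaces.linear scale scale (\<lambda>x. br x y)"
    and linear_right: "Vector_Spaces.linear scale scale (\<lambda>y. br x y)"
    and left_leibniz: "br x (br y z) = br (br x y) z + br y (br x z)"
begin

definition is_lie :: bool where
  "is_lie \<longleftrightarrow> (\<forall>x y. br x y = - br y x)"

definition bracket_set :: "'v set \<Rightarrow> 'v set \<Rightarrow> 'v set" where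
  "bracket_set U V = span {br x y | x y. x \<in> U \<and> y \<in> V}"

primrec derived_series :: "nat \<Rightarrow> 'v set" where
  "derived_series 0 = UNIV"
| "derived_series (Suc k) = bracket_set (derived_series k) (derived_series k)"

definition solvable :: bool where
  "solvable \<longleftrightarrow> (\<exists>k. derived_series k = {0})"

text \<open>The index is shifted by one: \<open>lower_central V k\<close> is $V^{k+1}$.\<close>

primrec lower_central :: "'v set \<Rightarrow> nat \<Rightarrow> 'v set" where
  "lower_central V 0 = V"
| "lower_central V (Suc k) = bracket_set V (lower_central V k)"

definition nilpotent :: "'v set \<Rightarrow> bool" where
  "nilpotent V \<longleftrightarrow> (\<exists>k. lower_central V k = {0})"

definition two_sided_ideal :: "'v set \<Rightarrow> bool" where
  "two_sided_ideal V \<longleftrightarrow> subspace V \<and> (\<forall>x. \<forall>v\<in>V. br x v \<in> V \<and> br v x \<in> V)"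

definition maximal_nilpotent_ideal :: "'v set \<Rightarrow> bool" where
  "maximal_nilpotent_ideal N \<longleftrightarrow> two_sided_ideal N \<and> nilpotent N \<and>
     (\<forall>M. two_sided_ideal M \<and> nilpotent M \<and> N \<subseteq> M \<longrightarrow> M = N)"

definition is_nilradical :: "'v set \<Rightarrow> bool" where
  "is_nilradical N \<longleftrightarrow> maximal_nilpotent_ideal N \<and> (\<forall>M. maximal_nilpotent_ideal M \<longrightarrow> M = N)"

definition indecomposable :: bool where
  "indecomposable \<longleftrightarrow>
     \<not> (\<exists>U V. two_sided_ideal U \<and> two_sided_ideal V \<and> U \<noteq> {0} \<and> V \<noteq> {0} \<and>
            U \<inter> V = {0} \<and> {u + v | u v. u \<in> U \<and> v \<in> V} = UNIV)"

definition is_basis :: "'v list \<Rightarrow> 'v set \<Rightarrow> bool" where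
  "is_basis xs V \<longleftrightarrow> distinct xs \<and> independent (set xs) \<and> span (set xs) = V"


section \<open>The Heisenberg algebra\<close>

text \<open>The indices of \<open>P\<close> and \<open>B\<close> run over $0, \dots, n-1$, in accordance with
  the indexing of matrices.\<close>

definition heis_list :: "nat \<Rightarrow> 'v \<Rightarrow> (nat \<Rightarrow> 'v) \<Rightarrow> (nat \<Rightarrow> 'v) \<Rightarrow> 'v list" where
  "heis_list n H P B = H # map P [0..<n] @ map B [0..<n]"

definition heisenberg_basis ::
    "nat \<Rightarrow> 'v \<Rightarrow> (nat \<Rightarrow> 'v) \<Rightarrow> (nat \<Rightarrow> 'v) \<Rightarrow> 'v set \<Rightarrow> bool" where
  "heisenberg_basis n H P B V \<longleftrightarrow>
     is_basis (heis_list n H P B) V \<and>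
     br H H = 0 \<and>
     (\<forall>i<n. br H (P i) = 0 \<and> br (P i) H = 0 \<and> br H (B i) = 0 \<and> br (B i) H = 0) \<and>
     (\<forall>i<n. \<forall>j<n. br (P i) (P j) = 0 \<and> br (B i) (B j) = 0 \<and>
        br (P i) (B j) = (if i = j then H else 0) \<and>
        br (B j) (P i) = - (if i = j then H else 0))"

text \<open>As $H(n)$ is given by a basis and its multiplication table, an isomorphism with it is
  the same as a basis with this table.\<close>

definition isomorphic_to_heisenberg :: "nat \<Rightarrow> 'v set \<Rightarrow> bool" where
  "isomorphic_to_heisenberg n V \<longleftrightarrow> (\<exists>H P B. heisenberg_basis n H P B V)"

text \<open>$T (xs)^T = M (xs)^T$: the rows of \<open>M\<close> are the coordinates of the images.\<close>

definition acts_by :: "('v \<Rightarrow> 'v) \<Rightarrow> 'v list \<Rightarrow> 'k mat \<Rightarrow> bool" where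
  "acts_by T xs M \<longleftrightarrow>
     (\<forall>i<length xs. T (xs ! i) = (\<Sum>j<length xs. scale (M $$ (i, j)) (xs ! j)))"

end


section \<open>Matrices\<close>

definition symp_form :: "nat \<Rightarrow> 'k::comm_ring_1 mat" where
  "symp_form n = four_block_mat (0\<^sub>m n n) (1\<^sub>m n) (- 1\<^sub>m n) (0\<^sub>m n n)"

definition sp :: "nat \<Rightarrow> 'k::comm_ring_1 mat set" where
  "sp n = {X \<in> carrier_mat (2 * n) (2 * n).
             X * symp_form n + symp_form n * transpose_mat X = 0\<^sub>m (2 * n) (2 * n)}"

definition nilpotent_mat :: "'k::comm_ring_1 mat \<Rightarrow> bool" where
  "nilpotent_mat X \<longleftrightarrow> (\<exists>k. X ^\<^sub>m k = 0\<^sub>m (dim_row X) (dim_row X))"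

text \<open>The sum of the \<open>c \<alpha> \<cdot>\<^sub>m X \<alpha>\<close> is written entrywise because
  matrices of varying dimension have no common zero.\<close>

definition lin_comb_mat ::
    "nat \<Rightarrow> 'i set \<Rightarrow> ('i \<Rightarrow> 'k) \<Rightarrow> ('i \<Rightarrow> 'k mat) \<Rightarrow> 'k::comm_ring_1 mat" where
  "lin_comb_mat m I c X = mat m m (\<lambda>(i, j). \<Sum>\<alpha>\<in>I. c \<alpha> * X \<alpha> $$ (i, j))"

definition lin_nilindependent ::
    "nat \<Rightarrow> 'i set \<Rightarrow> ('i \<Rightarrow> 'k::comm_ring_1 mat) \<Rightarrow> bool" where
  "lin_nilindependent m I X \<longleftrightarrow>
     (\<forall>c. nilpotent_mat (lin_comb_mat m I c X) \<longrightarrow> (\<forall>\<alpha>\<in>I. c \<alpha> = 0))"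

definition X_mat :: "'k::comm_ring_1 mat \<Rightarrow> 'k mat \<Rightarrow> 'k mat \<Rightarrow> 'k mat" where
  "X_mat A C D = four_block_mat A C D (- transpose_mat A)"

definition left_mat :: "nat \<Rightarrow> 'k::comm_ring_1 \<Rightarrow> 'k mat \<Rightarrow> 'k mat \<Rightarrow> 'k mat \<Rightarrow> 'k mat" where
  "left_mat n a A C D =
     four_block_mat (mat 1 1 (\<lambda>_. 2 * a)) (0\<^sub>m 1 (2 * n)) (0\<^sub>m (2 * n) 1)
       (four_block_mat (a \<cdot>\<^sub>m 1\<^sub>m n + A) C D (a \<cdot>\<^sub>m 1\<^sub>m n - transpose_mat A))"

definition right_mat ::
    "nat \<Rightarrow> 'k::comm_ring_1 \<Rightarrow> 'k mat \<Rightarrow> 'k mat \<Rightarrow> 'k mat \<Rightarrow> 'k vec \<Rightarrow> 'k vec \<Rightarrow> 'k mat" where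
  "right_mat n a A C D \<rho>1 \<rho>2 =
     four_block_mat (mat 1 1 (\<lambda>_. - 2 * a)) (0\<^sub>m 1 (2 * n)) (mat_of_cols (2 * n) [\<rho>1 @\<^sub>v \<rho>2])
       (four_block_mat ((- a) \<cdot>\<^sub>m 1\<^sub>m n - A) (- C) (- D) ((- a) \<cdot>\<^sub>m 1\<^sub>m n + transpose_mat A))"

end

theory Submission
  imports Defs "HOL-Library.Function_Algebras" "HOL-Computational_Algebra.Fundamental_Theorem_Algebra"
begin

text \<open>The derived algebra of a solvable algebra is nilpotent (Lie's theorem for the complexified
  adjoint representation), so $[L,L] \subseteq N$, where $N$ is the nilradical; moreover every
  $[x,y]+[y,x]$ lies in the centre $FH$ of $N$, since it annihilates $L$ from the left. Hence a right
  multiplication is the negative of the left multiplication up to $H$-components. Adding an element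
  of $N$ to $x$ removes the $H$-components of $L_x$ on the span of the $P_i, B_i$. For two elements
  $x, y$ normalised in this way, $[x,y] \in N$ acts on $P_i, B_i$ both with values in $FH$ and with
  values in the span of the $P_i, B_i$, so it acts as zero: this gives $[x,y] \in FH$ and the
  commutation of the matrices at once. If $[x,H]=0$ and the matrix of $x$ is nilpotent, then
  $N + Fx$ is a nilpotent ideal and $x \in N$; this is nilindependence. The bound on $f$ holds because
  a commuting family of symplectic matrices over the complex numbers preserves a flag in a
  Lagrangian subspace, whose $n$ weights decide which combinations are nilpotent.\<close>

section \<open>Common weight vectors\<close>

text \<open>Lie's theorem needs eigenvalues, but L may be real. L itself is not complexified: an
  embedding \<phi> of the ground field carries its left multiplications over to operators on
  functions from \<open>nat\<close> to \<open>complex\<close> with support below a bound. Quotient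
  spaces are not formed either: eigenvector statements hold modulo an invariant subspace U, and
  flags grow by one vector at a time.

  The shape of the result is dictated by the linear functional \<open>lam\<close> with [x,H] =
  lam(x) H, which vanishes on N. Since x acts as a derivation, its matrix M on the P_i, B_i
  satisfies M K + K M^T = lam(x) K, so M - (lam(x)/2) I is symplectic; this is the origin of a =
  lam/2 and of the corner entry 2a. A functional can be made to vanish on all but one of the
  S_\<alpha>, and a nonzero value on that one can be scaled to 2: hence a_1 in {0,1} and a_2 = ... =
  a_f = 0. That one vector is also the extra 1 in f \<le> n+1, since X_2, ..., X_f are
  nilindependent in either case.\<close>

locale complex_vector_space = vector_space scale
  for scale :: "complex \<Rightarrow> 'e::ab_group_add \<Rightarrow> 'e" (infixr \<open>*s\<close> 75)
begin

abbreviation endo :: "('e \<Rightarrow> 'e) \<Rightarrow> bool" where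
  "endo \<equiv> Vector_Spaces.linear scale scale"

lemma endo_iff:
  "endo f \<longleftrightarrow> (\<forall>x y. f (x + y) = f x + f y) \<and> (\<forall>c x. f (c *s x) = c *s f x)"
  by (auto simp: Vector_Spaces.linear_iff vector_space_axioms)

lemma endo_0: "endo f \<Longrightarrow> f 0 = 0"
  by (simp add: linear_iff_module_hom module_hom.zero)

text \<open>If no f m depended on its predecessors, arbitrarily long initial segments would be
  independent inside a finite-dimensional span. U only enlarges the span.\<close>

lemma krylov_dependence:
  fixes f :: "nat \<Rightarrow> 'e"
  assumes fin: "finite F" and f: "\<And>i. f i \<in> span F"
  shows "\<exists>m. f m \<in> span (U \<union> f ` {..<m})"
proof (rule ccontr)
  assume "\<not> ?thesis"
  then have nin: "f m \<notin> span (f ` {..<m})" for m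
    by (meson span_mono subsetD Un_upper2)
  have "independent (f ` {..<k}) \<and> card (f ` {..<k}) = k" for k
  proof (induction k)
    case 0
    then show ?case by (simp add: independent_empty)
  next
    case (Suc k)
    have "f k \<notin> f ` {..<k}" using nin[of k] span_base by metis
    then show ?case
      using Suc nin[of k] by (simp add: lessThan_Suc independent_insert)
  qed
  from this[of "Suc (card F)"] independent_span_bound[OF fin, of "f ` {..<Suc (card F)}"] f
  show False by (auto simp: image_subset_iff)
qed

lemma span_Un_lessThan:
  fixes f :: "nat \<Rightarrow> 'e"
  assumes "subspace U" "w \<in> span (U \<union> f ` {..<m})"
  shows "\<exists>c. w - (\<Sum>i<m. c i *s f i) \<in> U"
  using assms(2)
proof (induction m arbitrary: w)
  case 0
  then show ?case using assms(1) by (simp add: span_eq_iff[THEN iffD2])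
next
  case (Suc m)
  have "U \<union> f ` {..<Suc m} = insert (f m) (U \<union> f ` {..<m})" by (auto simp: lessThan_Suc)
  with Suc.prems obtain k where "w - k *s f m \<in> span (U \<union> f ` {..<m})"
    by (auto simp: span_insert)
  from Suc.IH[OF this] obtain c where c: "w - k *s f m - (\<Sum>i<m. c i *s f i) \<in> U" by blast
  have "(\<Sum>i<Suc m. (c(m := k)) i *s f i) = k *s f m + (\<Sum>i<m. c i *s f i)"
    by (simp add: add.commute)
  then have "w - (\<Sum>i<Suc m. (c(m := k)) i *s f i) \<in> U" using c by (metis diff_diff_eq)
  then show ?case by blast
qed

text \<open>Takes the least dependent index; it is positive because f 0 lies outside U. The second
  conclusion records minimality: modulo U and the lower iterates, the coefficient of f p can still
  be read off.\<close>

lemma first_krylov_dependence: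
  assumes "finite F" "\<And>i. f i \<in> span F" "subspace U" "f 0 \<notin> U"
  obtains p where "f (Suc p) \<in> span (U \<union> f ` {..<Suc p})" "f p \<notin> span (U \<union> f ` {..<p})"
proof -
  define m where "m = (LEAST m. f m \<in> span (U \<union> f ` {..<m}))"
  have m: "f m \<in> span (U \<union> f ` {..<m})"
    unfolding m_def using krylov_dependence[OF assms(1,2)] by (rule LeastI_ex)
  have least: "f j \<notin> span (U \<union> f ` {..<j})" if "j < m" for j
    using not_less_Least[of j "\<lambda>m. f m \<in> span (U \<union> f ` {..<m})"] that by (simp add: m_def)
  have "m \<noteq> 0"
  proof
    assume "m = 0"
    then have "f 0 \<in> span U" using m by simp
    then show False using assms(3,4) by (metis span_eq_iff)
  qed
  then obtain p where "m = Suc p" by (cases m) auto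
  with m least that show thesis by blast
qed

text \<open>An eigenvector of the map induced on W modulo U. A monic polynomial P with P(x)v in U
  has a complex root a; writing P = (X - a) q, the vector q(x)v serves.\<close>

lemma eigenvector_mod:
  assumes fin: "finite F" and WF: "W \<subseteq> span F" and U: "subspace U" and W: "subspace W"
    and x: "endo x" and xW: "x ` W \<subseteq> W" and v: "v \<in> W" "v \<notin> U"
  shows "\<exists>w\<in>W. w \<notin> U \<and> (\<exists>a. x w - a *s w \<in> U)"
proof -
  interpret x: Vector_Spaces.linear scale scale x by (rule x)
  define f where "f i = (x ^^ i) v" for i
  have fW: "f i \<in> W" for i using xW v(1) by (induction i) (auto simp: f_def)
  have xf: "x (f i) = f (Suc i)" for i by (simp add: f_def)
  have "f 0 \<notin> U" using v by (simp add: f_def)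
  obtain p where p: "f (Suc p) \<in> span (U \<union> f ` {..<Suc p})" "f p \<notin> span (U \<union> f ` {..<p})"
    using first_krylov_dependence[of F f U, OF fin _ U \<open>f 0 \<notin> U\<close>] fW WF by blast
  from span_Un_lessThan[OF U p(1)]
  obtain c where c: "f (Suc p) - (\<Sum>i<Suc p. c i *s f i) \<in> U" by blast
  \<comment> \<open>The minimal polynomial of v modulo U, read off from the first
    dependence.\<close>
  define P where "P = monom 1 (Suc p) - (\<Sum>i<Suc p. monom (c i) i)"
  have coP: "poly.coeff P i = (if i = Suc p then 1 else 0) - (if i < Suc p then c i else 0)" for i
    by (auto simp: P_def coeff_sum sum.delta)
  have degP: "degree P = Suc p"
    by (rule antisym[OF degree_le le_degree]) (auto simp: coP)
  then have "\<not> constant (poly P)" by (metis constant_degree Zero_not_Suc)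
  then obtain a where "poly P a = 0" using fundamental_theorem_of_algebra by blast
  then obtain q where q: "P = [:-a, 1:] * q" by (auto simp: poly_eq_0_iff_dvd dvd_def)
  have "q \<noteq> 0" using q degP by auto
  then have degq: "degree q = p"
    using degP unfolding q by (subst (asm) degree_mult_eq) auto
  have coPq: "poly.coeff P i = (case i of 0 \<Rightarrow> 0 | Suc j \<Rightarrow> poly.coeff q j) - a * poly.coeff q i" for i
    unfolding q by (simp add: coeff_pCons split: nat.split)
  have qp: "poly.coeff q p = 1"
    using coP[of "Suc p"] coPq[of "Suc p"] degq by (simp add: coeff_eq_0)
  define w where "w = (\<Sum>i<Suc p. poly.coeff q i *s f i)"
  \<comment> \<open>Here w = q(x)v, so this is (x - a) q(x) v = P(x) v.\<close>
  have "x w - a *s w = (\<Sum>i<Suc (Suc p). poly.coeff P i *s f i)"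
  proof -
    have "(\<Sum>i<Suc (Suc p). poly.coeff P i *s f i) =
        (\<Sum>i<Suc (Suc p). (case i of 0 \<Rightarrow> 0 | Suc j \<Rightarrow> poly.coeff q j) *s f i)
        - (\<Sum>i<Suc (Suc p). a *s poly.coeff q i *s f i)"
      unfolding sum_subtractf[symmetric] by (rule sum.cong) (auto simp: coPq scale_left_diff_distrib)
    also have "(\<Sum>i<Suc (Suc p). (case i of 0 \<Rightarrow> 0 | Suc j \<Rightarrow> poly.coeff q j) *s f i)
        = (\<Sum>i<Suc p. poly.coeff q i *s f (Suc i))"
      by (subst sum.lessThan_Suc_shift) simp
    also have "\<dots> = x w" by (simp only: w_def x.sum x.scale xf)
    also have "(\<Sum>i<Suc (Suc p). a *s poly.coeff q i *s f i) = a *s w"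
      using degq by (simp add: w_def scale_sum_right scale_right_distrib coeff_eq_0)
    finally show ?thesis by simp
  qed
  also have "\<dots> = f (Suc p) - (\<Sum>i<Suc p. c i *s f i)"
  proof -
    have "(\<Sum>i<Suc p. poly.coeff P i *s f i) = (\<Sum>i<Suc p. - (c i *s f i))"
      by (rule sum.cong) (auto simp: coP)
    then show ?thesis by (subst sum.lessThan_Suc) (simp add: coP sum_negf)
  qed
  finally have "x w - a *s w \<in> U" using c by simp
  moreover have "w \<in> W"
    unfolding w_def by (intro subspace_sum[OF W] subspace_scale[OF W] fW)
  \<comment> \<open>q is monic of degree p, so w in U would express f p through U and the lower
    iterates.\<close>
  moreover have "w \<notin> U"
  proof
    assume "w \<in> U"
    have "f p = w - (\<Sum>i<p. poly.coeff q i *s f i)" by (simp add: w_def qp)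
    also have "\<dots> \<in> span (U \<union> f ` {..<p})"
      by (intro span_diff span_sum span_scale) (auto intro!: span_base \<open>w \<in> U\<close>)
    finally show False using p(2) by blast
  qed
  ultimately show ?thesis by blast
qed

definition commutator :: "('e \<Rightarrow> 'e) \<Rightarrow> ('e \<Rightarrow> 'e) \<Rightarrow> 'e \<Rightarrow> 'e" where
  "commutator x y = (\<lambda>u. x (y u) - y (x u))"

text \<open>Modulo the span of the lower iterates, \<open>y\<close> maps $x^i v$ to
  $\mu(y) x^i v - i\,\mu([x,y])\, x^{i-1} v$; comparing the coefficients of $x^p v$ in
  $y\, x^{p+1} v$, for the first dependent iterate $x^{p+1}v$, forces $\mu([x,y]) = 0$.\<close>

lemma weight_commutator_zero:
  assumes fin: "finite F" and iter: "\<And>i. (x ^^ i) v \<in> span F"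
    and U: "subspace U" and v: "v \<notin> U"
    and x: "endo x" and xU: "x ` U \<subseteq> U"
    and K: "\<And>y. y \<in> K \<Longrightarrow> endo y" "\<And>y. y \<in> K \<Longrightarrow> y ` U \<subseteq> U"
    and comm: "\<And>y. y \<in> K \<Longrightarrow> commutator x y \<in> K"
    and \<mu>: "\<And>y. y \<in> K \<Longrightarrow> y v - \<mu> y *s v \<in> U"
    and y: "y \<in> K"
  shows "\<mu> (commutator x y) = 0"
proof -
  interpret x: Vector_Spaces.linear scale scale x by (rule x)
  define f where "f i = (x ^^ i) v" for i
  define G where "G i = span (U \<union> f ` {..<i})" for i
  have fG: "f i \<in> G j" if "i < j" for i j using that by (auto simp: G_def intro: span_base)
  have UG: "u \<in> G i" if "u \<in> U" for u i using that by (auto simp: G_def intro: span_base)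
  have Gmono: "u \<in> G j" if "u \<in> G i" "i \<le> j" for u i j
    using that span_mono[of "U \<union> f ` {..<i}" "U \<union> f ` {..<j}"] unfolding G_def by fastforce
  have G: "subspace (G i)" for i by (simp add: G_def)
  have xf: "x (f i) = f (Suc i)" for i by (simp add: f_def)
  have xG: "x u \<in> G (Suc i)" if "u \<in> G i" for u i
    using that unfolding G_def
  proof (induction u rule: span_induct_alt)
    case base
    then show ?case by (simp add: span_zero)
  next
    case (step c w u)
    have "x w \<in> G (Suc i)" using step(1) xU fG UG xf by auto
    then show ?case using step(2) unfolding G_def x.add x.scale by (intro span_add span_scale)
  qed
  \<comment> \<open>For i = 0 the truncated i - 1 is harmless: the factor \<open>of_nat i\<close>
    removes the extra term, and G 0 is the span of U.\<close>
  have key: "z (f i) - \<mu> z *s f i + of_nat i *s \<mu> (commutator x z) *s f (i - 1) \<in> G (i - 1)"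
    if "z \<in> K" for z i using that
  proof (induction i arbitrary: z)
    case 0
    then show ?case using \<mu>[of z] by (auto simp: f_def intro: UG)
  next
    case (Suc i)
    let ?c = "commutator x z"
    note IH = Suc.IH[OF Suc.prems] and IHc = Suc.IH[OF comm[OF Suc.prems]]
    have lower: "?c (f i) - \<mu> ?c *s f i \<in> G i"
    proof (cases i)
      case 0
      then show ?thesis using IHc by simp
    next
      case (Suc j)
      have "of_nat i *s \<mu> (commutator x ?c) *s f (i - 1) \<in> G i"
        by (intro subspace_scale[OF G] fG) (simp add: Suc)
      from subspace_diff[OF G Gmono[OF IHc] this] show ?thesis by simp
    qed
    have up: "x (z (f i)) - \<mu> z *s f (Suc i) + of_nat i *s \<mu> ?c *s f i \<in> G i"
    proof (cases i)
      case 0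
      have "z (f 0) - \<mu> z *s f 0 \<in> U" using \<mu>[OF Suc.prems] by (simp add: f_def)
      then have "x (z (f 0) - \<mu> z *s f 0) \<in> U" using xU by blast
      then show ?thesis using UG 0 by (simp add: x.diff x.scale xf)
    next
      case (Suc j)
      from xG[OF IH] have "x (z (f i)) - \<mu> z *s f (Suc i) + of_nat i *s \<mu> ?c *s f (Suc (i-1)) \<in> G (Suc (i-1))"
        by (simp add: x.diff x.scale x.add xf del: of_nat_Suc)
      then show ?thesis by (simp add: Suc)
    qed
    have "z (f (Suc i)) = x (z (f i)) - ?c (f i)" by (simp add: commutator_def xf)
    then have "z (f (Suc i)) - \<mu> z *s f (Suc i) + of_nat (Suc i) *s \<mu> ?c *s f i
      = (x (z (f i)) - \<mu> z *s f (Suc i) + of_nat i *s \<mu> ?c *s f i) - (?c (f i) - \<mu> ?c *s f i)"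
      by (simp add: algebra_simps)
    then show ?case using subspace_diff[OF G up lower] by (simp only: diff_Suc_1)
  qed
  have "f 0 \<notin> U" using v by (simp add: f_def)
  then obtain p where p: "f (Suc p) \<in> G (Suc p)" "f p \<notin> G p"
    using first_krylov_dependence[OF fin _ U, of f] iter unfolding G_def by (auto simp: f_def)
  interpret y: Vector_Spaces.linear scale scale y by (rule K(1)[OF y])
  \<comment> \<open>On G (Suc p) the map y - \<mu>(y) drops one level. The dependence places f (Suc
    p) in G (Suc p), so this applies to it as well.\<close>
  have yG: "y u - \<mu> y *s u \<in> G p" if "u \<in> G (Suc p)" for u
    using that unfolding G_def[of "Suc p"]
  proof (induction u rule: span_induct_alt)
    case base
    then show ?case by (simp add: subspace_0[OF G])
  next
    case (step c w u)
    have "y w - \<mu> y *s w \<in> G p"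
    proof (cases "w \<in> U")
      case True
      then show ?thesis using K(2)[OF y] by (intro UG subspace_diff[OF U] subspace_scale[OF U]) auto
    next
      case False
      then obtain i where i: "i < Suc p" "w = f i" using step(1) by auto
      show ?thesis
      proof (cases i)
        case 0
        then show ?thesis using key[OF y, of 0] i Gmono by fastforce
      next
        case (Suc j)
        have "of_nat i *s \<mu> (commutator x y) *s f (i - 1) \<in> G p"
          using i Suc by (intro subspace_scale[OF G] fG) auto
        moreover have "y (f i) - \<mu> y *s f i + of_nat i *s \<mu> (commutator x y) *s f (i - 1) \<in> G p"
          using key[OF y, of i] i by (auto intro: Gmono)
        ultimately have "y (f i) - \<mu> y *s f i + of_nat i *s \<mu> (commutator x y) *s f (i - 1)
            - of_nat i *s \<mu> (commutator x y) *s f (i - 1) \<in> G p"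
          by (intro subspace_diff[OF G])
        then show ?thesis using i by simp
      qed
    qed
    then have "c *s (y w - \<mu> y *s w) + (y u - \<mu> y *s u) \<in> G p"
      using step(2) by (intro subspace_add[OF G] subspace_scale[OF G])
    moreover have "y (c *s w + u) - \<mu> y *s (c *s w + u)
        = c *s (y w - \<mu> y *s w) + (y u - \<mu> y *s u)"
      by (simp add: y.add y.scale algebra_simps)
    ultimately show ?case by simp
  qed
  \<comment> \<open>Two descriptions of y on f (Suc p), \<open>key\<close> and \<open>yG\<close>,
    are subtracted. Since \<open>of_nat (Suc p)\<close> is nonzero in characteristic 0, a nonzero
    \<mu>([x,y]) would put f p into G p.\<close>
  have "of_nat (Suc p) *s \<mu> (commutator x y) *s f p \<in> G p"
    using subspace_diff[OF G key[OF y, of "Suc p", unfolded diff_Suc_1] yG[OF p(1)]] by simp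
  then have *: "(of_nat (Suc p) * \<mu> (commutator x y)) *s f p \<in> G p" by simp
  show ?thesis
  proof (rule ccontr)
    assume "\<mu> (commutator x y) \<noteq> 0"
    then have ne: "of_nat (Suc p) * \<mu> (commutator x y) \<noteq> 0" by (simp del: of_nat_Suc)
    from subspace_scale[OF G *, of "inverse (of_nat (Suc p) * \<mu> (commutator x y))"]
    have "f p \<in> G p" by (simp only: scale_scale left_inverse[OF ne] scale_one)
    with p(2) show False by blast
  qed
qed

text \<open>A joint eigenvector modulo U, with an eigenvalue for each operator. Vectors of U qualify
  trivially, so users state v \<notin> U separately.\<close>

definition weight_vector :: "'e set \<Rightarrow> ('e \<Rightarrow> 'e) set \<Rightarrow> 'e \<Rightarrow> bool" where
  "weight_vector U K v \<longleftrightarrow> (\<forall>y\<in>K. \<exists>a. y v - a *s v \<in> U)"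

text \<open>The inductive step of Lie's theorem. The joint weight space V of K is stable under x,
  because y x w = x y w - [x,y] w and \<mu>([x,y]) = 0; so x has an eigenvector modulo U inside
  V.\<close>

lemma weight_vector_extend:
  assumes fin: "finite F" and WF: "W \<subseteq> span F" and U: "subspace U" and W: "subspace W"
    and x: "endo x" and xU: "x ` U \<subseteq> U" and xW: "x ` W \<subseteq> W"
    and K: "\<And>y. y \<in> K \<Longrightarrow> endo y" "\<And>y. y \<in> K \<Longrightarrow> y ` U \<subseteq> U"
    and comm: "\<And>y. y \<in> K \<Longrightarrow> commutator x y \<in> K"
    and v: "v \<in> W" "v \<notin> U" "weight_vector U K v"
  shows "\<exists>w\<in>W. w \<notin> U \<and> weight_vector U (insert x K) w"
proof -
  interpret x: Vector_Spaces.linear scale scale x by (rule x)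
  from v(3) obtain \<mu> where \<mu>: "y v - \<mu> y *s v \<in> U" if "y \<in> K" for y
    unfolding weight_vector_def by metis
  define V where "V = {w \<in> W. \<forall>y\<in>K. y w - \<mu> y *s w \<in> U}"
  have "subspace V"
  proof (rule subspaceI)
    show "0 \<in> V"
      using K(1) subspace_0[OF U] subspace_0[OF W]
      by (auto simp: V_def endo_0)
  next
    fix a b assume ab: "a \<in> V" "b \<in> V"
    have "y (a + b) - \<mu> y *s (a + b) \<in> U" if "y \<in> K" for y
    proof -
      have "y (a + b) - \<mu> y *s (a + b) = (y a - \<mu> y *s a) + (y b - \<mu> y *s b)"
        using K(1)[OF that] by (simp add: endo_iff algebra_simps)
      then show ?thesis using ab that by (simp add: V_def subspace_add[OF U])
    qed
    then show "a + b \<in> V" using ab by (simp add: V_def subspace_add[OF W])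
  next
    fix c a assume a: "a \<in> V"
    have "y (c *s a) - \<mu> y *s (c *s a) \<in> U" if "y \<in> K" for y
    proof -
      have "y (c *s a) - \<mu> y *s (c *s a) = c *s (y a - \<mu> y *s a)"
        using K(1)[OF that] by (simp add: endo_iff algebra_simps)
      then show ?thesis using a that by (simp add: V_def subspace_scale[OF U])
    qed
    then show "c *s a \<in> V" using a by (simp add: V_def subspace_scale[OF W])
  qed
  moreover have "x ` V \<subseteq> V"
  proof safe
    fix w assume w: "w \<in> V"
    have "y (x w) - \<mu> y *s x w \<in> U" if y: "y \<in> K" for y
    proof -
      have "x (y w - \<mu> y *s w) \<in> U" using w y xU by (auto simp: V_def)
      moreover have "commutator x y w - \<mu> (commutator x y) *s w \<in> U"
        using w comm[OF y] by (simp add: V_def)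
      moreover have "\<mu> (commutator x y) = 0"
      proof (rule weight_commutator_zero[of F x v U K \<mu> y, OF fin _ U v(2) x xU K comm \<mu> y])
        fix i
        have "(x ^^ i) v \<in> W" using v(1) xW by (induction i) auto
        then show "(x ^^ i) v \<in> span F" using WF by blast
      qed
      ultimately have "x (y w - \<mu> y *s w) - commutator x y w \<in> U"
        by (simp add: subspace_diff[OF U])
      then show ?thesis by (simp add: x.diff x.scale commutator_def algebra_simps)
    qed
    then show "x w \<in> V" using w xW by (auto simp: V_def)
  qed
  moreover have "V \<subseteq> span F" "v \<in> V" using WF v(1) \<mu> by (auto simp: V_def)
  ultimately obtain w a where "w \<in> V" "w \<notin> U" "x w - a *s w \<in> U"
    using eigenvector_mod[OF fin _ U _ x _ _ v(2), of V] by blast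
  then show ?thesis by (auto simp: V_def weight_vector_def)
qed

lemma exists_common_weight_vector:
  assumes fin: "finite F" and WF: "W \<subseteq> span F" and U: "subspace U" and W: "subspace W"
    and "finite I"
    and x: "\<And>i. i \<in> I \<Longrightarrow> endo (x i)" "\<And>i. i \<in> I \<Longrightarrow> x i ` U \<subseteq> U" "\<And>i. i \<in> I \<Longrightarrow> x i ` W \<subseteq> W"
    and comm: "\<And>i j u. i \<in> I \<Longrightarrow> j \<in> I \<Longrightarrow> x i (x j u) = x j (x i u)"
    and "v \<in> W" "v \<notin> U"
  shows "\<exists>w\<in>W. w \<notin> U \<and> (\<forall>i\<in>I. \<exists>a. x i w - a *s w \<in> U)"
proof -
  \<comment> \<open>The zero map is adjoined so that the family contains the commutators of its
    members, all of which vanish.\<close>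
  have "\<exists>w\<in>W. w \<notin> U \<and> weight_vector U (insert (\<lambda>_. 0) (x ` J)) w" if "J \<subseteq> I" for J
    using finite_subset[OF that \<open>finite I\<close>] that
  proof (induction J)
    case empty
    have "weight_vector U {\<lambda>_. 0} v"
      using subspace_0[OF U] by (auto simp: weight_vector_def intro!: exI[of _ 0])
    then show ?case using \<open>v \<in> W\<close> \<open>v \<notin> U\<close> by auto
  next
    case (insert j J)
    then obtain w where w: "w \<in> W" "w \<notin> U" "weight_vector U (insert (\<lambda>_. 0) (x ` J)) w" by auto
    have zero: "endo (\<lambda>_. 0)" by (simp add: endo_iff)
    have "x j 0 = 0" using x(1)[of j] insert by (simp add: endo_0)
    then have "commutator (x j) y = (\<lambda>_. 0)" if "y \<in> insert (\<lambda>_. 0) (x ` J)" for y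
      using that comm insert by (auto simp: commutator_def fun_eq_iff)
    moreover have "endo y" "y ` U \<subseteq> U" if "y \<in> insert (\<lambda>_. 0) (x ` J)" for y
      using that zero subspace_0[OF U] x(1,2) insert.prems by (auto simp: image_subset_iff)
    ultimately have "\<exists>w\<in>W. w \<notin> U \<and> weight_vector U (insert (x j) (insert (\<lambda>_. 0) (x ` J))) w"
      using insert.prems x by (intro weight_vector_extend[OF fin WF U W _ _ _ _ _ _ w]) auto
    then show ?case by (simp add: insert_commute)
  qed
  from this[OF subset_refl] show ?thesis by (auto simp: weight_vector_def)
qed

end

section \<open>Embedding the ground field into the complex numbers\<close>

text \<open>The alternative for the range serves to pull complex coefficients back to the ground
  field: all of them in the complex case, the real ones in the real case.\<close>

locale complex_embedding =
  fixes \<phi> :: "'k::field \<Rightarrow> complex"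
  assumes \<phi>_add: "\<phi> (x + y) = \<phi> x + \<phi> y"
    and \<phi>_mult: "\<phi> (x * y) = \<phi> x * \<phi> y"
    and \<phi>_1: "\<phi> 1 = 1"
    and range_\<phi>: "surj \<phi> \<or> range \<phi> = \<real>"
begin

lemma \<phi>_0 [simp]: "\<phi> 0 = 0"
  using \<phi>_add[of 0 0] by simp

lemma \<phi>_minus: "\<phi> (- x) = - \<phi> x"
  using \<phi>_add[of x "- x"] by (simp add: eq_neg_iff_add_eq_0 add.commute)

lemma \<phi>_diff: "\<phi> (x - y) = \<phi> x - \<phi> y"
  using \<phi>_add[of x "- y"] by (simp add: \<phi>_minus)

lemma \<phi>_sum: "\<phi> (sum f A) = (\<Sum>a\<in>A. \<phi> (f a))"
  by (induction A rule: infinite_finite_induct) (auto simp: \<phi>_add)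

lemma \<phi>_eq_0_iff [simp]: "\<phi> x = 0 \<longleftrightarrow> x = 0"
proof
  assume "\<phi> x = 0"
  then have "\<phi> (x * inverse x) = 0" by (simp add: \<phi>_mult)
  then show "x = 0" using \<phi>_1 by (cases "x = 0") auto
qed simp

end

lemma exists_complex_embedding:
  "\<exists>\<phi> :: 'k::real_or_complex \<Rightarrow> complex. complex_embedding \<phi>"
  using real_or_complex[where 'a = 'k]
proof
  assume "\<forall>x::'k. \<exists>s::real. x = s *\<^sub>R 1"
  then obtain g where g: "\<And>x::'k. x = g x *\<^sub>R 1" by metis
  have gI: "g x = s" if "x = s *\<^sub>R 1" for x s
    using g[of x] that by (metis scaleR_cancel_right zero_neq_one)
  have "g (x + y) = g x + g y" for x y
    by (rule gI) (metis g scaleR_add_left)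
  moreover have "g (x * y) = g x * g y" for x y
  proof (rule gI)
    have "(g x *\<^sub>R 1) * (g y *\<^sub>R 1) = (g x * g y) *\<^sub>R (1::'k)" by simp
    then show "x * y = (g x * g y) *\<^sub>R 1" using g by metis
  qed
  moreover have "g 1 = 1" by (rule gI) simp
  moreover have "range (\<lambda>x. complex_of_real (g x)) = \<real>"
  proof -
    have "complex_of_real r \<in> range (\<lambda>x. complex_of_real (g x))" for r
      by (rule range_eqI[of _ _ "r *\<^sub>R 1"]) (simp add: gI[OF refl])
    then show ?thesis by (auto elim: Reals_cases)
  qed
  ultimately have "complex_embedding (\<lambda>x. complex_of_real (g x))"
    by unfold_locales auto
  then show ?thesis by blast
next
  assume "\<exists>i::'k. i * i = -1 \<and> (\<forall>x. \<exists>s t :: real. x = s *\<^sub>R 1 + t *\<^sub>R i)"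
  then obtain i :: 'k and s t :: "'k \<Rightarrow> real"
    where i: "i * i = -1" and st: "\<And>x. x = s x *\<^sub>R 1 + t x *\<^sub>R i" by metis
  \<comment> \<open>The class axiom asserts only that coordinates exist. They are unique because a 1
    = - b i gives, after squaring, a^2 = - b^2 with a and b real.\<close>
  have indep: "a = 0 \<and> b = 0" if "a *\<^sub>R 1 + b *\<^sub>R i = 0" for a b :: real
  proof -
    have "(a *\<^sub>R 1) * (a *\<^sub>R 1) = (b *\<^sub>R i) * (b *\<^sub>R i)"
      using that by (metis add_eq_0_iff minus_mult_minus)
    then have "(a * a) *\<^sub>R (1::'k) = (b * b) *\<^sub>R (i * i)" by simp
    then have "(a * a + b * b) *\<^sub>R (1::'k) = 0" by (simp add: i scaleR_add_left)
    then have "a * a + b * b = 0" by simp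
    then show ?thesis by (simp add: sum_squares_eq_zero_iff)
  qed
  have stI: "s x = a \<and> t x = b" if "x = a *\<^sub>R 1 + b *\<^sub>R i" for x a b
  proof -
    have "(s x - a) *\<^sub>R 1 + (t x - b) *\<^sub>R i = (s x *\<^sub>R 1 + t x *\<^sub>R i) - (a *\<^sub>R 1 + b *\<^sub>R i)"
      by (simp add: algebra_simps)
    also have "\<dots> = 0" using that st[of x] by simp
    finally show ?thesis using indep by fastforce
  qed
  define \<phi> where "\<phi> x = Complex (s x) (t x)" for x
  have \<phi>I: "\<phi> x = Complex a b" if "x = a *\<^sub>R 1 + b *\<^sub>R i" for x a b
    using stI[OF that] by (simp add: \<phi>_def)
  have "\<phi> (x + y) = \<phi> x + \<phi> y" for x y
  proof -
    have "(s x *\<^sub>R 1 + t x *\<^sub>R i) + (s y *\<^sub>R 1 + t y *\<^sub>R i)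
        = (s x + s y) *\<^sub>R 1 + (t x + t y) *\<^sub>R i" by (simp add: algebra_simps)
    then have "x + y = (s x + s y) *\<^sub>R 1 + (t x + t y) *\<^sub>R i" using st by metis
    from \<phi>I[OF this] show ?thesis by (simp add: \<phi>_def complex_eq_iff)
  qed
  moreover have "\<phi> (x * y) = \<phi> x * \<phi> y" for x y
  proof -
    have "(s x *\<^sub>R 1 + t x *\<^sub>R i) * (s y *\<^sub>R 1 + t y *\<^sub>R i)
        = (s x * s y) *\<^sub>R 1 + (t x * t y) *\<^sub>R (i * i) + (s x * t y + t x * s y) *\<^sub>R i"
      by (simp add: algebra_simps)
    also have "\<dots> = (s x * s y - t x * t y) *\<^sub>R 1 + (s x * t y + t x * s y) *\<^sub>R i"
      by (simp add: i scaleR_left_diff_distrib)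
    finally have "x * y = (s x * s y - t x * t y) *\<^sub>R 1 + (s x * t y + t x * s y) *\<^sub>R i"
      using st by metis
    from \<phi>I[OF this] show ?thesis by (simp add: \<phi>_def complex_eq_iff)
  qed
  moreover have "\<phi> 1 = 1"
    using \<phi>I[of 1 1 0] by (simp add: complex_eq_iff)
  moreover have "surj \<phi>"
  proof (rule surjI)
    fix z
    show "\<phi> (Re z *\<^sub>R 1 + Im z *\<^sub>R i) = z" using \<phi>I[OF refl] by simp
  qed
  ultimately have "complex_embedding \<phi>" by unfold_locales auto
  then show ?thesis by blast
qed

section \<open>Coordinate vectors\<close>

definition cscale :: "complex \<Rightarrow> (nat \<Rightarrow> complex) \<Rightarrow> nat \<Rightarrow> complex" where
  "cscale c f = (\<lambda>i. c * f i)"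

lemma cscale_apply [simp]: "cscale c f i = c * f i"
  by (simp add: cscale_def)

interpretation cfun: complex_vector_space cscale
  by unfold_locales (auto simp: fun_eq_iff algebra_simps)

lemma sum_fun_apply: "(\<Sum>i\<in>I. f i) j = (\<Sum>i\<in>I. f i j)"
  by (induction I rule: infinite_finite_induct) auto

definition cunit :: "nat \<Rightarrow> nat \<Rightarrow> complex" where
  "cunit i = (\<lambda>j. if j = i then 1 else 0)"

text \<open>Plays the role of C^d inside one fixed type, so that d may depend on the
  algebra.\<close>

definition csupp :: "nat \<Rightarrow> (nat \<Rightarrow> complex) set" where
  "csupp d = {f. \<forall>i\<ge>d. f i = 0}"

lemma csuppD: "f \<in> csupp d \<Longrightarrow> d \<le> i \<Longrightarrow> f i = 0"
  by (simp add: csupp_def)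

lemma subspace_csupp: "cfun.subspace (csupp d)"
  by (rule cfun.subspaceI) (auto simp: csupp_def)

lemma cunit_in_csupp: "i < d \<Longrightarrow> cunit i \<in> csupp d"
  by (auto simp: csupp_def cunit_def)

lemma csupp_expand: "f \<in> csupp d \<Longrightarrow> f = (\<Sum>i<d. cscale (f i) (cunit i))"
proof
  fix j assume "f \<in> csupp d"
  then show "f j = (\<Sum>i<d. cscale (f i) (cunit i)) j"
    by (cases "j < d") (auto simp: sum_fun_apply cunit_def csuppD if_distrib cong: if_cong)
qed

lemma csupp_span: "csupp d \<subseteq> cfun.span (cunit ` {..<d})"
proof
  fix f assume "f \<in> csupp d"
  then have "f = (\<Sum>i<d. cscale (f i) (cunit i))" by (rule csupp_expand)
  also have "\<dots> \<in> cfun.span (cunit ` {..<d})"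
    by (intro cfun.span_sum cfun.span_scale cfun.span_base) auto
  finally show "f \<in> cfun.span (cunit ` {..<d})" .
qed

text \<open>Stated for families, since several operators may have the same weights: a repeated
  vector is itself a relation, and otherwise dependence of the image set can be reindexed.\<close>

lemma (in vector_space) nontrivial_relation:
  assumes "finite I" "finite B" "f ` I \<subseteq> span B" "card B < card I"
  shows "\<exists>c. (\<exists>i\<in>I. c i \<noteq> 0) \<and> (\<Sum>i\<in>I. scale (c i) (f i)) = 0"
proof (cases "inj_on f I")
  case False
  then obtain i j where ij: "i \<in> I" "j \<in> I" "i \<noteq> j" "f i = f j" by (auto simp: inj_on_def)
  let ?c = "\<lambda>l. if l = i then 1 else if l = j then - 1 else 0"
  have "(\<Sum>l\<in>I. scale (?c l) (f l)) = (\<Sum>l\<in>{i, j}. scale (?c l) (f l))"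
    using ij assms(1) by (intro sum.mono_neutral_right) auto
  also have "\<dots> = 0" using ij by simp
  finally show ?thesis using ij(1) by (intro exI[of _ ?c]) auto
next
  case True
  then have "card (f ` I) = card I" by (rule card_image)
  then have "dependent (f ` I)"
    using independent_span_bound[OF assms(2) _ assms(3)] assms(4) by fastforce
  then obtain u where u: "\<exists>v\<in>f ` I. u v \<noteq> 0" "(\<Sum>v\<in>f ` I. scale (u v) v) = 0"
    using assms(1) by (subst (asm) dependent_finite) auto
  from u(2) have "(\<Sum>i\<in>I. scale (u (f i)) (f i)) = 0"
    by (simp add: sum.reindex[OF True])
  with u(1) show ?thesis by (intro exI[of _ "\<lambda>i. u (f i)"]) auto
qed

section \<open>Commuting families in the symplectic Lie algebra\<close>

text \<open>The entries of K as a function of indices over any ring, so that the same symbol serves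
  the ground field and the complex numbers.\<close>

definition symp_entry :: "nat \<Rightarrow> nat \<Rightarrow> nat \<Rightarrow> 'a::ring_1" where
  "symp_entry n i j = (if i < n \<and> j = n + i then 1 else if j < n \<and> i = n + j then - 1 else 0)"

lemma symp_form_index:
  "i < 2 * n \<Longrightarrow> j < 2 * n \<Longrightarrow> symp_form n $$ (i, j) = symp_entry n i j"
  by (auto simp: symp_form_def symp_entry_def index_mat_four_block)

lemma symp_entry_antisym: "symp_entry n i j = - symp_entry n j i"
  by (auto simp: symp_entry_def)

lemma sum_symp_entry:
  fixes g :: "nat \<Rightarrow> 'a::ring_1"
  assumes "i < 2 * n"
  shows "(\<Sum>j<2 * n. symp_entry n i j * g j) = (if i < n then g (n + i) else - g (i - n))"
proof -
  have "(\<Sum>j<2 * n. symp_entry n i j * g j)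
      = (\<Sum>j<2 * n. if j = (if i < n then n + i else i - n)
          then (if i < n then g (n + i) else - g (i - n)) else 0)"
    using assms by (intro sum.cong) (auto simp: symp_entry_def)
  also have "\<dots> = (if i < n then g (n + i) else - g (i - n))"
    using assms by (subst sum.delta) auto
  finally show ?thesis .
qed

lemma sp_index:
  fixes X :: "'k::comm_ring_1 mat"
  assumes "X \<in> carrier_mat (2 * n) (2 * n)"
  shows "X \<in> sp n \<longleftrightarrow> (\<forall>i<2 * n. \<forall>j<2 * n.
    (\<Sum>l<2 * n. X $$ (i, l) * symp_entry n l j) + (\<Sum>l<2 * n. symp_entry n i l * X $$ (j, l)) = 0)"
proof -
  have K: "(symp_form n :: 'k mat) \<in> carrier_mat (2 * n) (2 * n)"
    by (intro carrier_matI) (simp_all add: symp_form_def)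
  have 1: "(X * symp_form n) $$ (i, j) = (\<Sum>l<2 * n. X $$ (i, l) * symp_entry n l j)"
    if "i < 2 * n" "j < 2 * n" for i j
  proof -
    have "(X * symp_form n) $$ (i, j) = (\<Sum>l<2 * n. X $$ (i, l) * symp_form n $$ (l, j))"
      using carrier_matD[OF assms] carrier_matD[OF K] that by (auto simp: scalar_prod_def lessThan_atLeast0)
    then show ?thesis using that by (simp add: symp_form_index)
  qed
  have 2: "(symp_form n * transpose_mat X) $$ (i, j) = (\<Sum>l<2 * n. symp_entry n i l * X $$ (j, l))"
    if "i < 2 * n" "j < 2 * n" for i j
  proof -
    have "(symp_form n * transpose_mat X) $$ (i, j) = (\<Sum>l<2 * n. symp_form n $$ (i, l) * X $$ (j, l))"
      using carrier_matD[OF assms] carrier_matD[OF K] that by (auto simp: scalar_prod_def lessThan_atLeast0)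
    then show ?thesis using that by (simp add: symp_form_index)
  qed
  have dims: "X * symp_form n \<in> carrier_mat (2 * n) (2 * n)"
    "symp_form n * transpose_mat X \<in> carrier_mat (2 * n) (2 * n)"
    using assms K by auto
  have "X * symp_form n + symp_form n * transpose_mat X = 0\<^sub>m (2 * n) (2 * n) \<longleftrightarrow>
    (\<forall>i<2 * n. \<forall>j<2 * n. (X * symp_form n) $$ (i, j) + (symp_form n * transpose_mat X) $$ (i, j) = 0)"
    using carrier_matD[OF dims(1)] carrier_matD[OF dims(2)]
    by (subst mat_eq_iff) (auto simp del: index_mult_mat)
  then show ?thesis using assms by (simp add: sp_def 1 2)
qed

text \<open>The bilinear form f K g^T; the inner sum is already evaluated, as each row of K has a
  single nonzero entry.\<close>

definition symp :: "nat \<Rightarrow> (nat \<Rightarrow> complex) \<Rightarrow> (nat \<Rightarrow> complex) \<Rightarrow> complex" where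
  "symp n f g = (\<Sum>i<2 * n. f i * (if i < n then g (n + i) else - g (i - n)))"

lemma symp_eq: "symp n f g = (\<Sum>i<2 * n. \<Sum>j<2 * n. f i * symp_entry n i j * g j)"
  unfolding symp_def mult.assoc sum_distrib_left[symmetric] by (simp add: sum_symp_entry)

lemma symp_antisym: "symp n f g = - symp n g f"
proof -
  have "symp n f g = (\<Sum>j<2 * n. \<Sum>i<2 * n. f i * symp_entry n i j * g j)"
    unfolding symp_eq by (rule sum.swap)
  also have "\<dots> = (\<Sum>j<2 * n. \<Sum>i<2 * n. - (g j * symp_entry n j i * f i))"
    by (intro sum.cong refl) (subst symp_entry_antisym, simp)
  finally show ?thesis by (simp add: symp_eq sum_negf)
qed

lemma symp_self [simp]: "symp n f f = 0"
  using symp_antisym[of n f f] by simp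

lemma symp_add_left: "symp n (f + f') g = symp n f g + symp n f' g"
  and symp_add_right: "symp n f (g + g') = symp n f g + symp n f g'"
  and symp_scale_left: "symp n (cscale c f) g = c * symp n f g"
  and symp_scale_right: "symp n f (cscale c g) = c * symp n f g"
  by (simp_all add: symp_eq algebra_simps sum.distrib sum_distrib_left)

lemma symp_zero [simp]: "symp n 0 g = 0" "symp n g 0 = 0"
  by (simp_all add: symp_eq)

lemma symp_sum_left: "symp n (\<Sum>i\<in>I. f i) g = (\<Sum>i\<in>I. symp n (f i) g)"
  and symp_sum_right: "symp n g (\<Sum>i\<in>I. f i) = (\<Sum>i\<in>I. symp n g (f i))"
  by (induction I rule: infinite_finite_induct) (auto simp: symp_add_left symp_add_right)

text \<open>K applied to the complex conjugate of u. Since K squared is -1, pairing u with it yields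
  minus the squared norm of u.\<close>

definition symp_star :: "nat \<Rightarrow> (nat \<Rightarrow> complex) \<Rightarrow> nat \<Rightarrow> complex" where
  "symp_star n u = (\<lambda>i. if i < n then cnj (u (n + i)) else if i < 2 * n then - cnj (u (i - n)) else 0)"

lemma symp_star_sum:
  "symp_star n (\<Sum>j\<in>J. cscale (c j) (u j)) = (\<Sum>j\<in>J. cscale (cnj (c j)) (symp_star n (u j)))"
  by (auto simp: fun_eq_iff sum_fun_apply symp_star_def sum_negf)

lemma symp_star_self_eq_0:
  assumes "u \<in> csupp (2 * n)" "symp n u (symp_star n u) = 0"
  shows "u = 0"
proof -
  have "symp n u (symp_star n u) = (\<Sum>i<2 * n. - of_real ((cmod (u i))\<^sup>2))"
    unfolding symp_def
    by (intro sum.cong refl) (auto simp: symp_star_def complex_norm_square[symmetric])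
  then have "of_real (\<Sum>i<2 * n. (cmod (u i))\<^sup>2) = (0::complex)"
    using assms(2) by (simp add: sum_negf)
  then have "(\<Sum>i<2 * n. (cmod (u i))\<^sup>2) = 0" by (simp only: of_real_eq_0_iff)
  then have "u i = 0" if "i < 2 * n" for i using that by (subst (asm) sum_nonneg_eq_0_iff) auto
  then show ?thesis using assms(1) csuppD[of u "2 * n"] by (auto simp: fun_eq_iff not_less[symmetric])
qed

text \<open>The conjugate vectors span a complement of an isotropic subspace \<open>U\<close>, because
  \<open>symp\<close> pairs \<open>u\<close> with \<open>symp_star u\<close> to $-|u|^2$.\<close>

lemma isotropic_bound:
  assumes v: "\<And>i. i < k \<Longrightarrow> v i \<in> csupp (2 * n)"
    and indep: "\<And>c. (\<Sum>i<k. cscale (c i) (v i)) = 0 \<Longrightarrow> \<forall>i<k. c i = 0"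
    and iso: "\<And>i j. i < k \<Longrightarrow> j < k \<Longrightarrow> symp n (v i) (v j) = 0"
  shows "k \<le> n"
proof (rule ccontr)
  assume "\<not> k \<le> n"
  \<comment> \<open>The v's followed by their starred copies: 2k vectors in a space of dimension 2n,
    hence a relation if k > n.\<close>
  define w where "w i = (if i < k then v i else symp_star n (v (i - k)))" for i
  have "w i \<in> csupp (2 * n)" if "i < 2 * k" for i
    using v by (auto simp: w_def csupp_def symp_star_def)
  then have "w ` {..<2 * k} \<subseteq> cfun.span (cunit ` {..<2 * n})" using csupp_span by blast
  moreover have "card (cunit ` {..<2 * n}) < card {..<2 * k}"
    using card_image_le[of "{..<2 * n}" cunit] \<open>\<not> k \<le> n\<close> by simp
  ultimately obtain c where c: "\<exists>i\<in>{..<2 * k}. c i \<noteq> 0" "(\<Sum>i<2 * k. cscale (c i) (w i)) = 0"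
    using cfun.nontrivial_relation[of "{..<2 * k}" "cunit ` {..<2 * n}" w] by auto
  \<comment> \<open>The coefficients are conjugated because \<open>symp_star\<close> is conjugate
    linear; thus \<open>symp_star n u\<close> is exactly the second half of the relation.\<close>
  define u where "u = (\<Sum>j<k. cscale (cnj (c (k + j))) (v j))"
  define t where "t = (\<Sum>i<k. cscale (c i) (v i))"
  have u: "u \<in> csupp (2 * n)"
    unfolding u_def using v
    by (intro cfun.subspace_sum[OF subspace_csupp] cfun.subspace_scale[OF subspace_csupp]) auto
  have "(\<Sum>i<k + k. cscale (c i) (w i)) = t + (\<Sum>j<k. cscale (c (k + j)) (w (k + j)))"
    unfolding t_def sum.nat_group[symmetric] 
    by (subst sum.atLeastLessThan_concat[of 0 k "k + k", symmetric, simplified lessThan_atLeast0[symmetric]])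
      (auto simp: w_def lessThan_atLeast0 sum.atLeastLessThan_shift_0[of _ k "k + k"] add.commute)
  also have "(\<Sum>j<k. cscale (c (k + j)) (w (k + j))) = symp_star n u"
    unfolding u_def symp_star_sum by (simp add: w_def)
  finally have ts: "t + symp_star n u = 0" using c(2) by (simp only: mult_2)
  \<comment> \<open>Pairing the relation t + u* = 0 with u isolates the norm of u. So u = 0, and
    independence of the v's kills both halves of the relation.\<close>
  have "symp n u t = 0"
    unfolding u_def t_def symp_sum_left symp_sum_right symp_scale_left symp_scale_right
    by (simp add: iso)
  then have "symp n u (symp_star n u) = 0"
    using symp_add_right[of n u t "symp_star n u"] by (simp add: ts)
  then have "u = 0" by (rule symp_star_self_eq_0[OF u])
  from indep[OF this[unfolded u_def]] have c2: "\<forall>j<k. c (k + j) = 0" by simp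
  have "symp_star n u = 0" using \<open>u = 0\<close> by (auto simp: symp_star_def fun_eq_iff)
  then have "t = 0" using ts by simp
  from indep[OF this[unfolded t_def]] have "\<forall>i<k. c i = 0" .
  moreover have "c i = 0" if "\<not> i < k" "i < 2 * k" for i
    using c2[rule_format, of "i - k"] that by simp
  ultimately show False using c(1) by auto
qed

definition nilpotent_on :: "nat \<Rightarrow> ((nat \<Rightarrow> complex) \<Rightarrow> nat \<Rightarrow> complex) \<Rightarrow> bool" where
  "nilpotent_on d Z \<longleftrightarrow> (\<exists>m. \<forall>w\<in>csupp d. (Z ^^ m) w = 0)"

definition comb :: "'i set \<Rightarrow> ('i \<Rightarrow> (nat \<Rightarrow> complex) \<Rightarrow> nat \<Rightarrow> complex) \<Rightarrow> ('i \<Rightarrow> complex) \<Rightarrow>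
    (nat \<Rightarrow> complex) \<Rightarrow> nat \<Rightarrow> complex" where
  "comb I x c w = (\<Sum>i\<in>I. cscale (c i) (x i w))"

lemma comb_endo:
  assumes "\<And>i. i \<in> I \<Longrightarrow> cfun.endo (x i)"
  shows "cfun.endo (comb I x c)"
  using assms by (auto simp: comb_def cfun.endo_iff cfun.scale_right_distrib sum.distrib
      cfun.scale_sum_right cfun.scale_left_commute intro!: sum.cong)

text \<open>A maximal flag of invariant isotropic subspaces ends with a Lagrangian subspace \<open>U\<close>. A
  combination on which the (at most \<open>n\<close>) weights vanish is nilpotent on \<open>U\<close> and, by duality,
  on the quotient by $U = U^\perp$.\<close>

lemma commuting_symplectic_nilpotent_combination:
  assumes fin: "finite I" and card: "n < card I"
    and x: "\<And>i. i \<in> I \<Longrightarrow> cfun.endo (x i)" and xE: "\<And>i. i \<in> I \<Longrightarrow> x i ` csupp (2 * n) \<subseteq> csupp (2 * n)"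
    and comm: "\<And>i j u. i \<in> I \<Longrightarrow> j \<in> I \<Longrightarrow> x i (x j u) = x j (x i u)"
    and skew: "\<And>i f g. i \<in> I \<Longrightarrow> symp n (x i f) g = - symp n f (x i g)"
  shows "\<exists>c. (\<exists>i\<in>I. c i \<noteq> 0) \<and> nilpotent_on (2 * n) (comb I x c)"
proof -
  let ?E = "csupp (2 * n)"
  \<comment> \<open>\<open>\<mu> i j\<close> is the weight of \<open>x i\<close> on the j-th step of
    the flag. Isotropy bounds the length by n, so a longest flag exists.\<close>
  define flag where "flag k v \<mu> \<longleftrightarrow> (\<forall>j<k. v j \<in> ?E) \<and>
      (\<forall>c. (\<Sum>i<k. cscale (c i) (v i)) = 0 \<longrightarrow> (\<forall>i<k. c i = 0)) \<and>
      (\<forall>i<k. \<forall>j<k. symp n (v i) (v j) = 0) \<and>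
      (\<forall>i\<in>I. \<forall>j<k. x i (v j) - cscale (\<mu> i j) (v j) \<in> cfun.span (v ` {..<j}))"
    for k :: nat and v \<mu>
  have bound: "k \<le> n" if "flag k v \<mu>" for k v \<mu>
    using that unfolding flag_def by (intro isotropic_bound[of k v n]) blast+
  have "flag 0 v \<mu>" for v \<mu> by (simp add: flag_def)
  then have "\<exists>k. (\<exists>v \<mu>. flag k v \<mu>) \<and> (\<forall>k'. (\<exists>v \<mu>. flag k' v \<mu>) \<longrightarrow> k' \<le> k)"
    using Nat.ex_has_greatest_nat[of "\<lambda>k. \<exists>v \<mu>. flag k v \<mu>" 0 n] bound by blast
  then obtain k v \<mu> where fl: "flag k v \<mu>" and greatest: "\<And>k' v \<mu>. flag k' v \<mu> \<Longrightarrow> k' \<le> k"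
    by blast
  note vE = fl[unfolded flag_def, THEN conjunct1, rule_format]
  note indep = fl[unfolded flag_def, THEN conjunct2, THEN conjunct1, rule_format]
  note iso = fl[unfolded flag_def, THEN conjunct2, THEN conjunct2, THEN conjunct1, rule_format]
  note wt = fl[unfolded flag_def, THEN conjunct2, THEN conjunct2, THEN conjunct2, rule_format]
  define U where "U = cfun.span (v ` {..<k})"
  \<comment> \<open>The orthogonal complement of U, invariant because the operators are skew and
    preserve U.\<close>
  define W where "W = {w \<in> ?E. \<forall>j<k. symp n (v j) w = 0}"
  have U: "cfun.subspace U" by (simp add: U_def)
  have W: "cfun.subspace W"
    by (rule cfun.subspaceI)
      (auto simp: W_def cfun.subspace_0[OF subspace_csupp] cfun.subspace_add[OF subspace_csupp]
        cfun.subspace_scale[OF subspace_csupp] symp_add_right symp_scale_right)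
  have span_mono: "u \<in> cfun.span (v ` {..<j})" if "u \<in> cfun.span (v ` {..<i})" "i \<le> j" for u i j
    using cfun.span_mono[of "v ` {..<i}" "v ` {..<j}"] that by fastforce
  have xv: "x i (v j) \<in> U" if "i \<in> I" "j < k" for i j
  proof -
    have "x i (v j) - cscale (\<mu> i j) (v j) \<in> U"
      using span_mono[OF wt[OF that]] that by (simp add: U_def)
    moreover have "cscale (\<mu> i j) (v j) \<in> U"
      unfolding U_def using that by (intro cfun.span_scale cfun.span_base) auto
    ultimately have "(x i (v j) - cscale (\<mu> i j) (v j)) + cscale (\<mu> i j) (v j) \<in> U"
      by (rule cfun.subspace_add[OF U])
    then show ?thesis by simp
  qed
  have xU: "x i ` U \<subseteq> U" if "i \<in> I" for i
  proof -
    interpret Vector_Spaces.linear cscale cscale "x i" by (rule x[OF that])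
    have "x i ` U = cfun.span (x i ` v ` {..<k})" unfolding U_def by (rule span_image[symmetric])
    also have "\<dots> \<subseteq> U" using xv[OF that] by (intro cfun.span_minimal U) auto
    finally show ?thesis .
  qed
  have orth: "symp n u w = 0" if "u \<in> U" "w \<in> W" for u w
    using that(1) unfolding U_def
  proof (induction u rule: cfun.span_induct_alt)
    case base
    show ?case by (rule symp_zero)
  next
    case (step c u u')
    then have "symp n u w = 0" using that(2) by (auto simp: W_def)
    then show ?case using step(2) by (simp only: symp_add_left symp_scale_left) simp
  qed
  have xW: "x i ` W \<subseteq> W" if "i \<in> I" for i
  proof safe
    fix w assume w: "w \<in> W"
    have "symp n (v j) (x i w) = 0" if "j < k" for j
      using skew[OF \<open>i \<in> I\<close>, of "v j" w] orth[OF xv[OF \<open>i \<in> I\<close> that] w] by simp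
    then show "x i w \<in> W" using w xE[OF that] by (auto simp: W_def)
  qed
  \<comment> \<open>A common weight vector in W outside U would prolong the flag: it is orthogonal
    to U and, the form being alternating, to itself.\<close>
  have WU: "W \<subseteq> U"
  proof (rule ccontr)
    assume "\<not> W \<subseteq> U"
    then obtain w0 where w0: "w0 \<in> W" "w0 \<notin> U" by blast
    have "W \<subseteq> cfun.span (cunit ` {..<2 * n})" using csupp_span by (auto simp: W_def)
    from cfun.exists_common_weight_vector[where x = x, OF _ this U W fin x xU xW comm w0]
    obtain w where w: "w \<in> W" "w \<notin> U" "\<forall>i\<in>I. \<exists>a. x i w - cscale a w \<in> U" by auto
    then obtain a where a: "\<And>i. i \<in> I \<Longrightarrow> x i w - cscale (a i) w \<in> U" by metis
    define v' where "v' = v(k := w)"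
    define \<mu>' where "\<mu>' i = (\<mu> i)(k := a i)" for i
    have v'k: "v' ` {..<j} = v ` {..<j}" if "j \<le> k" for j using that by (auto simp: v'_def)
    have "flag (Suc k) v' \<mu>'"
      unfolding flag_def
    proof (intro conjI allI impI ballI)
      fix j assume "j < Suc k"
      then show "v' j \<in> ?E" using vE w by (auto simp: v'_def W_def less_Suc_eq)
    next
      fix c i assume c: "(\<Sum>i<Suc k. cscale (c i) (v' i)) = 0" and i: "i < Suc k"
      have "(\<Sum>i<Suc k. cscale (c i) (v' i)) = (\<Sum>i<k. cscale (c i) (v i)) + cscale (c k) w"
        by (simp add: v'_def)
      with c have eq: "cscale (c k) w = - (\<Sum>i<k. cscale (c i) (v i))"
        by (simp add: eq_neg_iff_add_eq_0 add.commute)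
      have ck: "c k = 0"
      proof (rule ccontr)
        assume "c k \<noteq> 0"
        then have "w = cscale (inverse (c k)) (cscale (c k) w)" by (auto simp: fun_eq_iff)
        also have "\<dots> \<in> U" unfolding eq U_def
          by (intro cfun.span_scale cfun.span_neg cfun.span_sum cfun.span_base) auto
        finally show False using w by blast
      qed
      then have "(\<Sum>i<k. cscale (c i) (v i)) = 0" using eq by (auto simp: fun_eq_iff)
      from indep[OF this] ck i show "c i = 0" by (auto simp: less_Suc_eq)
    next
      fix i j assume "i < Suc k" "j < Suc k"
      then show "symp n (v' i) (v' j) = 0"
        using iso w symp_antisym[of n w] by (auto simp: v'_def less_Suc_eq W_def)
    next
      fix i j assume i: "i \<in> I" and j: "j < Suc k"
      show "x i (v' j) - cscale (\<mu>' i j) (v' j) \<in> cfun.span (v' ` {..<j})"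
      proof (cases "j = k")
        case True
        then show ?thesis using a[OF i] v'k[of k] by (simp add: v'_def \<mu>'_def U_def)
      next
        case False
        then show ?thesis using wt[OF i] v'k[of j] j by (simp add: v'_def \<mu>'_def)
      qed
    qed
    from greatest[OF this] show False by simp
  qed
  \<comment> \<open>The weights of each operator form a vector of length k, and k \<le> n < card I.
    A relation between these vectors is a combination all of whose weights on the flag
    vanish.\<close>
  have "(\<lambda>i j. if j < k then \<mu> i j else 0) ` I \<subseteq> cfun.span (cunit ` {..<k})"
    using csupp_span[of k] by (auto simp: csupp_def)
  moreover have "card (cunit ` {..<k}) < card I"
    using card_image_le[of "{..<k}" cunit] bound[OF fl] card by simp
  ultimately obtain c where c: "\<exists>i\<in>I. c i \<noteq> 0"
    "(\<Sum>i\<in>I. cscale (c i) (\<lambda>j. if j < k then \<mu> i j else 0)) = 0"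
    using cfun.nontrivial_relation[OF fin, of "cunit ` {..<k}"] by blast
  have c0: "(\<Sum>i\<in>I. c i * \<mu> i j) = 0" if "j < k" for j
    using fun_cong[OF c(2), of j] that by (simp add: sum_fun_apply)
  define Z where "Z = comb I x c"
  have Z: "cfun.endo Z"
    unfolding Z_def by (rule comb_endo[OF x])
  interpret Z: Vector_Spaces.linear cscale cscale Z by (rule Z)
  have Zv: "Z (v j) \<in> cfun.span (v ` {..<j})" if "j < k" for j
  proof -
    have "Z (v j) = (\<Sum>i\<in>I. cscale (c i) (x i (v j) - cscale (\<mu> i j) (v j)))
        + cscale (\<Sum>i\<in>I. c i * \<mu> i j) (v j)"
      by (simp add: Z_def comb_def cfun.scale_right_diff_distrib sum_subtractf cfun.scale_sum_left)
    also have "\<dots> = (\<Sum>i\<in>I. cscale (c i) (x i (v j) - cscale (\<mu> i j) (v j)))"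
      by (simp add: c0[OF that])
    also have "\<dots> \<in> cfun.span (v ` {..<j})"
      using wt that by (intro cfun.span_sum cfun.span_scale) auto
    finally show ?thesis .
  qed
  have ZU: "(Z ^^ j) u = 0" if "j \<le> k" "u \<in> cfun.span (v ` {..<j})" for j u
    using that
  proof (induction j arbitrary: u)
    case 0
    then have "u = 0" by (simp only: lessThan_0 image_empty cfun.span_empty singleton_iff)
    then show ?case by (simp only: funpow.simps id_apply)
  next
    case (Suc j)
    have "Z ` cfun.span (v ` {..<Suc j}) = cfun.span (Z ` v ` {..<Suc j})"
      by (rule Z.span_image[symmetric])
    also have "\<dots> \<subseteq> cfun.span (v ` {..<j})"
    proof (intro cfun.span_minimal cfun.subspace_span subsetI, elim imageE)
      fix y w i assume "y = Z w" "w = v i" "i \<in> {..<Suc j}"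
      then show "y \<in> cfun.span (v ` {..<j})"
        using span_mono[OF Zv[of i], of j] Suc.prems(1) by auto
    qed
    finally have "Z u \<in> cfun.span (v ` {..<j})" using Suc.prems(2) by blast
    from Suc.IH[OF Suc_leD[OF Suc.prems(1)] this] have "(Z ^^ j) (Z u) = 0" .
    then show ?case by (simp only: funpow_Suc_right o_apply)
  qed
  have Zskew: "symp n (Z f) g = - symp n f (Z g)" for f g
    by (simp add: Z_def comb_def symp_sum_left symp_sum_right symp_scale_left symp_scale_right
        skew sum_negf)
  have Zskew': "symp n ((Z ^^ m) f) g = (-1) ^ m * symp n f ((Z ^^ m) g)" for m f g
    by (induction m arbitrary: g) (auto simp: Zskew funpow_swap1[symmetric])
  have ZE: "(Z ^^ m) w \<in> ?E" if "w \<in> ?E" for m w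
  proof (induction m)
    case (Suc m)
    then show ?case
      unfolding Z_def comb_def funpow.simps o_def using xE
      by (intro cfun.subspace_sum[OF subspace_csupp] cfun.subspace_scale[OF subspace_csupp]) auto
  qed (use that in simp)
  \<comment> \<open>\<open>Z ^^ k\<close> kills U; by skewness its image is orthogonal to U, hence
    lies in W and so in U, where k further steps finish.\<close>
  have "(Z ^^ (k + k)) w = 0" if "w \<in> ?E" for w
  proof -
    have "symp n (v j) ((Z ^^ k) w) = 0" if "j < k" for j
    proof -
      have "(Z ^^ k) (v j) = 0" by (rule ZU) (auto intro: cfun.span_base that)
      then show ?thesis using Zskew'[of k "v j" w] by simp
    qed
    then have "(Z ^^ k) w \<in> U" using WU ZE[OF that] by (auto simp: W_def)
    then show ?thesis using ZU[of k] by (simp add: funpow_add U_def)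
  qed
  then show ?thesis using c(1) unfolding nilpotent_on_def Z_def by blast
qed

section \<open>Sums and multiples of nilpotent operators\<close>

lemma nilpotent_on_add:
  assumes A: "cfun.endo A" and B: "cfun.endo B"
    and AE: "A ` csupp d \<subseteq> csupp d" and BE: "B ` csupp d \<subseteq> csupp d"
    and comm: "\<And>u. A (B u) = B (A u)"
    and nil: "nilpotent_on d A" "nilpotent_on d B"
  shows "nilpotent_on d (\<lambda>u. A u + B u)"
proof -
  interpret A: Vector_Spaces.linear cscale cscale A by (rule A)
  interpret B: Vector_Spaces.linear cscale cscale B by (rule B)
  let ?C = "\<lambda>u. A u + B u"
  from nil obtain p q where p: "\<And>w. w \<in> csupp d \<Longrightarrow> (A ^^ p) w = 0"
    and q: "\<And>w. w \<in> csupp d \<Longrightarrow> (B ^^ q) w = 0" by (auto simp: nilpotent_on_def)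
  have A0: "(A ^^ i) 0 = 0" for i by (induction i) (simp_all only: funpow.simps o_def A.zero id_def)
  have B0: "(B ^^ i) 0 = 0" for i by (induction i) (simp_all only: funpow.simps o_def B.zero id_def)
  have BAi: "B ((A ^^ i) u) = (A ^^ i) (B u)" for i u
    by (induction i) (simp_all add: comm[symmetric])
  have Cadd: "(?C ^^ m) (u + w) = (?C ^^ m) u + (?C ^^ m) w" for m u w
    by (induction m) (simp_all only: funpow.simps o_def A.add B.add id_def add.assoc add.left_commute)
  have Bi: "(B ^^ i) u \<in> csupp d" if "u \<in> csupp d" for i u
    using that BE by (induction i) auto
  \<comment> \<open>Replaces the binomial expansion: each application of A + B raises i or j by one,
    and once i + j reaches p + q one of the two powers vanishes.\<close>
  have vanish: "(?C ^^ m) ((A ^^ i) ((B ^^ j) u)) = 0" if "p + q \<le> m + i + j" "u \<in> csupp d" for m i j u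
    using that
  proof (induction m arbitrary: i j)
    case 0
    show ?case
    proof (cases "p \<le> i")
      case True
      then have "(A ^^ i) ((B ^^ j) u) = (A ^^ (i - p)) ((A ^^ p) ((B ^^ j) u))"
        by (metis funpow_add comp_apply le_add_diff_inverse2)
      also have "\<dots> = 0" by (simp only: p[OF Bi[OF 0(2)]] A0)
      finally show ?thesis by simp
    next
      case False
      then have "(B ^^ j) u = (B ^^ (j - q)) ((B ^^ q) u)"
        using 0(1) by (metis funpow_add comp_apply le_add_diff_inverse2 add_le_imp_le_left
            add_le_mono1 le_trans nat_le_linear add_0)
      also have "\<dots> = 0" by (simp only: q[OF 0(2)] B0)
      finally show ?thesis by (simp only: A0 funpow.simps id_def)
    qed
  next
    case (Suc m)
    have "?C ((A ^^ i) ((B ^^ j) u)) = (A ^^ Suc i) ((B ^^ j) u) + (A ^^ i) ((B ^^ Suc j) u)"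
      by (simp only: funpow.simps o_def BAi)
    moreover have "(?C ^^ Suc m) ((A ^^ i) ((B ^^ j) u)) = (?C ^^ m) (?C ((A ^^ i) ((B ^^ j) u)))"
      by (simp only: funpow_Suc_right o_def)
    ultimately have "(?C ^^ Suc m) ((A ^^ i) ((B ^^ j) u))
        = (?C ^^ m) ((A ^^ Suc i) ((B ^^ j) u)) + (?C ^^ m) ((A ^^ i) ((B ^^ Suc j) u))"
      by (simp only: Cadd)
    also have "\<dots> = 0 + 0" using Suc by (intro arg_cong2[of _ _ _ _ "(+)"] Suc.IH) auto
    finally show ?case by (simp only: add_0_left)
  qed
  have "(?C ^^ (p + q)) u = 0" if "u \<in> csupp d" for u
    using vanish[of "p + q" 0 0 u] that by simp
  then show ?thesis by (auto simp: nilpotent_on_def)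
qed

lemma nilpotent_on_scale:
  assumes "cfun.endo A" "nilpotent_on d A"
  shows "nilpotent_on d (\<lambda>u. cscale c (A u))"
proof -
  interpret A: Vector_Spaces.linear cscale cscale A by fact
  have "((\<lambda>u. cscale c (A u)) ^^ m) u = cscale (c ^ m) ((A ^^ m) u)" for m u
    by (induction m) (simp_all only: funpow.simps o_def A.scale cfun.scale_scale id_def
        power.simps cfun.scale_one)
  then show ?thesis using assms(2) by (auto simp: nilpotent_on_def)
qed

text \<open>Matrices act on row vectors from the right, matching \<open>acts_by\<close>, where rows
  are images. Consequently composition reverses the order of the factors.\<close>

definition row_op :: "('k::field \<Rightarrow> complex) \<Rightarrow> nat \<Rightarrow> 'k mat \<Rightarrow> (nat \<Rightarrow> complex) \<Rightarrow> nat \<Rightarrow> complex" where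
  "row_op \<phi> d M f = (\<lambda>j. if j < d then \<Sum>i<d. f i * \<phi> (M $$ (i, j)) else 0)"

lemma row_op_endo: "cfun.endo (row_op \<phi> d M)"
  by (auto simp: cfun.endo_iff row_op_def fun_eq_iff sum.distrib sum_distrib_left algebra_simps)

lemma row_op_csupp: "row_op \<phi> d M f \<in> csupp d"
  by (simp add: row_op_def csupp_def)

context complex_embedding
begin

lemma row_op_mult:
  assumes "M \<in> carrier_mat d d" "M' \<in> carrier_mat d d"
  shows "row_op \<phi> d M (row_op \<phi> d M' f) = row_op \<phi> d (M' * M) f"
proof
  fix j
  show "row_op \<phi> d M (row_op \<phi> d M' f) j = row_op \<phi> d (M' * M) f j"
  proof (cases "j < d")
    case True
    have "row_op \<phi> d M (row_op \<phi> d M' f) j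
        = (\<Sum>l<d. \<Sum>i<d. f i * \<phi> (M' $$ (i, l)) * \<phi> (M $$ (l, j)))"
      using True by (simp add: row_op_def sum_distrib_right)
    also have "\<dots> = (\<Sum>i<d. \<Sum>l<d. f i * \<phi> (M' $$ (i, l)) * \<phi> (M $$ (l, j)))"
      by (rule sum.swap)
    also have "\<dots> = (\<Sum>i<d. f i * \<phi> ((M' * M) $$ (i, j)))"
    proof (intro sum.cong refl)
      fix i assume "i \<in> {..<d}"
      then have "(M' * M) $$ (i, j) = (\<Sum>l<d. M' $$ (i, l) * M $$ (l, j))"
        using assms True by (auto simp: scalar_prod_def lessThan_atLeast0)
      then show "(\<Sum>l<d. f i * \<phi> (M' $$ (i, l)) * \<phi> (M $$ (l, j))) = f i * \<phi> ((M' * M) $$ (i, j))"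
        by (simp add: \<phi>_sum \<phi>_mult sum_distrib_left mult.assoc)
    qed
    also have "\<dots> = row_op \<phi> d (M' * M) f j" using True by (simp add: row_op_def)
    finally show ?thesis .
  qed (simp add: row_op_def)
qed

lemma row_op_one: "f \<in> csupp d \<Longrightarrow> row_op \<phi> d (1\<^sub>m d) f = f"
  by (auto simp: row_op_def fun_eq_iff csuppD one_mat_def \<phi>_1 if_distrib cong: if_cong)

lemma row_op_pow:
  assumes "M \<in> carrier_mat d d" "f \<in> csupp d"
  shows "(row_op \<phi> d M ^^ k) f = row_op \<phi> d (M ^\<^sub>m k) f"
  using assms
  by (induction k arbitrary: f)
    (auto simp: row_op_one row_op_mult row_op_csupp simp del: index_mult_mat)

lemma row_op_cunit: "i < d \<Longrightarrow> j < d \<Longrightarrow> row_op \<phi> d M (cunit i) j = \<phi> (M $$ (i, j))"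
  by (simp add: row_op_def cunit_def if_distrib[of "\<lambda>x. x * _"] cong: if_cong)

lemma nilpotent_mat_if_nilpotent_on:
  assumes M: "M \<in> carrier_mat d d" and nil: "nilpotent_on d (row_op \<phi> d M)"
  shows "nilpotent_mat M"
proof -
  from nil obtain m where m: "\<And>w. w \<in> csupp d \<Longrightarrow> (row_op \<phi> d M ^^ m) w = 0"
    by (auto simp: nilpotent_on_def)
  have "(M ^\<^sub>m m) $$ (i, j) = 0" if "i < d" "j < d" for i j
  proof -
    have "\<phi> ((M ^\<^sub>m m) $$ (i, j)) = row_op \<phi> d (M ^\<^sub>m m) (cunit i) j"
      using that by (simp add: row_op_cunit)
    also have "\<dots> = (row_op \<phi> d M ^^ m) (cunit i) j"
      by (simp add: row_op_pow[OF M cunit_in_csupp[OF that(1)]])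
    also have "\<dots> = 0" by (simp add: m cunit_in_csupp[OF that(1)])
    finally show ?thesis by simp
  qed
  then have "M ^\<^sub>m m = 0\<^sub>m d d" using M by (intro eq_matI) (auto simp: pow_carrier_mat)
  then show ?thesis using M unfolding nilpotent_mat_def by (intro exI[of _ m]) auto
qed

text \<open>Multiplying X K + K X^T = 0 by the row f on the left and the column g^T on the right
  gives (f X) K g^T = - f K (g X)^T.\<close>

lemma symp_row_op_skew:
  assumes "X \<in> sp n"
  shows "symp n (row_op \<phi> (2 * n) X f) g = - symp n f (row_op \<phi> (2 * n) X g)"
proof -
  have X: "X \<in> carrier_mat (2 * n) (2 * n)" using assms by (simp add: sp_def)
  let ?d = "2 * n"
  have \<phi>K: "\<phi> (symp_entry n i j) = symp_entry n i j" for i j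
    by (simp add: symp_entry_def \<phi>_1 \<phi>_minus)
  let ?a = "\<lambda>i j. \<Sum>l<?d. \<phi> (X $$ (i, l)) * symp_entry n l j"
  let ?b = "\<lambda>i j. \<Sum>l<?d. symp_entry n i l * \<phi> (X $$ (j, l))"
  have ab: "?a i j + ?b i j = 0" if "i < ?d" "j < ?d" for i j
  proof -
    have "\<phi> ((\<Sum>l<?d. X $$ (i, l) * symp_entry n l j) + (\<Sum>l<?d. symp_entry n i l * X $$ (j, l))) = 0"
      using assms that by (simp add: sp_index[OF X])
    then show ?thesis by (simp add: \<phi>_add \<phi>_sum \<phi>_mult \<phi>K)
  qed
  have "symp n (row_op \<phi> ?d X f) g = (\<Sum>l<?d. \<Sum>j<?d. \<Sum>i<?d. f i * \<phi> (X $$ (i, l)) * symp_entry n l j * g j)"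
    by (simp add: symp_eq row_op_def sum_distrib_right)
  also have "\<dots> = (\<Sum>i<?d. \<Sum>j<?d. \<Sum>l<?d. f i * \<phi> (X $$ (i, l)) * symp_entry n l j * g j)"
    by (subst sum.swap, subst (2) sum.swap, subst sum.swap) (rule refl)
  also have "\<dots> = (\<Sum>i<?d. \<Sum>j<?d. f i * ?a i j * g j)"
    by (simp add: sum_distrib_left sum_distrib_right mult.assoc)
  also have "\<dots> = (\<Sum>i<?d. \<Sum>j<?d. - (f i * ?b i j * g j))"
  proof (intro sum.cong refl)
    fix i j assume "i \<in> {..<?d}" "j \<in> {..<?d}"
    then have "?a i j = - ?b i j" using ab by (simp add: eq_neg_iff_add_eq_0)
    then show "f i * ?a i j * g j = - (f i * ?b i j * g j)" by simp
  qed
  also have "\<dots> = - (\<Sum>i<?d. \<Sum>j<?d. \<Sum>l<?d. f i * symp_entry n i l * (g j * \<phi> (X $$ (j, l))))"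
    by (simp add: sum_negf sum_distrib_left sum_distrib_right mult_ac)
  also have "(\<Sum>i<?d. \<Sum>j<?d. \<Sum>l<?d. f i * symp_entry n i l * (g j * \<phi> (X $$ (j, l))))
      = (\<Sum>i<?d. \<Sum>l<?d. \<Sum>j<?d. f i * symp_entry n i l * (g j * \<phi> (X $$ (j, l))))"
    by (intro sum.cong refl sum.swap)
  also have "\<dots> = symp n f (row_op \<phi> ?d X g)"
    by (simp add: symp_eq row_op_def sum_distrib_left)
  finally show ?thesis .
qed

text \<open>In the real case a nilpotent complex combination \<open>Z\<close> commutes with its conjugate, so that
  its real and imaginary parts are nilpotent as well.\<close>

lemma card_lin_nilindependent_le:
  fixes X :: "'i \<Rightarrow> 'k mat"
  assumes fin: "finite I" and X: "\<And>i. i \<in> I \<Longrightarrow> X i \<in> sp n"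
    and comm: "\<And>i j. i \<in> I \<Longrightarrow> j \<in> I \<Longrightarrow> X i * X j = X j * X i"
    and indep: "lin_nilindependent (2 * n) I X"
  shows "card I \<le> n"
proof (rule ccontr)
  assume "\<not> card I \<le> n"
  then have card: "n < card I" by simp
  let ?d = "2 * n"
  define x where "x i = row_op \<phi> ?d (X i)" for i
  have Xc: "X i \<in> carrier_mat ?d ?d" if "i \<in> I" for i using X[OF that] by (simp add: sp_def)
  have endo: "cfun.endo (x i)" for i by (simp add: x_def row_op_endo)
  have xcomm: "x i (x j u) = x j (x i u)" if "i \<in> I" "j \<in> I" for i j u
    using that Xc comm by (simp add: x_def row_op_mult)
  obtain c where c: "\<exists>i\<in>I. c i \<noteq> 0" "nilpotent_on ?d (comb I x c)"
    using commuting_symplectic_nilpotent_combination[of I n x, OF fin card endo _ xcomm]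
      symp_row_op_skew[OF X] row_op_csupp unfolding x_def by blast
  have lin: "comb I x (\<lambda>i. \<phi> (b i)) = row_op \<phi> ?d (lin_comb_mat ?d I b X)" for b
  proof (intro ext)
    fix f j
    show "comb I x (\<lambda>i. \<phi> (b i)) f j = row_op \<phi> ?d (lin_comb_mat ?d I b X) f j"
    proof (cases "j < ?d")
      case True
      have "comb I x (\<lambda>i. \<phi> (b i)) f j = (\<Sum>i\<in>I. \<Sum>l<?d. \<phi> (b i) * (f l * \<phi> (X i $$ (l, j))))"
        using True by (simp add: comb_def x_def row_op_def sum_fun_apply sum_distrib_left)
      also have "\<dots> = (\<Sum>l<?d. \<Sum>i\<in>I. \<phi> (b i) * (f l * \<phi> (X i $$ (l, j))))" by (rule sum.swap)
      also have "\<dots> = row_op \<phi> ?d (lin_comb_mat ?d I b X) f j"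
        using True by (simp add: row_op_def lin_comb_mat_def \<phi>_sum \<phi>_mult sum_distrib_left mult_ac)
      finally show ?thesis .
    qed (simp add: comb_def x_def row_op_def sum_fun_apply)
  qed
  have zero: "\<forall>i\<in>I. b i = 0" if "nilpotent_on ?d (comb I x (\<lambda>i. \<phi> (b i)))" for b
  proof -
    have "nilpotent_mat (lin_comb_mat ?d I b X)"
      using that unfolding lin by (intro nilpotent_mat_if_nilpotent_on) (auto simp: lin_comb_mat_def)
    then show ?thesis using indep by (auto simp: lin_nilindependent_def)
  qed
  have zero': "\<forall>i\<in>I. b i = 0" if nil: "nilpotent_on ?d (comb I x b)" and b: "range b \<subseteq> range \<phi>" for b
  proof -
    have b_eq: "\<phi> (inv_into UNIV \<phi> (b i)) = b i" for i
      by (rule f_inv_into_f) (use b in blast)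
    then have "\<forall>i\<in>I. inv_into UNIV \<phi> (b i) = 0" using zero[of "\<lambda>i. inv_into UNIV \<phi> (b i)"] nil by simp
    then show ?thesis using b_eq by (metis \<phi>_0)
  qed
  show False
  proof (cases "surj \<phi>")
    case True
    then show False using zero'[of c] c by auto
  next
    case False
    then have R: "range \<phi> = \<real>" using range_\<phi> by blast
    \<comment> \<open>The operators are real, so conjugating the coefficients conjugates the
      operator and preserves nilpotency. The two combinations commute, and their sum has the real
      coefficients 2 Re b.\<close>
    have real: "\<forall>i\<in>I. b i + cnj (b i) = 0" if nil: "nilpotent_on ?d (comb I x b)" for b
    proof -
      define cn :: "(nat \<Rightarrow> complex) \<Rightarrow> nat \<Rightarrow> complex" where "cn f = (\<lambda>i. cnj (f i))" for f
      have "cnj (\<phi> z) = \<phi> z" for z using R by (metis Reals_cnj_iff rangeI)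
      then have xcn: "x i (cn f) = cn (x i f)" for i f
        by (simp add: x_def row_op_def cn_def fun_eq_iff)
      have "comb I x (\<lambda>i. cnj (b i)) f = cn (comb I x b (cn f))" for f
      proof -
        have "x i f = cn (x i (cn f))" for i unfolding xcn by (simp add: cn_def)
        then show ?thesis by (simp add: comb_def fun_eq_iff sum_fun_apply) (simp add: cn_def sum_fun_apply)
      qed
      then have pow: "(comb I x (\<lambda>i. cnj (b i)) ^^ m) f = cn ((comb I x b ^^ m) (cn f))" for m f
        by (induction m) (simp_all add: cn_def)
      have "nilpotent_on ?d (comb I x (\<lambda>i. cnj (b i)))"
      proof -
        from nil obtain m where m: "\<And>w. w \<in> csupp ?d \<Longrightarrow> (comb I x b ^^ m) w = 0"
          by (auto simp: nilpotent_on_def)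
        have "cn w \<in> csupp ?d" if "w \<in> csupp ?d" for w using that by (simp add: cn_def csupp_def)
        then have "cn ((comb I x b ^^ m) (cn w)) = cn 0" if "w \<in> csupp ?d" for w
          using m that by metis
        moreover have "cn 0 = 0" by (simp add: cn_def fun_eq_iff)
        ultimately show ?thesis unfolding nilpotent_on_def pow by metis
      qed
      moreover have e: "cfun.endo (comb I x b')" for b'
        by (rule comb_endo[OF endo])
      moreover have E: "comb I x b' ` csupp ?d \<subseteq> csupp ?d" for b'
        unfolding comb_def x_def
        by (auto intro!: cfun.subspace_sum[OF subspace_csupp] cfun.subspace_scale[OF subspace_csupp]
            row_op_csupp simp del: cscale_apply)
      moreover have "comb I x b1 (comb I x b2 u) = comb I x b2 (comb I x b1 u)" for b1 b2 u
      proof -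
        have lin_x: "x i (\<Sum>j\<in>I. cscale (b j) (w j)) = (\<Sum>j\<in>I. cscale (b j) (x i (w j)))" for i b w
        proof -
          interpret Vector_Spaces.linear cscale cscale "x i" by (rule endo)
          show ?thesis by (simp only: sum scale)
        qed
        have "comb I x b1 (comb I x b2 u) = (\<Sum>i\<in>I. \<Sum>j\<in>I. cscale (b1 i * b2 j) (x i (x j u)))"
          by (simp only: comb_def lin_x cfun.scale_sum_right cfun.scale_scale)
        also have "\<dots> = (\<Sum>j\<in>I. \<Sum>i\<in>I. cscale (b1 i * b2 j) (x i (x j u)))" by (rule sum.swap)
        also have "\<dots> = (\<Sum>j\<in>I. \<Sum>i\<in>I. cscale (b2 j * b1 i) (x j (x i u)))"
          by (intro sum.cong refl) (simp add: xcomm mult.commute)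
        also have "\<dots> = comb I x b2 (comb I x b1 u)"
          by (simp only: comb_def lin_x cfun.scale_sum_right cfun.scale_scale)
        finally show ?thesis .
      qed
      ultimately have "nilpotent_on ?d (\<lambda>u. comb I x b u + comb I x (\<lambda>i. cnj (b i)) u)"
        using nil by (intro nilpotent_on_add) auto
      moreover have "(\<lambda>u. comb I x b u + comb I x (\<lambda>i. cnj (b i)) u) = comb I x (\<lambda>i. b i + cnj (b i))"
        by (simp add: comb_def fun_eq_iff sum_fun_apply sum.distrib algebra_simps)
      ultimately have "nilpotent_on ?d (comb I x (\<lambda>i. b i + cnj (b i)))" by (simp only:)
      moreover have "range (\<lambda>i. b i + cnj (b i)) \<subseteq> range \<phi>"
        unfolding R by (auto simp: complex_is_Real_iff)
      ultimately show ?thesis by (rule zero')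
    qed
    \<comment> \<open>Multiplying by the imaginary unit turns the imaginary parts of c into real
      parts, to which \<open>real\<close> applies again.\<close>
    have "nilpotent_on ?d (\<lambda>u. cscale \<i> (comb I x c u))"
      by (rule nilpotent_on_scale[OF comb_endo[OF endo] c(2)])
    also have "(\<lambda>u. cscale \<i> (comb I x c u)) = comb I x (\<lambda>i. \<i> * c i)"
      by (rule ext) (simp only: comb_def cfun.scale_sum_right cfun.scale_scale)
    finally have "\<forall>i\<in>I. \<i> * c i + cnj (\<i> * c i) = 0" by (rule real)
    moreover have "\<forall>i\<in>I. c i + cnj (c i) = 0" by (rule real[OF c(2)])
    ultimately have "\<forall>i\<in>I. c i = 0" by (auto simp: complex_eq_iff)
    then show False using c(1) by blast
  qed
qed

end

section \<open>The derived algebra is nilpotent\<close>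

context leibniz_algebra
begin

section \<open>Coordinates, bilinearity of the bracket, and products\<close>

definition coord :: "'v list \<Rightarrow> 'v \<Rightarrow> nat \<Rightarrow> 'k" where
  "coord xs w j = representation (set xs) w (xs ! j)"

context
  fixes xs :: "'v list"
  assumes xs: "distinct xs" "independent (set xs)"
begin

lemma coord_expand:
  assumes "w \<in> span (set xs)"
  shows "w = (\<Sum>j<length xs. scale (coord xs w j) (xs ! j))"
proof -
  have "w = (\<Sum>b\<in>set xs. scale (representation (set xs) w b) b)"
    using sum_representation_eq[OF xs(2) assms finite_set subset_refl] by simp
  also have "\<dots> = (\<Sum>j<length xs. scale (representation (set xs) w (xs ! j)) (xs ! j))"
    by (rule sum.reindex_bij_betw[OF bij_betw_nth[OF xs(1) refl refl], symmetric])
  finally show ?thesis by (simp add: coord_def)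
qed

lemma coord_add:
  "v \<in> span (set xs) \<Longrightarrow> w \<in> span (set xs) \<Longrightarrow> coord xs (v + w) j = coord xs v j + coord xs w j"
  by (simp add: coord_def representation_add xs)

lemma coord_diff:
  "v \<in> span (set xs) \<Longrightarrow> w \<in> span (set xs) \<Longrightarrow> coord xs (v - w) j = coord xs v j - coord xs w j"
  by (simp add: coord_def representation_diff xs)

lemma coord_scale:
  "w \<in> span (set xs) \<Longrightarrow> coord xs (scale c w) j = c * coord xs w j"
  by (simp add: coord_def representation_scale xs)

lemma coord_zero: "coord xs 0 j = 0"
  by (simp add: coord_def representation_zero)

lemma coord_sum:
  "(\<And>i. i \<in> I \<Longrightarrow> f i \<in> span (set xs)) \<Longrightarrow> coord xs (\<Sum>i\<in>I. f i) j = (\<Sum>i\<in>I. coord xs (f i) j)"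
  by (simp add: coord_def representation_sum xs)

lemma coord_nth:
  "i < length xs \<Longrightarrow> j < length xs \<Longrightarrow> coord xs (xs ! i) j = (if i = j then 1 else 0)"
  using xs by (simp add: coord_def representation_basis nth_eq_iff_index_eq)

end

lemma br_add_left: "br (x + y) z = br x z + br y z"
  and br_scale_left: "br (scale c x) z = scale c (br x z)"
  and br_diff_left: "br (x - y) z = br x z - br y z"
  and br_minus_left: "br (- x) z = - br x z"
  and br_zero_left [simp]: "br 0 z = 0"
  and br_sum_left: "br (\<Sum>i\<in>I. f i) z = (\<Sum>i\<in>I. br (f i) z)"
  using linear_left[of z, unfolded linear_iff_module_hom]
  by (auto dest: module_hom.add module_hom.scale module_hom.diff module_hom.neg module_hom.zero
      module_hom.sum)

lemma br_add_right: "br z (x + y) = br z x + br z y"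
  and br_scale_right: "br z (scale c x) = scale c (br z x)"
  and br_diff_right: "br z (x - y) = br z x - br z y"
  and br_zero_right [simp]: "br z 0 = 0"
  and br_sum_right: "br z (\<Sum>i\<in>I. f i) = (\<Sum>i\<in>I. br z (f i))"
  using linear_right[of z, unfolded linear_iff_module_hom]
  by (auto dest: module_hom.add module_hom.scale module_hom.diff module_hom.neg module_hom.zero
      module_hom.sum)

text \<open>The Leibniz identity read as a representation: the left multiplication by [x,y] is the
  commutator of those by x and y. This is what carries Lie's theorem over to Leibniz
  algebras.\<close>

lemma br_br: "br (br x y) z = br x (br y z) - br y (br x z)"
  by (simp add: left_leibniz[of x y z])

lemma independent_finite: "independent S \<Longrightarrow> finite S"
  using finite_dim independent_span_bound by blast

lemma exists_finite_basis:
  assumes "subspace V"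
  obtains S where "finite S" "S \<subseteq> V" "independent S" "span S = V"
proof -
  obtain S where S: "S \<subseteq> V" "independent S" "V \<subseteq> span S" using basis_exists by metis
  have "span S = V" using S assms by (metis span_minimal subset_antisym)
  with S independent_finite show thesis by (intro that)
qed

lemma bracket_set_memI: "x \<in> U \<Longrightarrow> y \<in> V \<Longrightarrow> br x y \<in> bracket_set U V"
  unfolding bracket_set_def by (rule span_base) blast

lemma bracket_set_subset:
  assumes "subspace W" "\<And>x y. x \<in> U \<Longrightarrow> y \<in> V \<Longrightarrow> br x y \<in> W"
  shows "bracket_set U V \<subseteq> W"
  unfolding bracket_set_def by (rule span_minimal) (use assms in auto)

lemma subspace_derived_series: "subspace (derived_series k)"
  by (cases k) (auto simp: bracket_set_def)

lemma derived_series_Suc_subset: "derived_series (Suc k) \<subseteq> derived_series k"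
proof (induction k)
  case (Suc k)
  then show ?case
    unfolding derived_series.simps(2)[of "Suc k"]
    by (intro bracket_set_subset[OF subspace_derived_series])
      (metis bracket_set_memI derived_series.simps(2) subsetD)
qed simp

lemma nilpotentI:
  assumes "lower_central V k \<subseteq> {0}"
  shows "nilpotent V"
proof -
  \<comment> \<open>One more step, because for an arbitrary set V the k-th term might be empty,
    whereas a span contains 0.\<close>
  have "lower_central V (Suc k) \<subseteq> {0}"
    unfolding lower_central.simps using assms by (intro bracket_set_subset) auto
  then have "lower_central V (Suc k) = {0}"
    using span_zero by (auto simp: bracket_set_def)
  then show ?thesis unfolding nilpotent_def by blast
qed

text \<open>Reduces nilpotency to the vanishing of all nested products [z_1,[z_2,...[z_k,w]]], which
  are compositions of left multiplications.\<close>

lemma lower_central_subset_products: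
  "lower_central V k \<subseteq> span {foldr br zs w | zs w. length zs = k \<and> set zs \<subseteq> V \<and> w \<in> V}"
proof (induction k)
  case 0
  then show ?case by (auto intro!: span_base)
next
  case (Suc k)
  let ?S = "\<lambda>k. {foldr br zs w | zs w. length zs = k \<and> set zs \<subseteq> V \<and> w \<in> V}"
  show ?case
    unfolding lower_central.simps
  proof (rule bracket_set_subset[OF subspace_span])
    fix x y assume x: "x \<in> V" and "y \<in> lower_central V k"
    then have "y \<in> span (?S k)" using Suc by blast
    then show "br x y \<in> span (?S (Suc k))"
    proof (induction y rule: span_induct_alt)
      case base
      then show ?case by (simp add: span_zero)
    next
      case (step c w u)
      then obtain zs w' where "w = foldr br zs w'" "length zs = k" "set zs \<subseteq> V" "w' \<in> V" by blast
      then have "br x w \<in> ?S (Suc k)" using x by (intro CollectI exI[of _ "x # zs"] exI[of _ w']) auto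
      then show ?case using step(2) by (simp add: br_add_right br_scale_right span_add span_scale span_base)
    qed
  qed
qed

end

text \<open>Abstracts the complexified adjoint representation: x remains in L, and only the space
  acted upon is complex, so T is linear in x through \<phi>.\<close>

locale leibniz_representation = leibniz_algebra scale br + complex_embedding \<phi>
  for scale :: "'k::field \<Rightarrow> 'v::ab_group_add \<Rightarrow> 'v" and br and \<phi> :: "'k \<Rightarrow> complex" +
  fixes T :: "'v \<Rightarrow> (nat \<Rightarrow> complex) \<Rightarrow> nat \<Rightarrow> complex" and d :: nat
  assumes T_endo: "cfun.endo (T x)"
    and T_csupp: "T x ` csupp d \<subseteq> csupp d"
    and T_add: "T (x + y) f = T x f + T y f"
    and T_scale: "T (scale c x) f = cscale (\<phi> c) (T x f)"
    and T_br: "T (br x y) f = T x (T y f) - T y (T x f)"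
begin

text \<open>Climbs one step of the derived series by adjoining basis vectors of the larger term one
  at a time, each by \<open>weight_vector_extend\<close>.\<close>

lemma common_weight_vector_step:
  assumes U: "cfun.subspace U" and TU: "\<And>x. T x ` U \<subseteq> U"
    and w: "w \<in> csupp d" "w \<notin> U" "cfun.weight_vector U (T ` derived_series (Suc k)) w"
  shows "\<exists>w\<in>csupp d. w \<notin> U \<and> cfun.weight_vector U (T ` derived_series k) w"
proof -
  let ?D = "derived_series (Suc k)"
  obtain S where S: "finite S" "S \<subseteq> derived_series k" "span S = derived_series k"
    using exists_finite_basis[OF subspace_derived_series] by metis
  have "\<exists>w\<in>csupp d. w \<notin> U \<and> cfun.weight_vector U (T ` span (?D \<union> R)) w" if "R \<subseteq> S" for R
    using finite_subset[OF that S(1)] that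
  proof (induction R)
    case empty
    have "span ?D = ?D" by (simp only: span_eq_iff subspace_derived_series)
    then show ?case using w by (intro bexI[of _ w] conjI) (simp_all only: Un_empty_right not_False_eq_True)
  next
    case (insert b R)
    then obtain w where w: "w \<in> csupp d" "w \<notin> U" "cfun.weight_vector U (T ` span (?D \<union> R)) w"
      by blast
    have sub: "span (?D \<union> R) \<subseteq> derived_series k"
      using derived_series_Suc_subset[of k] insert.prems S(2)
      by (intro span_minimal subspace_derived_series) blast
    \<comment> \<open>Both b and z lie in the k-th derived term, so [b,z] falls into the next one,
      whatever R has been collected so far.\<close>
    have comm: "cfun.commutator (T b) y \<in> T ` span (?D \<union> R)" if "y \<in> T ` span (?D \<union> R)" for y
    proof -
      from that obtain z where z: "y = T z" "z \<in> span (?D \<union> R)" by blast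
      have "cfun.commutator (T b) y = T (br b z)"
        unfolding z(1) cfun.commutator_def by (rule ext) (rule T_br[symmetric])
      moreover have "br b z \<in> ?D"
        using insert.prems S(2) sub z(2) unfolding derived_series.simps by (intro bracket_set_memI) auto
      ultimately show ?thesis using span_base by blast
    qed
    have "\<exists>w\<in>csupp d. w \<notin> U \<and> cfun.weight_vector U (insert (T b) (T ` span (?D \<union> R))) w"
      by (rule cfun.weight_vector_extend[OF _ csupp_span U subspace_csupp T_endo TU T_csupp _ _ comm w])
        (use T_endo TU in auto)
    then obtain w where w: "w \<in> csupp d" "w \<notin> U"
      "cfun.weight_vector U (insert (T b) (T ` span (?D \<union> R))) w" by blast
    \<comment> \<open>The extension was made for \<open>T b\<close> alone; linearity of T in its
      first argument spreads the weights over the whole span.\<close>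
    have "\<exists>a. T y w - cscale a w \<in> U" if "y \<in> span (?D \<union> insert b R)" for y
    proof -
      have "y \<in> span (insert b (?D \<union> R))" using that by simp
      then obtain c where c: "y - scale c b \<in> span (?D \<union> R)" using span_breakdown_eq by blast
      obtain a1 a2 where a: "T (y - scale c b) w - cscale a1 w \<in> U" "T b w - cscale a2 w \<in> U"
        using w(3) c unfolding cfun.weight_vector_def by blast
      have "T y w = T ((y - scale c b) + scale c b) w" by simp
      also have "\<dots> = T (y - scale c b) w + cscale (\<phi> c) (T b w)" unfolding T_add T_scale ..
      finally have "T y w - cscale (a1 + \<phi> c * a2) w
          = (T (y - scale c b) w - cscale a1 w) + cscale (\<phi> c) (T b w - cscale a2 w)"
        by (simp add: fun_eq_iff algebra_simps)
      also have "\<dots> \<in> U" by (intro cfun.subspace_add[OF U] cfun.subspace_scale[OF U] a)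
      finally show ?thesis by blast
    qed
    then have "cfun.weight_vector U (T ` span (?D \<union> insert b R)) w"
      unfolding cfun.weight_vector_def by blast
    then show ?case using w by blast
  qed
  from this[OF subset_refl] obtain w where w: "w \<in> csupp d" "w \<notin> U"
    "cfun.weight_vector U (T ` span (?D \<union> S)) w" by blast
  have "derived_series k \<subseteq> span (?D \<union> S)" using S(3) span_mono[of S "?D \<union> S"] by blast
  then show ?thesis using w by (auto simp: cfun.weight_vector_def)
qed

text \<open>At the last derived term {0} only the zero operator acts, so any vector starts the climb
  to the whole algebra.\<close>

lemma common_weight_vector:
  assumes solvable and U: "cfun.subspace U" and TU: "\<And>x. T x ` U \<subseteq> U" and "\<not> csupp d \<subseteq> U"
  shows "\<exists>w\<in>csupp d. w \<notin> U \<and> (\<forall>x. \<exists>a. T x w - cscale a w \<in> U)"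
proof -
  from \<open>solvable\<close> obtain K where K: "derived_series K = {0}" by (auto simp: solvable_def)
  from assms(4) obtain w where w: "w \<in> csupp d" "w \<notin> U" by blast
  have "T 0 w = 0" using T_add[of 0 0 w] by (simp only: add_0_right add_cancel_right_left)
  then have "cfun.weight_vector U (T ` derived_series K) w"
    unfolding K cfun.weight_vector_def using cfun.subspace_0[OF U]
    by (auto intro!: exI[of _ 0] simp del: cscale_apply)
  then have "\<exists>w\<in>csupp d. w \<notin> U \<and> cfun.weight_vector U (T ` derived_series K) w" using w by blast
  then have "\<exists>w\<in>csupp d. w \<notin> U \<and> cfun.weight_vector U (T ` derived_series 0) w"
    by (induction K) (blast intro: common_weight_vector_step[OF U TU])+
  then show ?thesis by (auto simp: cfun.weight_vector_def)
qed

text \<open>Grows an invariant subspace on which long products from the derived algebra vanish. A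
  weight vector w modulo it adds one dimension and lengthens the required products by one, since the
  derived algebra maps w into the old subspace.\<close>

lemma derived_products_vanish:
  assumes solvable
  shows "\<exists>k. \<forall>zs. length zs = k \<longrightarrow> set zs \<subseteq> derived_series 1 \<longrightarrow> (\<forall>f\<in>csupp d. foldr T zs f = 0)"
proof -
  define good where "good S \<longleftrightarrow> S \<subseteq> csupp d \<and> cfun.independent S \<and>
    (\<forall>x. T x ` cfun.span S \<subseteq> cfun.span S) \<and>
    (\<exists>k. \<forall>zs. length zs = k \<longrightarrow> set zs \<subseteq> derived_series 1 \<longrightarrow> (\<forall>f\<in>cfun.span S. foldr T zs f = 0))"
    for S
  have fin: "finite S \<and> card S \<le> card (cunit ` {..<d})" if "good S" for S
  proof (rule cfun.independent_span_bound)
    show "cfun.independent S" using that unfolding good_def by blast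
    show "S \<subseteq> cfun.span (cunit ` {..<d})" using that csupp_span unfolding good_def by (meson order_trans)
  qed simp
  have T0: "T x 0 = 0" for x by (rule cfun.endo_0[OF T_endo])
  have foldr0: "foldr T zs 0 = 0" for zs
    by (induction zs) (simp_all only: foldr.simps o_def id_def T0)
  have "good {}"
    unfolding good_def cfun.span_empty
  proof (intro conjI allI)
    show "T x ` {0} \<subseteq> {0}" for x by (simp only: image_insert image_empty T0 subset_refl)
    show "\<exists>k. \<forall>zs. length zs = k \<longrightarrow> set zs \<subseteq> derived_series 1 \<longrightarrow> (\<forall>f\<in>{0}. foldr T zs f = 0)"
      by (intro exI[of _ 0] allI impI ballI) (simp only: singleton_iff foldr0)
  qed (rule empty_subsetI cfun.independent_empty)+
  moreover have "\<forall>S. good S \<longrightarrow> card S < Suc (card (cunit ` {..<d}))"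
    using fin by (simp add: less_Suc_eq_le)
  ultimately have "\<exists>S. good S \<and> (\<forall>S'. good S' \<longrightarrow> card S' \<le> card S)"
    by (rule ex_has_greatest_nat)
  then obtain S where S: "good S" and greatest: "\<And>S'. good S' \<Longrightarrow> card S' \<le> card S" by blast
  let ?U = "cfun.span S"
  have TU: "T x ` ?U \<subseteq> ?U" for x using S by (simp add: good_def)
  have "csupp d \<subseteq> ?U"
  proof (rule ccontr)
    assume "\<not> csupp d \<subseteq> ?U"
    from common_weight_vector[OF assms cfun.subspace_span TU this]
    obtain w where w: "w \<in> csupp d" "w \<notin> ?U" "\<forall>x. \<exists>a. T x w - cscale a w \<in> ?U" by blast
    then obtain \<mu> where \<mu>: "\<And>x. T x w - cscale (\<mu> x) w \<in> ?U" by metis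
    let ?U' = "cfun.span (insert w S)"
    have linT: "T x (cscale c f + g) = cscale c (T x f) + T x g" for x c f g
      using T_endo[of x] unfolding cfun.endo_iff by metis
    have UU': "?U \<subseteq> ?U'" by (rule cfun.span_mono) auto
    have wU': "w \<in> ?U'" by (intro cfun.span_base) simp
    have TU': "T x ` ?U' \<subseteq> ?U'" for x
    proof safe
      fix f assume "f \<in> ?U'"
      then obtain c where c: "f - cscale c w \<in> ?U" using cfun.span_breakdown_eq by blast
      have "T x f = T x (cscale c w + (f - cscale c w))" by simp
      also have "\<dots> = cscale c ((T x w - cscale (\<mu> x) w) + cscale (\<mu> x) w) + T x (f - cscale c w)"
        unfolding linT by simp
      also have "\<dots> \<in> ?U'"
        using TU[of x] c \<mu>[of x] UU' wU'
        by (intro cfun.span_add cfun.span_scale) auto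
      finally show "T x f \<in> ?U'" .
    qed
    \<comment> \<open>Modulo U the operators act on w by scalars, which commute; hence a commutator
      sends w into U.\<close>
    have TD: "T z f \<in> ?U" if z: "z \<in> derived_series 1" and f: "f \<in> ?U'" for z f
    proof -
      have "T z w \<in> ?U"
        using z unfolding One_nat_def derived_series.simps bracket_set_def
      proof (induction z rule: span_induct_alt)
        case base
        have "T 0 w = 0" using T_add[of 0 0 w] by (simp only: add_0_right add_cancel_right_left)
        then show ?case by (simp only: cfun.span_zero)
      next
        case (step c z z')
        then obtain x y where z: "z = br x y" by blast
        define u where "u x = T x w - cscale (\<mu> x) w" for x
        have u: "u x \<in> ?U" for x unfolding u_def by (rule \<mu>)
        have Tu: "T x (u y) \<in> ?U" for x y using TU u by blast
        have Tw: "T x w = cscale (\<mu> x) w + u x" for x by (simp add: u_def)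
        have "T x (T y w) = cscale (\<mu> y) (T x w) + T x (u y)" for x y
          by (subst Tw) (simp only: linT)
        then have "T z w = cscale (\<mu> y) (T x w) + T x (u y) - (cscale (\<mu> x) (T y w) + T y (u x))"
          unfolding z T_br by simp
        also have "\<dots> = cscale (\<mu> y) (u x) + T x (u y) - (cscale (\<mu> x) (u y) + T y (u x))"
          unfolding Tw by (simp add: fun_eq_iff algebra_simps)
        also have "\<dots> \<in> ?U"
          by (intro cfun.span_diff cfun.span_add cfun.span_scale u Tu)
        finally show ?case using step(2) unfolding T_add T_scale
          by (intro cfun.span_add cfun.span_scale)
      qed
      moreover obtain c where c: "f - cscale c w \<in> ?U" using f cfun.span_breakdown_eq by blast
      moreover have "T z f = cscale c (T z w) + T z (f - cscale c w)"
        by (subst linT[symmetric]) simp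
      ultimately show ?thesis using TU[of z] by (auto intro!: cfun.span_add cfun.span_scale)
    qed
    from S obtain k where k: "\<And>zs f. length zs = k \<Longrightarrow> set zs \<subseteq> derived_series 1 \<Longrightarrow> f \<in> ?U \<Longrightarrow>
        foldr T zs f = 0" unfolding good_def by blast
    have "foldr T zs f = 0" if "length zs = Suc k" "set zs \<subseteq> derived_series 1" "f \<in> ?U'" for zs f
    proof -
      \<comment> \<open>The last list entry acts first and moves the vector into the old subspace,
        where k factors suffice.\<close>
      have "zs \<noteq> []" using that(1) by auto
      then obtain ys z where "zs = ys @ [z]" by (meson rev_exhaust)
      then show ?thesis using that k[of ys "T z f"] TD by simp
    qed
    moreover have "w \<notin> S" using w(2) cfun.span_base by blast
    ultimately have "good (insert w S)"
      using S w TU' unfolding good_def by (auto simp: cfun.independent_insert)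
    from greatest[OF this] show False using fin[OF S] \<open>w \<notin> S\<close> by simp
  qed
  then show ?thesis using S unfolding good_def by blast
qed

end

context leibniz_algebra
begin

lemma solvable_derived_nilpotent:
  assumes \<phi>: "complex_embedding (\<phi> :: 'k \<Rightarrow> complex)" and solvable
  shows "nilpotent (derived_series 1)"
proof -
  interpret complex_embedding \<phi> by (rule \<phi>)
  obtain S where S: "finite S" "independent S" "span S = UNIV"
    using exists_finite_basis[OF subspace_UNIV] by metis
  then obtain bs where bs: "distinct bs" "set bs = S" using finite_distinct_list by blast
  have ind: "independent (set bs)" and sp: "w \<in> span (set bs)" for w using S bs by auto
  note coord = coord_add[OF bs(1) ind sp sp] coord_diff[OF bs(1) ind sp sp]
    coord_scale[OF bs(1) ind sp] coord_zero
  have coord_s: "coord bs (\<Sum>i\<in>I. f i) j = (\<Sum>i\<in>I. coord bs (f i) j)" for I :: "nat set" and f j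
    by (rule coord_sum[OF bs(1) ind sp])
  define d where "d = length bs"
  have expand: "w = (\<Sum>j<d. scale (coord bs w j) (bs ! j))" for w
    unfolding d_def by (rule coord_expand[OF bs(1) ind sp])
  define M where "M x = mat d d (\<lambda>(i, j). coord bs (br x (bs ! i)) j)" for x
  define T where "T x = row_op \<phi> d (M x)" for x
  have Mc: "M x \<in> carrier_mat d d" for x by (simp add: M_def)
  \<comment> \<open>The order of the products is reversed by the row convention.\<close>
  have Mbr: "M (br x y) = M y * M x - M x * M y" for x y
  proof (rule eq_matI)
    fix i j assume "i < dim_row (M y * M x - M x * M y)" "j < dim_col (M y * M x - M x * M y)"
    then have ij: "i < d" "j < d" by (auto simp: M_def)
    have comp: "coord bs (br x (br y (bs ! i))) j = (M y * M x) $$ (i, j)" for x y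
    proof -
      have "br x (br y (bs ! i)) = (\<Sum>l<d. scale (coord bs (br y (bs ! i)) l) (br x (bs ! l)))"
        by (subst expand[of "br y (bs ! i)"]) (simp add: br_sum_right br_scale_right)
      then show ?thesis
        using ij by (simp add: coord_s coord M_def scalar_prod_def lessThan_atLeast0)
    qed
    show "M (br x y) $$ (i, j) = (M y * M x - M x * M y) $$ (i, j)"
      using ij by (simp add: M_def[of "br x y"] br_br coord comp carrier_matD[OF Mc] del: index_mult_mat(1))
  qed (auto simp: M_def)
  interpret T: leibniz_representation scale br \<phi> T d
  proof (rule leibniz_representation.intro[OF leibniz_algebra_axioms \<phi>
        leibniz_representation_axioms.intro])
    show "cfun.endo (T x)" for x by (simp add: T_def row_op_endo)
    show "T x ` csupp d \<subseteq> csupp d" for x using row_op_csupp by (auto simp: T_def)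
    show "T (x + y) f = T x f + T y f" for x y f
      by (auto simp: T_def row_op_def fun_eq_iff M_def br_add_left coord \<phi>_add algebra_simps sum.distrib)
    show "T (scale c x) f = cscale (\<phi> c) (T x f)" for c x f
      by (auto simp: T_def row_op_def fun_eq_iff M_def br_scale_left coord \<phi>_mult algebra_simps sum_distrib_left)
    show "T (br x y) f = T x (T y f) - T y (T x f)" for x y f
    proof -
      have "T (br x y) f = row_op \<phi> d (M y * M x) f - row_op \<phi> d (M x * M y) f"
        using Mc[of x] Mc[of y]
        by (auto simp: T_def Mbr row_op_def fun_eq_iff \<phi>_diff algebra_simps sum_subtractf
            simp del: index_mult_mat(1))
      then show ?thesis by (simp only: T_def row_op_mult[OF Mc Mc])
    qed
  qed
  \<comment> \<open>Embeds L into the complex space compatibly with left multiplication, so that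
    vanishing products can be brought back to L.\<close>
  define \<iota> where "\<iota> w = (\<lambda>j. if j < d then \<phi> (coord bs w j) else 0)" for w
  have T\<iota>: "T x (\<iota> w) = \<iota> (br x w)" for x w
  proof
    fix j
    show "T x (\<iota> w) j = \<iota> (br x w) j"
    proof (cases "j < d")
      case True
      have "br x w = (\<Sum>i<d. scale (coord bs w i) (br x (bs ! i)))"
        by (subst expand[of w]) (simp add: br_sum_right br_scale_right)
      then show ?thesis using True
        by (simp add: T_def row_op_def \<iota>_def M_def coord_s coord \<phi>_sum \<phi>_mult)
    qed (simp add: T_def row_op_def \<iota>_def)
  qed
  obtain k where k: "\<And>zs f. length zs = k \<Longrightarrow> set zs \<subseteq> derived_series 1 \<Longrightarrow> f \<in> csupp d \<Longrightarrow> foldr T zs f = 0"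
    using T.derived_products_vanish[OF \<open>solvable\<close>] by blast
  have "foldr br zs w = 0" if "length zs = k" "set zs \<subseteq> derived_series 1" for zs w
  proof -
    have "\<iota> (foldr br zs w) = foldr T zs (\<iota> w)" for zs
      by (induction zs) (simp_all add: T\<iota>[symmetric])
    moreover have "\<iota> w \<in> csupp d" by (simp add: \<iota>_def csupp_def)
    ultimately have "\<iota> (foldr br zs w) = 0" using k[OF that] by simp
    then have "coord bs (foldr br zs w) j = 0" if "j < d" for j
      using that by (auto simp: \<iota>_def fun_eq_iff split: if_splits)
    then show ?thesis by (subst expand) simp
  qed
  then have "{foldr br zs w | zs w. length zs = k \<and> set zs \<subseteq> derived_series 1 \<and> w \<in> derived_series 1} \<subseteq> {0}"
    by auto
  then have "lower_central (derived_series 1) k \<subseteq> {0}"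
    using lower_central_subset_products[of "derived_series 1" k] span_minimal subspace_single_0
    by (meson order_trans)
  then show ?thesis by (rule nilpotentI)
qed

end

section \<open>Algebras with Heisenberg nilradical\<close>

context leibniz_algebra
begin

text \<open>A nilpotent ideal of largest dimension containing M is maximal, and
  \<open>is_nilradical\<close> makes maximal nilpotent ideals unique. No sum of nilpotent ideals is
  formed.\<close>

lemma nilpotent_ideal_subset_nilradical:
  assumes N: "is_nilradical N" and M: "two_sided_ideal M" "nilpotent M"
  shows "M \<subseteq> N"
proof -
  obtain S where S: "finite S" "independent S" "span S = UNIV"
    using exists_finite_basis[OF subspace_UNIV] by metis
  interpret finite_dimensional_vector_space scale S
    by unfold_locales (use S in auto)
  define good where "good W \<longleftrightarrow> two_sided_ideal W \<and> nilpotent W \<and> M \<subseteq> W" for W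
  have "good M" using M by (simp add: good_def)
  moreover have "\<forall>W. good W \<longrightarrow> dim W < Suc (card S)"
    using dim_subset_UNIV by (simp add: less_Suc_eq_le dimension_def)
  ultimately obtain W where W: "good W" and greatest: "\<And>W'. good W' \<Longrightarrow> dim W' \<le> dim W"
    using ex_has_greatest_nat[of good M dim "Suc (card S)"] by blast
  have "maximal_nilpotent_ideal W"
    unfolding maximal_nilpotent_ideal_def
  proof (intro conjI allI impI)
    fix W' assume W': "two_sided_ideal W' \<and> nilpotent W' \<and> W \<subseteq> W'"
    then have "good W'" using W by (auto simp: good_def)
    from greatest[OF this] have "W = W'"
      using W W' by (intro subspace_dim_equal) (auto simp: good_def two_sided_ideal_def)
    then show "W' = W" by simp
  qed (use W in \<open>auto simp: good_def\<close>)
  then have "W = N" using N by (simp add: is_nilradical_def)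
  then show ?thesis using W by (simp add: good_def)
qed

text \<open>By \<open>br_br\<close> the left multiplication by [x,y] is antisymmetric in x and y,
  even if the bracket is not.\<close>

lemma anticommutator_left_annihilates: "br (br x y + br y x) z = 0"
  by (simp add: br_add_left br_br)

end

locale heisenberg_nilradical = leibniz_algebra scale br
  for scale :: "'k::real_or_complex \<Rightarrow> 'v::ab_group_add \<Rightarrow> 'v" and br +
  fixes n :: nat and N :: "'v set" and H :: 'v and P B :: "nat \<Rightarrow> 'v"
  assumes n_pos: "1 \<le> n"
    and heis: "heisenberg_basis n H P B N"
    and nilrad: "is_nilradical N"
    and solv: solvable
begin

text \<open>One index for P and B together turns the multiplication table into [e_i,e_j] = K_ij
  H.\<close>

definition e :: "nat \<Rightarrow> 'v" where
  "e i = (if i < n then P i else B (i - n))"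

abbreviation hl :: "'v list" where
  "hl \<equiv> heis_list n H P B"

abbreviation K :: "nat \<Rightarrow> nat \<Rightarrow> 'k" where
  "K \<equiv> symp_entry n"

section \<open>Coordinates and brackets inside the Heisenberg ideal\<close>

lemma hl_props: "distinct hl" "independent (set hl)" "span (set hl) = N"
  using heis by (auto simp: heisenberg_basis_def is_basis_def)

lemma length_hl: "length hl = Suc (2 * n)"
  by (simp add: heis_list_def)

lemma hl_0: "hl ! 0 = H"
  by (simp add: heis_list_def)

lemma hl_Suc: "i < 2 * n \<Longrightarrow> hl ! Suc i = e i"
  by (auto simp: heis_list_def e_def nth_append)

lemma sum_hl: "(\<Sum>j<length hl. scale (c j) (hl ! j)) = scale (c 0) H + (\<Sum>j<2 * n. scale (c (Suc j)) (e j))"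
  unfolding length_hl by (subst sum.lessThan_Suc_shift) (simp add: hl_0 hl_Suc)

lemma H_in_N: "H \<in> N"
  using hl_props(3) hl_0 length_hl by (metis nth_mem span_base zero_less_Suc)

lemma e_in_N: "i < 2 * n \<Longrightarrow> e i \<in> N"
  using hl_props(3) hl_Suc length_hl by (metis Suc_less_eq nth_mem span_base)

lemma ideal_N: "two_sided_ideal N" and nilpotent_N: "nilpotent N"
  using nilrad by (auto simp: is_nilradical_def maximal_nilpotent_ideal_def)

lemma subspace_N: "subspace N"
  using ideal_N by (simp add: two_sided_ideal_def)

lemma span_N: "span N = N"
  by (simp only: span_eq_iff subspace_N)

lemma br_in_N: "w \<in> N \<Longrightarrow> br x w \<in> N" "w \<in> N \<Longrightarrow> br w x \<in> N"
  using ideal_N by (auto simp: two_sided_ideal_def)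

definition hc :: "'v \<Rightarrow> 'k" where "hc w = coord hl w 0"

definition ec :: "'v \<Rightarrow> nat \<Rightarrow> 'k" where "ec w i = coord hl w (Suc i)"

lemma N_expand: "w \<in> N \<Longrightarrow> w = scale (hc w) H + (\<Sum>i<2 * n. scale (ec w i) (e i))"
  using coord_expand[OF hl_props(1,2), of w] hl_props(3) by (simp add: sum_hl hc_def ec_def)

lemma hc_add: "v \<in> N \<Longrightarrow> w \<in> N \<Longrightarrow> hc (v + w) = hc v + hc w"
  and hc_diff: "v \<in> N \<Longrightarrow> w \<in> N \<Longrightarrow> hc (v - w) = hc v - hc w"
  and hc_scale: "w \<in> N \<Longrightarrow> hc (scale c w) = c * hc w"
  and hc_zero: "hc 0 = 0"
  using coord_add[OF hl_props(1,2)] coord_diff[OF hl_props(1,2)] coord_scale[OF hl_props(1,2)]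
    coord_zero[OF hl_props(1,2)] hl_props(3)
  by (simp_all add: hc_def)

lemma hc_sum: "(\<And>i. i \<in> I \<Longrightarrow> f i \<in> N) \<Longrightarrow> hc (\<Sum>i\<in>I. f i) = (\<Sum>i\<in>I. hc (f i))"
  unfolding hc_def by (rule coord_sum[OF hl_props(1,2)]) (simp add: hl_props(3))

lemma ec_add: "v \<in> N \<Longrightarrow> w \<in> N \<Longrightarrow> ec (v + w) j = ec v j + ec w j"
  and ec_scale: "w \<in> N \<Longrightarrow> ec (scale c w) j = c * ec w j"
  and ec_zero: "ec 0 j = 0"
  using coord_add[OF hl_props(1,2)] coord_diff[OF hl_props(1,2)] coord_scale[OF hl_props(1,2)]
    coord_zero[OF hl_props(1,2)] hl_props(3)
  by (simp_all add: ec_def)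

lemma ec_sum: "(\<And>i. i \<in> I \<Longrightarrow> f i \<in> N) \<Longrightarrow> ec (\<Sum>i\<in>I. f i) j = (\<Sum>i\<in>I. ec (f i) j)"
  unfolding ec_def by (rule coord_sum[OF hl_props(1,2)]) (simp add: hl_props(3))

lemma hc_H: "hc H = 1" and ec_H: "j < 2 * n \<Longrightarrow> ec H j = 0"
  and hc_e: "i < 2 * n \<Longrightarrow> hc (e i) = 0"
  and ec_e: "i < 2 * n \<Longrightarrow> j < 2 * n \<Longrightarrow> ec (e i) j = (if i = j then 1 else 0)"
  using coord_nth[OF hl_props(1,2), of 0 0] coord_nth[OF hl_props(1,2), of 0 "Suc j"]
    coord_nth[OF hl_props(1,2), of "Suc i" 0] coord_nth[OF hl_props(1,2), of "Suc i" "Suc j"]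
  by (simp_all add: hc_def ec_def length_hl hl_0 hl_Suc)

lemma hc_comb: "hc (\<Sum>i<2 * n. scale (c i) (e i)) = 0"
  by (subst hc_sum) (auto simp: hc_scale hc_e e_in_N subspace_scale[OF subspace_N])

lemma ec_comb: "j < 2 * n \<Longrightarrow> ec (\<Sum>i<2 * n. scale (c i) (e i)) j = c j"
  by (subst ec_sum)
    (auto simp: ec_scale ec_e e_in_N subspace_scale[OF subspace_N] if_distrib cong: if_cong)

lemma comb_in_N: "(\<Sum>i<2 * n. scale (c i) (e i)) \<in> N"
  by (intro subspace_sum[OF subspace_N] subspace_scale[OF subspace_N] e_in_N) auto

lemma H_nonzero: "H \<noteq> 0"
  using hc_H hc_zero by auto

lemma scale_H_in_N: "scale c H \<in> N"
  by (intro subspace_scale[OF subspace_N] H_in_N)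

lemma br_e_e: "i < 2 * n \<Longrightarrow> j < 2 * n \<Longrightarrow> br (e i) (e j) = scale (K i j) H"
  using heis by (auto simp: heisenberg_basis_def e_def symp_entry_def)

lemma br_H_N: "w \<in> N \<Longrightarrow> br H w = 0" and br_N_H: "w \<in> N \<Longrightarrow> br w H = 0"
proof -
  have *: "br H H = 0" "i < 2 * n \<Longrightarrow> br H (e i) = 0" "i < 2 * n \<Longrightarrow> br (e i) H = 0" for i
    using heis by (auto simp: heisenberg_basis_def e_def)
  assume w: "w \<in> N"
  show "br H w = 0"
    by (subst N_expand[OF w]) (simp add: br_add_right br_sum_right br_scale_right *)
  show "br w H = 0"
    by (subst N_expand[OF w]) (simp add: br_add_left br_sum_left br_scale_left *)
qed

lemma br_N_e: "w \<in> N \<Longrightarrow> j < 2 * n \<Longrightarrow> br w (e j) = scale (\<Sum>i<2 * n. ec w i * K i j) H"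
  by (subst N_expand)
    (simp_all add: br_add_left br_sum_left br_scale_left br_H_N e_in_N br_e_e scale_sum_left)

lemma br_e_N: "w \<in> N \<Longrightarrow> j < 2 * n \<Longrightarrow> br (e j) w = scale (\<Sum>i<2 * n. K j i * ec w i) H"
  by (subst N_expand)
    (simp_all add: br_add_right br_sum_right br_scale_right br_N_H e_in_N br_e_e scale_sum_left mult.commute)

lemma br_N_N:
  assumes "v \<in> N" "w \<in> N"
  shows "br v w = scale (\<Sum>j<2 * n. ec w j * (\<Sum>i<2 * n. ec v i * K i j)) H"
  by (subst N_expand[OF assms(2)])
    (simp add: br_add_right br_sum_right br_scale_right br_N_H br_N_e assms scale_sum_left[symmetric])

lemma br_N_antisym:
  assumes "v \<in> N" "j < 2 * n"
  shows "br v (e j) = - br (e j) v"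
proof -
  have "(\<Sum>i<2 * n. ec v i * K i j) = - (\<Sum>i<2 * n. K j i * ec v i)"
    unfolding sum_negf[symmetric]
    by (intro sum.cong refl) (subst symp_entry_antisym, simp)
  then show ?thesis by (simp add: br_N_e[OF assms] br_e_N[OF assms])
qed

text \<open>K is nondegenerate: each e-coordinate of w appears up to sign as the H-coordinate of
  some [w,e_j].\<close>

lemma centralizer:
  assumes w: "w \<in> N" and "\<And>j. j < 2 * n \<Longrightarrow> br w (e j) = 0"
  shows "w = scale (hc w) H"
proof -
  have 0: "(\<Sum>i<2 * n. K j i * ec w i) = 0" if "j < 2 * n" for j
    using assms(2)[OF that] br_N_antisym[OF w that] br_e_N[OF w that] H_nonzero by simp
  have "ec w i = 0" if i: "i < 2 * n" for i
  proof (cases "i < n")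
    case True
    then show ?thesis using 0[of "n + i"] sum_symp_entry[of "n + i" n "ec w"] by simp
  next
    case False
    then have "i - n < n" "n + (i - n) = i" using i by auto
    then show ?thesis using 0[of "i - n"] i sum_symp_entry[of "i - n" n "ec w"] by simp
  qed
  then show ?thesis by (subst (1) N_expand[OF w]) simp
qed

section \<open>The action of the whole algebra on the nilradical\<close>

lemma br_in_nilradical: "br x y \<in> N"
proof -
  obtain \<phi> :: "'k \<Rightarrow> complex" where "complex_embedding \<phi>" using exists_complex_embedding by blast
  from solvable_derived_nilpotent[OF this solv] have "nilpotent (derived_series 1)" .
  moreover have "two_sided_ideal (derived_series 1)"
    using subspace_derived_series[of 1] by (auto simp: two_sided_ideal_def intro: bracket_set_memI)
  ultimately have "derived_series 1 \<subseteq> N" using nilpotent_ideal_subset_nilradical[OF nilrad] by blast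
  moreover have "br x y \<in> derived_series 1" by (simp add: bracket_set_memI)
  ultimately show ?thesis by blast
qed

definition sq :: "'v \<Rightarrow> 'v \<Rightarrow> 'k" where "sq x y = hc (br x y + br y x)"

lemma anticommutator: "br x y + br y x = scale (sq x y) H"
  unfolding sq_def
  by (intro centralizer subspace_add[OF subspace_N] br_in_nilradical anticommutator_left_annihilates)

lemma br_swap: "br y x = scale (sq x y) H - br x y"
  using anticommutator[of x y] by (simp add: algebra_simps eq_diff_eq)

definition lam :: "'v \<Rightarrow> 'k" where "lam x = hc (br x H)"

text \<open>As n \<ge> 1, H = [e_0,e_n], and a derivation keeps this in [N,N] = FH. For [H,x] the
  anticommutator leaves the multiple of H open; expanding [[e_0,e_n],x] determines it, because the
  ambiguous H-terms are central in N.\<close>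

lemma br_x_H: "br x H = scale (lam x) H"
  and br_H_x: "br H x = scale (- lam x) H"
proof -
  have n: "0 < 2 * n" "n < 2 * n" using n_pos by auto
  have H: "H = br (e 0) (e n)" using n_pos by (simp add: br_e_e symp_entry_def)
  have xH: "br x H = br (br x (e 0)) (e n) + br (e 0) (br x (e n))"
    by (subst H) (rule left_leibniz)
  obtain c1 c2 where "br (br x (e 0)) (e n) = scale c1 H" "br (e 0) (br x (e n)) = scale c2 H"
    using br_N_e[OF br_in_nilradical n(2)] br_e_N[OF br_in_nilradical n(1)] by blast
  then obtain c where "br x H = scale c H" unfolding xH by (metis scale_left_distrib)
  then show 1: "br x H = scale (lam x) H" by (simp add: lam_def hc_scale H_in_N hc_H)
  have "br H x = br (e 0) (br (e n) x) - br (e n) (br (e 0) x)"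
    by (subst H) (rule br_br)
  also have "\<dots> = - br (e 0) (br x (e n)) + br (e n) (br x (e 0))"
    unfolding br_swap[of "e _" x] br_diff_right br_scale_right using n by (simp add: br_N_H e_in_N)
  also have "\<dots> = - br x H"
    unfolding xH using br_N_antisym[OF br_in_N(1)[OF e_in_N[OF n(1)]] n(2), of x] by simp
  finally show "br H x = scale (- lam x) H" using 1 by simp
qed

lemma lam_N: "w \<in> N \<Longrightarrow> lam w = 0"
  by (simp add: lam_def br_N_H hc_zero)

lemma lam_diff: "lam (x - y) = lam x - lam y"
  and lam_scale: "lam (scale c x) = c * lam x"
  and lam_sum: "lam (\<Sum>i\<in>I. f i) = (\<Sum>i\<in>I. lam (f i))"
  by (simp_all add: lam_def br_add_left br_diff_left br_scale_left br_sum_left hc_add hc_diff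
      hc_scale hc_sum br_in_nilradical)

definition m :: "'v \<Rightarrow> nat \<Rightarrow> nat \<Rightarrow> 'k" where "m x i j = ec (br x (e i)) j"

lemma m_scale: "m (scale c x) i j = c * m x i j"
  and m_sum: "m (\<Sum>a\<in>I. f a) i j = (\<Sum>a\<in>I. m (f a) i j)"
  by (simp_all add: m_def br_add_left br_scale_left br_sum_left ec_add ec_scale ec_sum br_in_nilradical)

text \<open>Apply the derivation \<open>br x\<close> to [e_i,e_j] = K_ij H and compare coefficients
  of H.\<close>

lemma m_derivation:
  assumes "i < 2 * n" "j < 2 * n"
  shows "(\<Sum>l<2 * n. m x i l * K l j) + (\<Sum>l<2 * n. K i l * m x j l) = lam x * K i j"
proof -
  have "br x (br (e i) (e j)) = br (br x (e i)) (e j) + br (e i) (br x (e j))"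
    by (rule left_leibniz)
  then have "scale (lam x * K i j) H
      = scale ((\<Sum>l<2 * n. m x i l * K l j) + (\<Sum>l<2 * n. K i l * m x j l)) H"
    using assms
    by (simp add: br_e_e br_scale_right br_x_H br_N_e br_e_N br_in_nilradical m_def scale_left_distrib
        mult.commute)
  then show ?thesis using H_nonzero by simp
qed

text \<open>The normalised elements: their left multiplication maps the span of the e_i into
  itself.\<close>

definition Q :: "'v set" where
  "Q = {x. \<forall>i<2 * n. hc (br x (e i)) = 0}"

lemma subspace_Q: "subspace Q"
  by (rule subspaceI)
    (auto simp: Q_def hc_zero br_add_left hc_add br_scale_left hc_scale br_in_nilradical)

lemma br_Q_e: "x \<in> Q \<Longrightarrow> i < 2 * n \<Longrightarrow> br x (e i) = (\<Sum>j<2 * n. scale (m x i j) (e j))"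
  using N_expand[OF br_in_nilradical, of x "e i"] by (simp add: Q_def m_def)

lemma exists_Q_translate: "\<exists>w\<in>N. x - w \<in> Q"
proof -
  define \<xi> where "\<xi> i = hc (br x (e i))" for i
  \<comment> \<open>These coefficients are K \<xi>. The H-coordinates of the [w,e_j] form - K (K
    \<xi>) = \<xi>, as K squared is -1.\<close>
  define w where "w = (\<Sum>i<2 * n. scale (if i < n then \<xi> (n + i) else - \<xi> (i - n)) (e i))"
  have w: "w \<in> N" unfolding w_def by (rule comb_in_N)
  have "hc (br w (e j)) = \<xi> j" if j: "j < 2 * n" for j
  proof -
    have "(\<Sum>i<2 * n. K j i * ec w i) = - \<xi> j"
      unfolding sum_symp_entry[OF j] using j by (auto simp: w_def ec_comb)
    then show ?thesis
      using br_N_antisym[OF w j] by (simp add: br_e_N[OF w j] hc_scale H_in_N hc_H)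
  qed
  then have "x - w \<in> Q" by (simp add: Q_def br_diff_left hc_diff br_in_nilradical \<xi>_def)
  with w show ?thesis by blast
qed

lemma br_Q_Q:
  assumes x: "x \<in> Q" and y: "y \<in> Q"
  shows "br x y = scale (hc (br x y)) H"
    and "i < 2 * n \<Longrightarrow> j < 2 * n \<Longrightarrow>
      (\<Sum>l<2 * n. m y i l * m x l j) = (\<Sum>l<2 * n. m x i l * m y l j)"
proof -
  have twice: "br x (br y (e i)) = (\<Sum>j<2 * n. scale (\<Sum>l<2 * n. m y i l * m x l j) (e j))"
    if "x \<in> Q" "y \<in> Q" "i < 2 * n" for x y i
  proof -
    have "br x (br y (e i)) = (\<Sum>l<2 * n. \<Sum>j<2 * n. scale (m y i l * m x l j) (e j))"
      using that by (simp add: br_Q_e br_sum_right br_scale_right scale_sum_right)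
    also have "\<dots> = (\<Sum>j<2 * n. \<Sum>l<2 * n. scale (m y i l * m x l j) (e j))" by (rule sum.swap)
    finally show ?thesis by (simp add: scale_sum_left)
  qed
  define D where "D i j = (\<Sum>l<2 * n. m y i l * m x l j) - (\<Sum>l<2 * n. m x i l * m y l j)" for i j
  have br_e: "br (br x y) (e i) = (\<Sum>j<2 * n. scale (D i j) (e j))" if "i < 2 * n" for i
    using that by (simp add: br_br twice x y D_def scale_left_diff_distrib sum_subtractf)
  have zero: "br (br x y) (e i) = 0" if i: "i < 2 * n" for i
  proof -
    obtain c where c: "br (br x y) (e i) = scale c H"
      using br_N_e[OF br_in_nilradical i] by blast
    then have "c = hc (br (br x y) (e i))" by (simp add: hc_scale H_in_N hc_H)
    also have "\<dots> = 0" unfolding br_e[OF i] by (rule hc_comb)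
    finally show ?thesis using c by simp
  qed
  show "br x y = scale (hc (br x y)) H"
    by (rule centralizer[OF br_in_nilradical zero])
  assume i: "i < 2 * n" and j: "j < 2 * n"
  have "D i j = ec (br (br x y) (e i)) j" unfolding br_e[OF i] by (rule ec_comb[OF j, symmetric])
  then have "D i j = 0" by (simp add: zero[OF i] ec_zero)
  then show "(\<Sum>l<2 * n. m y i l * m x l j) = (\<Sum>l<2 * n. m x i l * m y l j)" by (simp add: D_def)
qed

definition Mm :: "'v \<Rightarrow> 'k mat" where
  "Mm x = mat (2 * n) (2 * n) (\<lambda>(i, j). m x i j)"

lemma Mm_carrier: "Mm x \<in> carrier_mat (2 * n) (2 * n)"
  by (simp add: Mm_def)

text \<open>The span of \<open>N\<close> and \<open>x\<close> is a nilpotent ideal.\<close>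

lemma nilpotent_action_in_N:
  assumes x: "x \<in> Q" and lam: "lam x = 0" and nil: "nilpotent_mat (Mm x)"
  shows "x \<in> N"
proof -
  let ?M = "span (insert x N)"
  have N_sub: "N \<subseteq> ?M" using span_superset by blast
  have "two_sided_ideal ?M"
    unfolding two_sided_ideal_def using N_sub br_in_nilradical by auto
  moreover have "nilpotent ?M"
  proof -
    from nil obtain k where k: "Mm x ^\<^sub>m k = 0\<^sub>m (2 * n) (2 * n)"
      by (auto simp: nilpotent_mat_def Mm_def)
    \<comment> \<open>Left multiplication by any y in N + Fx maps F t into F (Suc t): the x-part
      raises the power, and the N-part lands in FH.\<close>
    define F where "F t = span (insert H {(br x ^^ t) (e i) | i. i < 2 * n})" for t
    have pow: "(br x ^^ t) (e i) = (\<Sum>j<2 * n. scale ((Mm x ^\<^sub>m t) $$ (i, j)) (e j))"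
      if i: "i < 2 * n" for t i
    proof (induction t)
      case 0
      have "(\<Sum>j<2 * n. scale ((Mm x ^\<^sub>m 0) $$ (i, j)) (e j)) = (\<Sum>j<2 * n. if j = i then e i else 0)"
        using i by (intro sum.cong) (auto simp: Mm_def)
      then show ?case using i by simp
    next
      case (Suc t)
      have "(br x ^^ Suc t) (e i) = (\<Sum>l<2 * n. \<Sum>j<2 * n. scale ((Mm x ^\<^sub>m t) $$ (i, l) * m x l j) (e j))"
        by (simp add: Suc br_sum_right br_scale_right br_Q_e[OF x] scale_sum_right)
      also have "\<dots> = (\<Sum>j<2 * n. \<Sum>l<2 * n. scale ((Mm x ^\<^sub>m t) $$ (i, l) * m x l j) (e j))"
        by (rule sum.swap)
      also have "\<dots> = (\<Sum>j<2 * n. scale ((Mm x ^\<^sub>m Suc t) $$ (i, j)) (e j))"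
      proof (intro sum.cong refl)
        fix j assume "j \<in> {..<2 * n}"
        then have "(Mm x ^\<^sub>m Suc t) $$ (i, j) = (\<Sum>l<2 * n. (Mm x ^\<^sub>m t) $$ (i, l) * m x l j)"
          using i pow_carrier_mat[OF Mm_carrier, of x t]
          by (auto simp: scalar_prod_def lessThan_atLeast0 Mm_def)
        then show "(\<Sum>l<2 * n. scale ((Mm x ^\<^sub>m t) $$ (i, l) * m x l j) (e j))
            = scale ((Mm x ^\<^sub>m Suc t) $$ (i, j)) (e j)"
          by (simp add: scale_sum_left)
      qed
      finally show ?case .
    qed
    have eN: "(br x ^^ t) (e i) \<in> N" if "i < 2 * n" for t i
      unfolding pow[OF that] by (rule comb_in_N)
    have step: "br y w \<in> F (Suc t)" if y: "y \<in> ?M" and w: "w \<in> F t" for y w t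
    proof -
      obtain c where c: "y - scale c x \<in> N"
        using y span_breakdown_eq[of y x N] by (auto simp: span_N)
      have y_eq: "br y u = br (y - scale c x) u + scale c (br x u)" for u
        by (simp add: br_diff_left br_scale_left)
      have HF: "scale b H \<in> F (Suc t)" for b unfolding F_def by (intro span_scale span_base) simp
      have yH: "br y H = 0" unfolding y_eq by (simp add: br_x_H lam lam_N[OF c])
      from w show ?thesis unfolding F_def[of t]
      proof (induction w rule: span_induct_alt)
        case base
        then show ?case by (simp add: F_def span_zero)
      next
        case (step b u u')
        have "br y u \<in> F (Suc t)"
        proof (cases "u = H")
          case True
          then show ?thesis by (simp add: yH F_def span_zero)
        next
          case False
          then obtain i where i: "i < 2 * n" "u = (br x ^^ t) (e i)" using step(1) by auto
          have "br x u \<in> F (Suc t)"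
            unfolding F_def by (rule span_base) (use i in auto)
          moreover have "br (y - scale c x) u \<in> F (Suc t)"
            unfolding i(2) br_N_N[OF c eN[OF i(1)]] by (rule HF)
          ultimately show ?thesis
            unfolding y_eq F_def by (intro span_add span_scale)
        qed
        then show ?case using step(2) unfolding br_add_right br_scale_right F_def
          by (intro span_add span_scale)
      qed
    qed
    have N_F: "N \<subseteq> F 0"
    proof
      fix w assume "w \<in> N"
      have "H \<in> F 0" "\<And>i. i < 2 * n \<Longrightarrow> e i \<in> F 0"
        unfolding F_def by (auto intro!: span_base)
      then have "scale (hc w) H + (\<Sum>i<2 * n. scale (ec w i) (e i)) \<in> F 0"
        unfolding F_def by (intro span_add span_sum span_scale) auto
      then show "w \<in> F 0" using N_expand[OF \<open>w \<in> N\<close>] by simp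
    qed
    \<comment> \<open>The index is shifted because the first bracket already falls into N, hence
      into F 0.\<close>
    have "lower_central ?M (Suc t) \<subseteq> F t" for t
    proof (induction t)
      case 0
      show ?case unfolding lower_central.simps
        by (intro bracket_set_subset) (use br_in_nilradical N_F in \<open>auto simp: F_def\<close>)
    next
      case (Suc t)
      show ?case unfolding lower_central.simps(2)[of _ "Suc t"]
        by (intro bracket_set_subset) (use step Suc in \<open>auto simp: F_def\<close>)
    qed
    moreover have "F k \<subseteq> span {H}"
      unfolding F_def by (rule span_minimal) (auto simp: pow k span_zero intro: span_base)
    ultimately have lc: "lower_central ?M (Suc k) \<subseteq> span {H}" by blast
    \<comment> \<open>What remains is FH; one more bracket kills it, since both N and x annihilate H
      from the left.\<close>
    have "lower_central ?M (Suc (Suc k)) \<subseteq> {0}"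
      unfolding lower_central.simps(2)[of _ "Suc k"]
    proof (rule bracket_set_subset)
      fix y w assume y: "y \<in> ?M" and "w \<in> lower_central ?M (Suc k)"
      then obtain b where w: "w = scale b H" using lc by (auto simp: span_singleton)
      obtain c where c: "y - scale c x \<in> N"
        using y span_breakdown_eq[of y x N] by (auto simp: span_N)
      have "br y H = br (y - scale c x) H + scale c (br x H)"
        by (simp add: br_diff_left br_scale_left)
      then show "br y w \<in> {0}" by (simp add: w br_scale_right br_x_H lam lam_N[OF c])
    qed simp
    then show ?thesis by (rule nilpotentI)
  qed
  ultimately have "?M \<subseteq> N" by (rule nilpotent_ideal_subset_nilradical[OF nilrad])
  then show ?thesis using span_base by blast
qed

end

section \<open>The structure matrices\<close>

lemma left_mat_index:
  assumes "A \<in> carrier_mat n n" "C \<in> carrier_mat n n" "D \<in> carrier_mat n n"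
  shows "left_mat n a A C D $$ (0, 0) = 2 * a"
    and "j < 2 * n \<Longrightarrow> left_mat n a A C D $$ (0, Suc j) = 0"
    and "i < 2 * n \<Longrightarrow> left_mat n a A C D $$ (Suc i, 0) = 0"
    and "i < 2 * n \<Longrightarrow> j < 2 * n \<Longrightarrow>
      left_mat n a A C D $$ (Suc i, Suc j) = X_mat A C D $$ (i, j) + (if i = j then a else 0)"
  using assms by (auto simp: left_mat_def X_mat_def)

lemma right_mat_index:
  assumes "A \<in> carrier_mat n n" "C \<in> carrier_mat n n" "D \<in> carrier_mat n n"
    and "\<rho>1 \<in> carrier_vec n" "\<rho>2 \<in> carrier_vec n"
  shows "right_mat n a A C D \<rho>1 \<rho>2 $$ (0, 0) = - (2 * a)"
    and "j < 2 * n \<Longrightarrow> right_mat n a A C D \<rho>1 \<rho>2 $$ (0, Suc j) = 0"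
    and "i < 2 * n \<Longrightarrow> right_mat n a A C D \<rho>1 \<rho>2 $$ (Suc i, 0) = (\<rho>1 @\<^sub>v \<rho>2) $ i"
    and "i < 2 * n \<Longrightarrow> j < 2 * n \<Longrightarrow>
      right_mat n a A C D \<rho>1 \<rho>2 $$ (Suc i, Suc j) = - X_mat A C D $$ (i, j) - (if i = j then a else 0)"
  using assms by (auto simp: right_mat_def X_mat_def mat_of_cols_index)

context heisenberg_nilradical
begin

text \<open>A scalar matrix c I contributes 2cK to M K + K M^T, so removing lam/2 turns
  \<open>m_derivation\<close> into the symplectic condition.\<close>

definition Xm :: "'v \<Rightarrow> 'k mat" where
  "Xm x = mat (2 * n) (2 * n) (\<lambda>(i, j). m x i j - (if i = j then lam x / 2 else 0))"

lemma Xm_carrier: "Xm x \<in> carrier_mat (2 * n) (2 * n)"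
  by (simp add: Xm_def)

lemma Xm_eq_Mm: "lam x = 0 \<Longrightarrow> Xm x = Mm x"
  by (auto simp: Xm_def Mm_def intro!: eq_matI)

lemma Xm_sp: "Xm x \<in> sp n"
  unfolding sp_index[OF Xm_carrier]
proof (intro allI impI)
  fix i j assume ij: "i < 2 * n" "j < 2 * n"
  have "(\<Sum>l<2 * n. Xm x $$ (i, l) * K l j) = (\<Sum>l<2 * n. m x i l * K l j - (if l = i then lam x / 2 * K l j else 0))"
    using ij by (intro sum.cong) (auto simp: Xm_def algebra_simps)
  also have "\<dots> = (\<Sum>l<2 * n. m x i l * K l j) - lam x / 2 * K i j"
    using ij by (simp add: sum_subtractf)
  finally have 1: "(\<Sum>l<2 * n. Xm x $$ (i, l) * K l j) = (\<Sum>l<2 * n. m x i l * K l j) - lam x / 2 * K i j" .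
  have "(\<Sum>l<2 * n. K i l * Xm x $$ (j, l)) = (\<Sum>l<2 * n. K i l * m x j l - (if l = j then lam x / 2 * K i l else 0))"
    using ij by (intro sum.cong) (auto simp: Xm_def algebra_simps)
  also have "\<dots> = (\<Sum>l<2 * n. K i l * m x j l) - lam x / 2 * K i j"
    using ij by (simp add: sum_subtractf)
  finally have 2: "(\<Sum>l<2 * n. K i l * Xm x $$ (j, l)) = (\<Sum>l<2 * n. K i l * m x j l) - lam x / 2 * K i j" .
  have "(\<Sum>l<2 * n. Xm x $$ (i, l) * K l j) + (\<Sum>l<2 * n. K i l * Xm x $$ (j, l))
      = ((\<Sum>l<2 * n. m x i l * K l j) + (\<Sum>l<2 * n. K i l * m x j l)) - lam x * K i j"
    unfolding 1 2 by (simp add: field_simps)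
  then show "(\<Sum>l<2 * n. Xm x $$ (i, l) * K l j) + (\<Sum>l<2 * n. K i l * Xm x $$ (j, l)) = 0"
    by (simp add: m_derivation[OF ij])
qed

lemma Xm_commute:
  assumes "x \<in> Q" "y \<in> Q"
  shows "Xm x * Xm y = Xm y * Xm x"
proof (rule eq_matI)
  fix i j assume "i < dim_row (Xm y * Xm x)" "j < dim_col (Xm y * Xm x)"
  then have ij: "i < 2 * n" "j < 2 * n" by (auto simp: Xm_def)
  \<comment> \<open>Apart from the product of the m-matrices, the terms are symmetric under exchange
    of x and y.\<close>
  have prod: "(Xm x * Xm y) $$ (i, j) = (\<Sum>l<2 * n. m x i l * m y l j)
      - lam y / 2 * m x i j - lam x / 2 * m y i j + (if i = j then lam x / 2 * (lam y / 2) else 0)" for x y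
  proof -
    have "(Xm x * Xm y) $$ (i, j) = (\<Sum>l<2 * n. Xm x $$ (i, l) * Xm y $$ (l, j))"
      using ij by (simp add: Xm_def scalar_prod_def lessThan_atLeast0)
    also have "\<dots> = (\<Sum>l<2 * n. m x i l * m y l j - (if l = j then lam y / 2 * m x i l else 0)
        - (if l = i then lam x / 2 * m y l j else 0)
        + (if l = i then (if i = j then lam x / 2 * (lam y / 2) else 0) else 0))"
      using ij by (intro sum.cong) (auto simp: Xm_def algebra_simps)
    also have "\<dots> = (\<Sum>l<2 * n. m x i l * m y l j)
      - lam y / 2 * m x i j - lam x / 2 * m y i j + (if i = j then lam x / 2 * (lam y / 2) else 0)"
      using ij by (simp add: sum_subtractf sum.distrib)
    finally show ?thesis .
  qed
  show "(Xm x * Xm y) $$ (i, j) = (Xm y * Xm x) $$ (i, j)"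
    unfolding prod br_Q_Q(2)[OF assms ij] by (simp add: mult.commute)
qed (auto simp: Xm_def)

definition blockA :: "'v \<Rightarrow> 'k mat" where
  "blockA x = mat n n (\<lambda>(i, j). Xm x $$ (i, j))"

definition blockC :: "'v \<Rightarrow> 'k mat" where
  "blockC x = mat n n (\<lambda>(i, j). Xm x $$ (i, n + j))"

definition blockD :: "'v \<Rightarrow> 'k mat" where
  "blockD x = mat n n (\<lambda>(i, j). Xm x $$ (n + i, j))"

lemma block_carrier:
  "blockA x \<in> carrier_mat n n" "blockC x \<in> carrier_mat n n" "blockD x \<in> carrier_mat n n"
  by (auto simp: blockA_def blockC_def blockD_def)

lemma Xm_blocks: "Xm x = X_mat (blockA x) (blockC x) (blockD x)"
proof (rule eq_matI)
  fix i j
  assume "i < dim_row (X_mat (blockA x) (blockC x) (blockD x))"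
    "j < dim_col (X_mat (blockA x) (blockC x) (blockD x))"
  then have ij: "i < 2 * n" "j < 2 * n" by (auto simp: X_mat_def blockA_def)
  \<comment> \<open>The symplectic condition at position (j, n + i) forces the lower right block to
    be minus the transpose of the upper left one.\<close>
  have skew: "Xm x $$ (n + i, n + j) = - Xm x $$ (j, i)" if "i < n" "j < n" for i j
  proof -
    have "(\<Sum>l<2 * n. Xm x $$ (j, l) * K l (n + i)) + (\<Sum>l<2 * n. K j l * Xm x $$ (n + i, l)) = 0"
      using Xm_sp[of x] that unfolding sp_index[OF Xm_carrier] by auto
    moreover have "(\<Sum>l<2 * n. Xm x $$ (j, l) * K l (n + i)) = (\<Sum>l<2 * n. if l = i then Xm x $$ (j, l) else 0)"
      using that by (intro sum.cong) (auto simp: symp_entry_def)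
    moreover have "(\<Sum>l<2 * n. K j l * Xm x $$ (n + i, l)) = Xm x $$ (n + i, n + j)"
      using that by (subst sum_symp_entry) auto
    ultimately show ?thesis using that by (simp add: add_eq_0_iff)
  qed
  have "Xm x $$ (i, j) = - Xm x $$ (j - n, i - n)" if "\<not> i < n" "\<not> j < n"
    using skew[of "i - n" "j - n"] that ij by simp
  then show "Xm x $$ (i, j) = X_mat (blockA x) (blockC x) (blockD x) $$ (i, j)"
    using ij by (auto simp: X_mat_def blockA_def blockC_def blockD_def)
qed (auto simp: X_mat_def blockA_def Xm_def)

definition rho :: "'v \<Rightarrow> nat \<Rightarrow> 'k" where "rho x i = hc (br (e i) x)"

lemma br_e_Q:
  assumes x: "x \<in> Q" and i: "i < 2 * n"
  shows "br (e i) x = scale (rho x i) H - (\<Sum>j<2 * n. scale (m x i j) (e j))"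
proof -
  have *: "br (e i) x = scale (sq x (e i)) H - (\<Sum>j<2 * n. scale (m x i j) (e j))"
    unfolding br_swap[of "e i" x] br_Q_e[OF assms] ..
  have "rho x i = sq x (e i)"
    unfolding rho_def * by (simp add: hc_diff scale_H_in_N comb_in_N hc_scale H_in_N hc_H hc_comb)
  then show ?thesis using * by simp
qed

text \<open>From [x,[e_i,x]] = [[x,e_i],x] + [e_i,[x,x]]: the last term vanishes since [x,x] lies in
  FH. The left side has no H-coordinate because x is normalised and kills H; that of the right side
  is the i-th entry of the matrix applied to rho.\<close>

lemma rho_in_kernel:
  assumes x: "x \<in> Q" and lam: "lam x = 0" and i: "i < 2 * n"
  shows "(\<Sum>j<2 * n. m x i j * rho x j) = 0"
proof -
  have xx: "br (e i) (br x x) = 0"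
    by (subst br_Q_Q(1)[OF x x]) (simp add: br_scale_right br_N_H e_in_N i)
  have "br x (br (e i) x) = br (br x (e i)) x" using left_leibniz[of x "e i" x] xx by simp
  also have "\<dots> = (\<Sum>j<2 * n. scale (m x i j) (br (e j) x))"
    by (simp add: br_Q_e[OF x i] br_sum_left br_scale_left)
  finally have "hc (br x (br (e i) x)) = (\<Sum>j<2 * n. m x i j * rho x j)"
    by (simp add: hc_sum hc_scale br_in_nilradical rho_def subspace_scale[OF subspace_N])
  moreover have "br x (br (e i) x) = - br x (\<Sum>j<2 * n. scale (m x i j) (e j))"
    unfolding br_e_Q[OF x i] by (simp add: br_diff_right br_scale_right br_x_H lam)
  moreover have "hc (- br x (\<Sum>j<2 * n. scale (m x i j) (e j))) = 0"
  proof -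
    have "- br x (\<Sum>j<2 * n. scale (m x i j) (e j)) = (\<Sum>j<2 * n. scale (- m x i j) (br x (e j)))"
      by (simp add: br_sum_right br_scale_right sum_negf)
    then show ?thesis
      using x by (simp only:) (subst hc_sum,
        auto simp: hc_scale br_in_nilradical subspace_scale[OF subspace_N] subspace_neg[OF subspace_N] Q_def
          simp del: scale_minus_left)
  qed
  ultimately show ?thesis by simp
qed

lemma acts_by_hl:
  assumes "T H = scale (M $$ (0, 0)) H + (\<Sum>j<2 * n. scale (M $$ (0, Suc j)) (e j))"
    and "\<And>i. i < 2 * n \<Longrightarrow>
      T (e i) = scale (M $$ (Suc i, 0)) H + (\<Sum>j<2 * n. scale (M $$ (Suc i, Suc j)) (e j))"
  shows "acts_by T hl M"
  unfolding acts_by_def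
proof (intro allI impI)
  fix i assume "i < length hl"
  then show "T (hl ! i) = (\<Sum>j<length hl. scale (M $$ (i, j)) (hl ! j))"
    unfolding sum_hl using assms by (cases i) (auto simp: length_hl hl_0 hl_Suc)
qed

lemma left_action:
  assumes x: "x \<in> Q"
  shows "acts_by (br x) hl (left_mat n (lam x / 2) (blockA x) (blockC x) (blockD x))"
proof (rule acts_by_hl)
  show "br x H = scale (left_mat n (lam x / 2) (blockA x) (blockC x) (blockD x) $$ (0, 0)) H
      + (\<Sum>j<2 * n. scale (left_mat n (lam x / 2) (blockA x) (blockC x) (blockD x) $$ (0, Suc j)) (e j))"
    by (simp add: left_mat_index[OF block_carrier] br_x_H)
  fix i assume i: "i < 2 * n"
  show "br x (e i) = scale (left_mat n (lam x / 2) (blockA x) (blockC x) (blockD x) $$ (Suc i, 0)) H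
      + (\<Sum>j<2 * n. scale (left_mat n (lam x / 2) (blockA x) (blockC x) (blockD x) $$ (Suc i, Suc j)) (e j))"
    unfolding br_Q_e[OF x i] using i
    by (auto simp: left_mat_index[OF block_carrier] Xm_blocks[symmetric] Xm_def intro!: sum.cong)
qed

definition rho1 :: "'v \<Rightarrow> 'k vec" where "rho1 x = vec n (rho x)"

definition rho2 :: "'v \<Rightarrow> 'k vec" where "rho2 x = vec n (\<lambda>i. rho x (n + i))"

lemma rho_carrier: "rho1 x \<in> carrier_vec n" "rho2 x \<in> carrier_vec n"
  by (auto simp: rho1_def rho2_def)

lemma rho_append: "i < 2 * n \<Longrightarrow> (rho1 x @\<^sub>v rho2 x) $ i = rho x i"
  by (auto simp: rho1_def rho2_def not_less)

lemma right_action: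
  assumes x: "x \<in> Q"
  shows "acts_by (\<lambda>y. br y x) hl
    (right_mat n (lam x / 2) (blockA x) (blockC x) (blockD x) (rho1 x) (rho2 x))"
proof (rule acts_by_hl)
  let ?R = "right_mat n (lam x / 2) (blockA x) (blockC x) (blockD x) (rho1 x) (rho2 x)"
  show "br H x = scale (?R $$ (0, 0)) H + (\<Sum>j<2 * n. scale (?R $$ (0, Suc j)) (e j))"
    by (simp add: right_mat_index[OF block_carrier rho_carrier] br_H_x)
  fix i assume i: "i < 2 * n"
  have "(\<Sum>j<2 * n. scale (?R $$ (Suc i, Suc j)) (e j)) = (\<Sum>j<2 * n. - scale (m x i j) (e j))"
    using i by (intro sum.cong)
      (auto simp: right_mat_index[OF block_carrier rho_carrier] Xm_blocks[symmetric] Xm_def)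
  then show "br (e i) x = scale (?R $$ (Suc i, 0)) H + (\<Sum>j<2 * n. scale (?R $$ (Suc i, Suc j)) (e j))"
    unfolding br_e_Q[OF x i] using i
    by (simp add: right_mat_index[OF block_carrier rho_carrier] rho_append sum_negf)
qed

lemma rho_mat_kernel:
  assumes "x \<in> Q" "lam x = 0"
  shows "rho1 x @\<^sub>v rho2 x \<in> mat_kernel (Xm x)"
proof (rule mat_kernelI[OF Xm_carrier])
  show "rho1 x @\<^sub>v rho2 x \<in> carrier_vec (2 * n)"
    unfolding mult_2 by (intro append_carrier_vec rho_carrier)
  then have dim: "dim_vec (rho1 x @\<^sub>v rho2 x) = 2 * n" by (rule carrier_vecD)
  show "Xm x *\<^sub>v (rho1 x @\<^sub>v rho2 x) = 0\<^sub>v (2 * n)"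
  proof (rule eq_vecI)
    fix i assume "i < dim_vec (0\<^sub>v (2 * n) :: 'k vec)"
    then have i: "i < 2 * n" by simp
    have "(Xm x *\<^sub>v (rho1 x @\<^sub>v rho2 x)) $ i = (\<Sum>j<2 * n. m x i j * rho x j)"
      using i dim rho_append[of _ x]
      by (simp add: Xm_eq_Mm[OF assms(2)] Mm_def scalar_prod_def lessThan_atLeast0 del: index_append_vec)
    then show "(Xm x *\<^sub>v (rho1 x @\<^sub>v rho2 x)) $ i = 0\<^sub>v (2 * n) $ i"
      using i by (simp add: rho_in_kernel[OF assms i])
  qed (simp add: Xm_def)
qed

text \<open>Anticommutators are multiples of H and annihilate z from the left, whereas [H,z] = -
  lam(z) H is nonzero.\<close>

lemma lie_if_lam_nonzero:
  assumes "lam z \<noteq> 0"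
  shows is_lie
  unfolding is_lie_def
proof (intro allI)
  fix x y
  have "br (scale (sq x y) H) z = 0"
    using anticommutator_left_annihilates[of x y z] unfolding anticommutator .
  then have "sq x y = 0" using assms H_nonzero by (simp add: br_scale_left br_H_x)
  then show "br x y = - br y x" using anticommutator[of x y] by (simp add: eq_neg_iff_add_eq_0)
qed

lemma rho_zero_if_lie:
  assumes is_lie "x \<in> Q"
  shows "rho1 x = 0\<^sub>v n" "rho2 x = 0\<^sub>v n"
proof -
  have "rho x i = 0" if "i < 2 * n" for i
  proof -
    have "br (e i) x = br (- x) (e i)"
      unfolding br_minus_left using assms(1)[unfolded is_lie_def] by blast
    moreover have "- x \<in> Q" by (rule subspace_neg[OF subspace_Q assms(2)])
    ultimately show ?thesis using that by (simp add: rho_def Q_def)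
  qed
  then show "rho1 x = 0\<^sub>v n" "rho2 x = 0\<^sub>v n" by (auto simp: rho1_def rho2_def)
qed

text \<open>A nilpotent combination is the matrix of the same combination x of basis vectors, so x
  lies in N; but those vectors are independent modulo N. The map g translates index sets starting at
  1 or 2 into list positions.\<close>

lemma lin_nilindependent_Xm:
  assumes L: "distinct (Ss @ hl)" "independent (set (Ss @ hl))" and Ss: "set Ss \<subseteq> Q"
    and I: "finite I" "inj_on g I" "g ` I \<subseteq> {..<length Ss}" and lam: "\<And>i. i \<in> I \<Longrightarrow> lam (Ss ! g i) = 0"
  shows "lin_nilindependent (2 * n) I (\<lambda>i. Xm (Ss ! g i))"
  unfolding lin_nilindependent_def
proof (intro allI impI)
  fix c assume nil: "nilpotent_mat (lin_comb_mat (2 * n) I c (\<lambda>i. Xm (Ss ! g i)))"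
  define x where "x = (\<Sum>i\<in>I. scale (c i) (Ss ! g i))"
  have SQ: "Ss ! g i \<in> Q" if "i \<in> I" for i using Ss I that by (auto intro: nth_mem)
  have "x \<in> Q"
    unfolding x_def using SQ by (intro subspace_sum[OF subspace_Q] subspace_scale[OF subspace_Q])
  moreover have "lam x = 0" by (simp add: x_def lam_sum lam_scale lam)
  moreover have "Mm x = lin_comb_mat (2 * n) I c (\<lambda>i. Xm (Ss ! g i))"
    by (auto simp: Mm_def lin_comb_mat_def x_def m_sum m_scale Xm_eq_Mm lam intro!: eq_matI sum.cong)
  ultimately have x: "x \<in> N" using nil by (intro nilpotent_action_in_N) auto
  let ?L = "Ss @ hl"
  note co = coord_sum[OF L] coord_scale[OF L] coord_add[OF L]
  have Ssp: "Ss ! i \<in> span (set ?L)" if "i < length Ss" for i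
    using that by (intro span_base) auto
  have hsp: "hl ! i \<in> span (set ?L)" if "i < length hl" for i
    using that by (intro span_base) auto
  show "\<forall>i\<in>I. c i = 0"
  proof
    fix i assume i: "i \<in> I"
    then have il: "g i < length Ss" using I by auto
    have "coord ?L x (g i) = (\<Sum>j\<in>I. c j * coord ?L (Ss ! g j) (g i))"
      unfolding x_def using I Ssp by (subst co(1)) (auto simp: co(2) intro!: span_scale sum.cong)
    also have "\<dots> = (\<Sum>j\<in>I. if j = i then c i else 0)"
    proof (intro sum.cong refl)
      fix j assume "j \<in> I"
      then have jl: "g j < length Ss" and gj: "g j = g i \<longleftrightarrow> j = i" using I i by (auto dest: inj_onD)
      have "coord ?L (?L ! g j) (g i) = (if j = i then 1 else 0)"
        using il jl gj by (subst coord_nth[OF L]) auto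
      then show "c j * coord ?L (Ss ! g j) (g i) = (if j = i then c i else 0)"
        using jl by (simp add: nth_append split: if_splits)
    qed
    also have "\<dots> = c i" using i I(1) by simp
    \<comment> \<open>The same coordinate is now computed from x as an element of N, where it is
      0.\<close>
    finally have 1: "coord ?L x (g i) = c i" .
    have "x = (\<Sum>j<length hl. scale (coord hl x j) (hl ! j))"
      using coord_expand[OF hl_props(1,2)] x hl_props(3) by simp
    from arg_cong[OF this, of "\<lambda>x. coord ?L x (g i)"]
    have "coord ?L x (g i) = (\<Sum>j<length hl. coord ?L (scale (coord hl x j) (hl ! j)) (g i))"
      using hsp by (subst (asm) co(1)) (auto intro!: span_scale)
    also have "\<dots> = (\<Sum>j<length hl. coord hl x j * coord ?L (hl ! j) (g i))"
      using hsp by (intro sum.cong refl co(2)) simp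
    also have "\<dots> = 0"
    proof (intro sum.neutral ballI)
      fix j assume "j \<in> {..<length hl}"
      then have "coord ?L (?L ! (length Ss + j)) (g i) = 0" using il by (subst coord_nth[OF L]) auto
      then show "coord hl x j * coord ?L (hl ! j) (g i) = 0" by (simp add: nth_append)
    qed
    finally show "c i = 0" using 1 by simp
  qed
qed

section \<open>Choice of an adapted basis and assembly of the structure\<close>

lemma extend_hl:
  assumes ts: "distinct (ts @ hl)" "independent (set (ts @ hl))"
    and sp: "\<And>x. x \<in> span (set (ts @ hl) \<union> Q')"
  obtains ss where "set ss \<subseteq> Q'" "distinct ((ts @ ss) @ hl)" "independent (set ((ts @ ss) @ hl))"
    "span (set ((ts @ ss) @ hl)) = UNIV"
proof -
  \<comment> \<open>Extending inside this union makes every new basis vector an element of Q', so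
    the normalisations encoded in Q' survive.\<close>
  obtain S where S: "set (ts @ hl) \<subseteq> S" "S \<subseteq> set (ts @ hl) \<union> Q'" "independent S"
    "set (ts @ hl) \<union> Q' \<subseteq> span S"
    using maximal_independent_subset_extend[OF _ ts(2), of "set (ts @ hl) \<union> Q'"] by blast
  obtain ss where ss: "distinct ss" "set ss = S - set (ts @ hl)"
    using finite_distinct_list[of "S - set (ts @ hl)"] independent_finite[OF S(3)] by blast
  have set: "set ((ts @ ss) @ hl) = S" using ss(2) S(1) by auto
  have "span (set (ts @ hl) \<union> Q') \<subseteq> span S" by (rule span_minimal[OF S(4) subspace_span])
  then have "span S = UNIV" using sp by blast
  moreover have "set ss \<subseteq> Q'" using ss(2) S(2) by blast
  moreover have "distinct ((ts @ ss) @ hl)" using ss ts(1) by auto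
  ultimately show thesis using that[of ss] S(3) unfolding set by blast
qed

text \<open>Splits on whether the functional \<open>lam\<close> vanishes. If not, one vector s
  carries it, and the others are corrected by multiples of s and H.\<close>

lemma exists_adapted_basis:
  obtains Ss where "distinct (Ss @ hl)" "independent (set (Ss @ hl))" "span (set (Ss @ hl)) = UNIV"
    "set Ss \<subseteq> Q" "\<forall>x\<in>set Ss. lam x = 0"
  | s Ss where "distinct ((s # Ss) @ hl)" "independent (set ((s # Ss) @ hl))"
    "span (set ((s # Ss) @ hl)) = UNIV" "set (s # Ss) \<subseteq> Q" "lam s = 2"
    "\<forall>x\<in>set Ss. lam x = 0 \<and> br s x = 0"
proof (cases "\<exists>z. lam z \<noteq> 0")
  case False
  have sp: "x \<in> span (set ([] @ hl) \<union> Q)" for x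
  proof -
    obtain w where w: "w \<in> N" "x - w \<in> Q" using exists_Q_translate by blast
    have "w \<in> span (set hl \<union> Q)" using w(1) hl_props(3) span_mono[of "set hl" "set hl \<union> Q"] by auto
    moreover have "x - w \<in> span (set hl \<union> Q)" using w(2) by (intro span_base) simp
    ultimately have "(x - w) + w \<in> span (set hl \<union> Q)" by (intro span_add)
    then show ?thesis by simp
  qed
  obtain ss where "set ss \<subseteq> Q" "distinct (([] @ ss) @ hl)" "independent (set (([] @ ss) @ hl))"
    "span (set (([] @ ss) @ hl)) = UNIV"
    using extend_hl[of "[]" Q, OF _ _ sp] hl_props by auto
  then show thesis using False by (intro that(1)[of ss]) auto
next
  case True
  then obtain z where z: "lam z \<noteq> 0" by blast
  obtain w where w: "w \<in> N" "z - w \<in> Q" using exists_Q_translate by blast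
  \<comment> \<open>The value 2 makes a_1 = lam(s)/2 equal to 1.\<close>
  define s where "s = scale (2 / lam z) (z - w)"
  have sQ: "s \<in> Q" unfolding s_def by (rule subspace_scale[OF subspace_Q w(2)])
  have lam_s: "lam s = 2" using z by (simp add: s_def lam_scale lam_diff lam_N[OF w(1)])
  have sN: "s \<notin> N" using lam_s lam_N by force
  define Q' where "Q' = {x \<in> Q. lam x = 0 \<and> br s x = 0}"
  have HQ: "H \<in> Q" by (simp add: Q_def br_H_N e_in_N hc_zero)
  have ts: "distinct ([s] @ hl)" "independent (set ([s] @ hl))"
    using hl_props sN span_base[of s "set hl"] by (auto simp: independent_insert)
  have sp: "x \<in> span (set ([s] @ hl) \<union> Q')" for x
  proof -
    let ?V = "span (set ([s] @ hl) \<union> Q')"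
    obtain w where w: "w \<in> N" "x - w \<in> Q" using exists_Q_translate by blast
    define q where "q = x - w - scale (lam x / 2) s"
    have q: "q \<in> Q" unfolding q_def by (intro subspace_diff[OF subspace_Q] subspace_scale[OF subspace_Q] w sQ)
    have lq: "lam q = 0" by (simp add: q_def lam_diff lam_scale lam_s lam_N[OF w(1)])
    define h where "h = hc (br s q)"
    have sq: "br s q = scale h H" unfolding h_def by (rule br_Q_Q(1)[OF sQ q])
    \<comment> \<open>Since [s,H] = 2H, subtracting (h/2) H removes [s,q] = h H without disturbing
      the other normalisations.\<close>
    have "q - scale (h / 2) H \<in> Q'"
      using q HQ sq lq
      by (simp add: Q'_def subspace_diff[OF subspace_Q] subspace_scale[OF subspace_Q] lam_diff lam_scale
          lam_N[OF H_in_N] br_diff_right br_scale_right br_x_H lam_s)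
    then have 1: "q - scale (h / 2) H \<in> ?V" by (intro span_base) simp
    have N: "u \<in> ?V" if "u \<in> N" for u
      using that hl_props(3) span_mono[of "set hl" "set ([s] @ hl) \<union> Q'"] by auto
    have 2: "scale (h / 2) H + w \<in> ?V" by (intro N subspace_add[OF subspace_N] scale_H_in_N w)
    have 3: "scale (lam x / 2) s \<in> ?V" by (intro span_scale span_base) simp
    have "x = (q - scale (h / 2) H) + (scale (h / 2) H + w) + scale (lam x / 2) s"
      by (simp add: q_def)
    then show ?thesis using span_add[OF span_add[OF 1 2] 3] by simp
  qed
  obtain ss where ss: "set ss \<subseteq> Q'" "distinct (([s] @ ss) @ hl)" "independent (set (([s] @ ss) @ hl))"
    "span (set (([s] @ ss) @ hl)) = UNIV"
    using extend_hl[OF ts sp] by blast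
  show thesis
    using ss sQ lam_s by (intro that(2)[of s ss]) (auto simp: Q'_def)
qed

text \<open>Left multiplication by s kills x and y, hence also [x,y]; but it acts on FH, where [x,y]
  lies, as multiplication by 2.\<close>

lemma adapted_brackets_vanish:
  assumes lie: is_lie and s: "lam s = 2" "s \<in> Q"
    and Ss: "\<And>x. x \<in> set Ss \<Longrightarrow> x \<in> Q \<and> lam x = 0 \<and> br s x = 0"
    and xy: "x \<in> set (s # Ss)" "y \<in> set (s # Ss)"
  shows "br x y = 0"
proof -
  have anti: "br x y = - br y x" for x y using lie[unfolded is_lie_def] by blast
  have self: "br x x = 0" for x
  proof -
    have "scale (2::'k) (br x x) = br x x + br x x" by (metis scale_left_distrib one_add_one scale_one)
    also have "\<dots> = 0" using anti[of x x] by (metis add.right_inverse)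
    finally show ?thesis by simp
  qed
  have s0: "br s z = 0" if "z \<in> set (s # Ss)" for z using that Ss self by auto
  show ?thesis
  proof (cases "x = s \<or> y = s")
    case True
    then show ?thesis using s0 xy anti[of x s] by auto
  next
    case False
    then have "x \<in> Q" "y \<in> Q" using xy Ss by auto
    then have r: "br x y = scale (hc (br x y)) H" by (rule br_Q_Q(1))
    have "br s (br x y) = 0" using left_leibniz[of s x y] s0[OF xy(1)] s0[OF xy(2)] by simp
    then have "scale (hc (br x y) * 2) H = 0" by (subst (asm) r) (simp add: br_scale_right br_x_H s(1))
    then show ?thesis using r H_nonzero by simp
  qed
qed

text \<open>Common assembly for both kinds of adapted basis; the first entry alone decides between
  a_1 = 0 and a_1 = 1.\<close>

lemma structure_from_adapted_basis:
  assumes L: "distinct (Ss @ hl)" "independent (set (Ss @ hl))" "span (set (Ss @ hl)) = UNIV"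
    and SQ: "set Ss \<subseteq> Q"
    and lam_hd: "lam (Ss ! 0) = 0 \<or> lam (Ss ! 0) = 2"
    and lam_tl: "\<And>i. 0 < i \<Longrightarrow> i < length Ss \<Longrightarrow> lam (Ss ! i) = 0"
    and lie: "lam (Ss ! 0) = 2 \<Longrightarrow> is_lie \<and> (\<forall>x\<in>set Ss. \<forall>y\<in>set Ss. br x y = 0)"
    and proper: "N \<noteq> UNIV"
  shows "\<exists>f. 1 \<le> f \<and> f \<le> n + 1 \<and> dim (UNIV :: 'v set) = 2 * n + 1 + f \<and>
    (\<exists>(S :: nat \<Rightarrow> 'v) (P :: nat \<Rightarrow> 'v) (B :: nat \<Rightarrow> 'v) (H :: 'v)
       (a :: nat \<Rightarrow> 'k) (A :: nat \<Rightarrow> 'k mat) (C :: nat \<Rightarrow> 'k mat) (D :: nat \<Rightarrow> 'k mat)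
       (\<rho>1 :: nat \<Rightarrow> 'k vec) (\<rho>2 :: nat \<Rightarrow> 'k vec) (r :: nat \<Rightarrow> nat \<Rightarrow> 'k) (X :: nat \<Rightarrow> 'k mat).
      is_basis (map S [1..<Suc f] @ map P [0..<n] @ map B [0..<n] @ [H]) UNIV \<and>
      heisenberg_basis n H P B N \<and>
      (\<forall>\<alpha>\<in>{1..f}. \<forall>\<beta>\<in>{1..f}. br (S \<alpha>) (S \<beta>) = scale (r \<alpha> \<beta>) H) \<and>
      (\<forall>\<alpha>\<in>{1..f}. A \<alpha> \<in> carrier_mat n n \<and> C \<alpha> \<in> carrier_mat n n \<and> D \<alpha> \<in> carrier_mat n n \<and>
         \<rho>1 \<alpha> \<in> carrier_vec n \<and> \<rho>2 \<alpha> \<in> carrier_vec n \<and>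
         acts_by (\<lambda>x. br (S \<alpha>) x) (heis_list n H P B)
           (left_mat n (a \<alpha>) (A \<alpha>) (C \<alpha>) (D \<alpha>)) \<and>
         acts_by (\<lambda>x. br x (S \<alpha>)) (heis_list n H P B)
           (right_mat n (a \<alpha>) (A \<alpha>) (C \<alpha>) (D \<alpha>) (\<rho>1 \<alpha>) (\<rho>2 \<alpha>))) \<and>
      (\<forall>\<alpha>\<in>{1..f}. X \<alpha> = X_mat (A \<alpha>) (C \<alpha>) (D \<alpha>) \<and> X \<alpha> \<in> sp n) \<and>
      (\<forall>\<alpha>\<in>{1..f}. \<forall>\<beta>\<in>{1..f}. X \<alpha> * X \<beta> = X \<beta> * X \<alpha>) \<and>
      a 1 \<in> {0, 1} \<and> (\<forall>\<alpha>\<in>{2..f}. a \<alpha> = 0) \<and>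
      (a 1 = 1 \<longrightarrow>
         lin_nilindependent (2 * n) {2..f} X \<and>
         (\<forall>\<alpha>\<in>{1..f}. \<forall>\<beta>\<in>{1..f}. r \<alpha> \<beta> = 0) \<and>
         (\<forall>\<alpha>\<in>{1..f}. \<rho>1 \<alpha> = 0\<^sub>v n \<and> \<rho>2 \<alpha> = 0\<^sub>v n) \<and>
         is_lie) \<and>
      (a 1 = 0 \<longrightarrow>
         lin_nilindependent (2 * n) {1..f} X \<and>
         (\<forall>\<alpha>\<in>{1..f}. \<rho>1 \<alpha> @\<^sub>v \<rho>2 \<alpha> \<in> mat_kernel (X \<alpha>))))"
proof -
  define f where "f = length Ss"
  define S where "S \<alpha> = Ss ! (\<alpha> - 1)" for \<alpha>
  have S_in: "S \<alpha> \<in> set Ss" if "\<alpha> \<in> {1..f}" for \<alpha>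
    unfolding S_def using that by (intro nth_mem) (auto simp: f_def)
  have S_Q: "S \<alpha> \<in> Q" if "\<alpha> \<in> {1..f}" for \<alpha> using S_in[OF that] SQ by blast
  have Ss_ne: "Ss \<noteq> []" using L(3) hl_props(3) proper by auto
  then have f1: "1 \<le> f" by (simp add: f_def Suc_le_eq)
  have lam_S: "lam (S \<alpha>) = 0" if "\<alpha> \<in> {2..f}" for \<alpha>
    unfolding S_def using that by (intro lam_tl) (auto simp: f_def)
  have lam_S1: "lam (S 1) = 0 \<or> lam (S 1) = 2" using lam_hd by (simp add: S_def)
  have map_S: "map S [1..<Suc f] = Ss"
    by (rule nth_equalityI) (auto simp: f_def S_def simp del: upt_Suc)
  let ?bs = "map S [1..<Suc f] @ map P [0..<n] @ map B [0..<n] @ [H]"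
  have set_bs: "set ?bs = set (Ss @ hl)" unfolding map_S by (auto simp: heis_list_def)
  have dist_bs: "distinct ?bs" unfolding map_S using L(1) by (auto simp: heis_list_def)
  have basis: "is_basis ?bs UNIV"
    unfolding is_basis_def set_bs using dist_bs L(2,3) by blast
  have "dim (UNIV :: 'v set) = card (set ?bs)"
    unfolding set_bs using L(2,3) by (intro basis_card_eq_dim[symmetric]) auto
  also have "\<dots> = 2 * n + 1 + f"
    unfolding distinct_card[OF dist_bs] by simp
  finally have dim: "dim (UNIV :: 'v set) = 2 * n + 1 + f" .
  define X where "X \<alpha> = Xm (S \<alpha>)" for \<alpha>
  have nilindep: "lin_nilindependent (2 * n) I X"
    if "I \<subseteq> {1..f}" "\<And>\<alpha>. \<alpha> \<in> I \<Longrightarrow> lam (S \<alpha>) = 0" for I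
    unfolding X_def S_def
  proof (rule lin_nilindependent_Xm[OF L(1,2) SQ])
    show "finite I" using that(1) finite_subset by blast
    show "inj_on (\<lambda>\<alpha>. \<alpha> - 1) I" by (rule inj_on_diff_nat) (use that(1) in auto)
    show "(\<lambda>\<alpha>. \<alpha> - 1) ` I \<subseteq> {..<length Ss}" using that(1) f1 by (fastforce simp: f_def)
    show "lam (Ss ! (\<alpha> - 1)) = 0" if "\<alpha> \<in> I" for \<alpha>
      using \<open>\<And>\<alpha>. \<alpha> \<in> I \<Longrightarrow> lam (S \<alpha>) = 0\<close>[OF that] by (simp add: S_def)
  qed
  obtain \<phi> :: "'k \<Rightarrow> complex" where \<phi>: "complex_embedding \<phi>" using exists_complex_embedding by blast
  \<comment> \<open>Index 1 is left out because \<open>lam\<close> may be nonzero there; bounding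
    the remaining f - 1 matrices covers both cases and yields f \<le> n + 1.\<close>
  have "card {2..f} \<le> n"
    using lam_S nilindep[of "{2..f}"]
    by (intro complex_embedding.card_lin_nilindependent_le[OF \<phi>, of _ X])
      (auto simp: X_def Xm_sp intro!: Xm_commute S_Q)
  then have fn: "f \<le> n + 1" by simp
  have nil1: "lin_nilindependent (2 * n) {1..f} X" if "lam (S 1) = 0"
  proof (rule nilindep)
    fix \<alpha> assume "\<alpha> \<in> {1..f}"
    then have "\<alpha> = 1 \<or> \<alpha> \<in> {2..f}" by auto
    then show "lam (S \<alpha>) = 0" using that lam_S by blast
  qed simp
  have nil2: "lin_nilindependent (2 * n) {2..f} X" by (rule nilindep) (use lam_S in auto)
  have kernel: "rho1 (S \<alpha>) @\<^sub>v rho2 (S \<alpha>) \<in> mat_kernel (X \<alpha>)"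
    if "lam (S 1) = 0" "\<alpha> \<in> {1..f}" for \<alpha>
  proof -
    have "\<alpha> = 1 \<or> \<alpha> \<in> {2..f}" using that(2) by auto
    then have "lam (S \<alpha>) = 0" using that(1) lam_S by blast
    then show ?thesis unfolding X_def by (rule rho_mat_kernel[OF S_Q[OF that(2)]])
  qed
  have lie': "is_lie \<and> (\<forall>\<alpha>\<in>{1..f}. \<forall>\<beta>\<in>{1..f}. hc (br (S \<alpha>) (S \<beta>)) = 0) \<and>
      (\<forall>\<alpha>\<in>{1..f}. rho1 (S \<alpha>) = 0\<^sub>v n \<and> rho2 (S \<alpha>) = 0\<^sub>v n)" if "lam (S 1) = 2"
    using lie that S_in S_Q rho_zero_if_lie by (simp add: S_def hc_zero)
  show ?thesis
  proof (rule exI[of _ f], intro conjI f1 fn dim,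
      rule exI[of _ S], rule exI[of _ P], rule exI[of _ B], rule exI[of _ H],
      rule exI[of _ "\<lambda>\<alpha>. lam (S \<alpha>) / 2"],
      rule exI[of _ "\<lambda>\<alpha>. blockA (S \<alpha>)"], rule exI[of _ "\<lambda>\<alpha>. blockC (S \<alpha>)"],
      rule exI[of _ "\<lambda>\<alpha>. blockD (S \<alpha>)"],
      rule exI[of _ "\<lambda>\<alpha>. rho1 (S \<alpha>)"], rule exI[of _ "\<lambda>\<alpha>. rho2 (S \<alpha>)"],
      rule exI[of _ "\<lambda>\<alpha> \<beta>. hc (br (S \<alpha>) (S \<beta>))"], rule exI[of _ X], intro conjI ballI impI)
    show "is_basis ?bs UNIV" by (rule basis)
    show "heisenberg_basis n H P B N" by (rule heis)
    show "lam (S 1) / 2 \<in> {0, 1}" using lam_S1 by auto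
    show "lam (S \<alpha>) / 2 = 0" if "\<alpha> \<in> {2..f}" for \<alpha> using lam_S[OF that] by simp
    show "lin_nilindependent (2 * n) {2..f} X" by (rule nil2)
    show "lin_nilindependent (2 * n) {1..f} X" if "lam (S 1) / 2 = 0" using nil1 that by simp
    fix \<alpha> assume \<alpha>: "\<alpha> \<in> {1..f}"
    show "acts_by (br (S \<alpha>)) hl (left_mat n (lam (S \<alpha>) / 2) (blockA (S \<alpha>)) (blockC (S \<alpha>)) (blockD (S \<alpha>)))"
      by (rule left_action[OF S_Q[OF \<alpha>]])
    show "acts_by (\<lambda>x. br x (S \<alpha>)) hl (right_mat n (lam (S \<alpha>) / 2) (blockA (S \<alpha>)) (blockC (S \<alpha>))
        (blockD (S \<alpha>)) (rho1 (S \<alpha>)) (rho2 (S \<alpha>)))"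
      by (rule right_action[OF S_Q[OF \<alpha>]])
    show "rho1 (S \<alpha>) @\<^sub>v rho2 (S \<alpha>) \<in> mat_kernel (X \<alpha>)" if "lam (S 1) / 2 = 0"
      using kernel[OF _ \<alpha>] that by simp
    show "br (S \<alpha>) (S \<beta>) = scale (hc (br (S \<alpha>) (S \<beta>))) H" if "\<beta> \<in> {1..f}" for \<beta>
      by (rule br_Q_Q(1)[OF S_Q[OF \<alpha>] S_Q[OF that]])
    show "X \<alpha> * X \<beta> = X \<beta> * X \<alpha>" if "\<beta> \<in> {1..f}" for \<beta>
      unfolding X_def by (rule Xm_commute[OF S_Q[OF \<alpha>] S_Q[OF that]])
    show "hc (br (S \<alpha>) (S \<beta>)) = 0" if "lam (S 1) / 2 = 1" "\<beta> \<in> {1..f}" for \<beta>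
      using lie' \<alpha> that by simp
  qed (use lie' in \<open>auto simp: block_carrier rho_carrier X_def Xm_sp Xm_blocks[symmetric]\<close>)
qed

end

theorem theorem3p1:
  fixes scale :: "'k::real_or_complex \<Rightarrow> 'v::ab_group_add \<Rightarrow> 'v"
    and br :: "'v \<Rightarrow> 'v \<Rightarrow> 'v"
    and n :: nat and N :: "'v set"
  assumes "leibniz_algebra scale br"
    and "1 \<le> n"
    and "leibniz_algebra.indecomposable scale br"
    and "leibniz_algebra.solvable scale br"
    and "leibniz_algebra.is_nilradical scale br N"
    and "leibniz_algebra.isomorphic_to_heisenberg scale br n N"
    and "N \<noteq> UNIV"
  shows "\<exists>f. 1 \<le> f \<and> f \<le> n + 1 \<and> vector_space.dim scale (UNIV :: 'v set) = 2 * n + 1 + f \<and>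
    (\<exists>(S :: nat \<Rightarrow> 'v) (P :: nat \<Rightarrow> 'v) (B :: nat \<Rightarrow> 'v) (H :: 'v)
       (a :: nat \<Rightarrow> 'k) (A :: nat \<Rightarrow> 'k mat) (C :: nat \<Rightarrow> 'k mat) (D :: nat \<Rightarrow> 'k mat)
       (\<rho>1 :: nat \<Rightarrow> 'k vec) (\<rho>2 :: nat \<Rightarrow> 'k vec) (r :: nat \<Rightarrow> nat \<Rightarrow> 'k) (X :: nat \<Rightarrow> 'k mat).
      leibniz_algebra.is_basis scale
        (map S [1..<Suc f] @ map P [0..<n] @ map B [0..<n] @ [H]) UNIV \<and>
      leibniz_algebra.heisenberg_basis scale br n H P B N \<and>
      (\<forall>\<alpha>\<in>{1..f}. \<forall>\<beta>\<in>{1..f}. br (S \<alpha>) (S \<beta>) = scale (r \<alpha> \<beta>) H) \<and>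
      (\<forall>\<alpha>\<in>{1..f}. A \<alpha> \<in> carrier_mat n n \<and> C \<alpha> \<in> carrier_mat n n \<and> D \<alpha> \<in> carrier_mat n n \<and>
         \<rho>1 \<alpha> \<in> carrier_vec n \<and> \<rho>2 \<alpha> \<in> carrier_vec n \<and>
         leibniz_algebra.acts_by scale (\<lambda>x. br (S \<alpha>) x) (leibniz_algebra.heis_list n H P B)
           (left_mat n (a \<alpha>) (A \<alpha>) (C \<alpha>) (D \<alpha>)) \<and>
         leibniz_algebra.acts_by scale (\<lambda>x. br x (S \<alpha>)) (leibniz_algebra.heis_list n H P B)
           (right_mat n (a \<alpha>) (A \<alpha>) (C \<alpha>) (D \<alpha>) (\<rho>1 \<alpha>) (\<rho>2 \<alpha>))) \<and>
      (\<forall>\<alpha>\<in>{1..f}. X \<alpha> = X_mat (A \<alpha>) (C \<alpha>) (D \<alpha>) \<and> X \<alpha> \<in> sp n) \<and>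
      (\<forall>\<alpha>\<in>{1..f}. \<forall>\<beta>\<in>{1..f}. X \<alpha> * X \<beta> = X \<beta> * X \<alpha>) \<and>
      a 1 \<in> {0, 1} \<and> (\<forall>\<alpha>\<in>{2..f}. a \<alpha> = 0) \<and>
      (a 1 = 1 \<longrightarrow>
         lin_nilindependent (2 * n) {2..f} X \<and>
         (\<forall>\<alpha>\<in>{1..f}. \<forall>\<beta>\<in>{1..f}. r \<alpha> \<beta> = 0) \<and>
         (\<forall>\<alpha>\<in>{1..f}. \<rho>1 \<alpha> = 0\<^sub>v n \<and> \<rho>2 \<alpha> = 0\<^sub>v n) \<and>
         leibniz_algebra.is_lie br) \<and>
      (a 1 = 0 \<longrightarrow>
         lin_nilindependent (2 * n) {1..f} X \<and>
         (\<forall>\<alpha>\<in>{1..f}. \<rho>1 \<alpha> @\<^sub>v \<rho>2 \<alpha> \<in> mat_kernel (X \<alpha>))))"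
proof -
  from assms(6) obtain H P B where "leibniz_algebra.heisenberg_basis scale br n H P B N"
    unfolding leibniz_algebra.isomorphic_to_heisenberg_def[OF assms(1)] by blast
  then interpret heisenberg_nilradical scale br n N H P B
    by (intro heisenberg_nilradical.intro heisenberg_nilradical_axioms.intro assms)
  show ?thesis
  proof (cases rule: exists_adapted_basis)
    case (1 Ss)
    have "Ss \<noteq> []" using 1(3) hl_props(3) assms(7) by auto
    then show ?thesis using 1 assms(7) by (intro structure_from_adapted_basis[of Ss]) auto
  next
    case (2 s Ss)
    have lie: is_lie using 2(5) by (intro lie_if_lam_nonzero[of s]) simp
    have "br x y = 0" if "x \<in> set (s # Ss)" "y \<in> set (s # Ss)" for x y
      using 2 by (intro adapted_brackets_vanish[OF lie _ _ _ that]) auto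
    then show ?thesis
      using 2 lie assms(7) by (intro structure_from_adapted_basis[of "s # Ss"]) (auto simp: nth_Cons')
  qed
qed

end
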